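(* Let $s_1,s_2>0$ and $1\le p,q\le\infty$ satisfy $\min\{s_1,s_2\}\ge\max\{1/p,1/2\}$, and let $A>0$. Suppose the kernel $g$ satisfies: there exist $\nu>0$ and constants $0<C_1\le C_2$, independent of $m$ and $u$, such that $C_1|m|^{-2\nu}\le|g_m(u)|^2\le C_2|m|^{-2\nu}$ for all $m$ and all $u\in[0,1]$. Then there is a constant $C>0$, independent of $\varepsilon$, such that as $\varepsilon\to0$, $$R_\varepsilon\big(B^{s_1,s_2}_{p,q}(A)\big)\ge C A^2\left(\frac{\varepsilon^2}{A^2}\right)^{d},\qquad d=\min\left(\frac{2s_2}{2s_2+1},\ \frac{2s_1}{2s_1+2\nu+1},\ \frac{2s_1'}{2s_1'+2\nu}\right),$$ where $s_1'=s_1+\tfrac12-\tfrac1{p'}$ and $p'=\min\{p,2\}$.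
   Context: Model: for $\varepsilon>0$ one observes $y(u,t)=\int_0^1 g(u,t-x)f(u,x)\,dx+\varepsilon z(u,t)$, $u,t\in[0,1]$, where $f,g$ are functions on $[0,1]^2$, periodic (period 1) in the second argument, $g$ is known, and $z$ is a two-dimensional Gaussian white noise (generalized Gaussian field with covariance $\mathbb E[z(u_1,t_1)z(u_2,t_2)]=\delta(t_1-t_2)\delta(u_1-u_2)$). Let $e_m(t)=e^{i2\pi mt}$, $m\in\mathbb Z$, and $g_m(u)=\int_0^1 g(u,t)\overline{e_m(t)}\,dt$. Wavelets: $\{\psi_{j,k}\}$ is a periodized band-limited (Meyer-type) wavelet basis of $L^2[0,1]$ with coarsest level $m_0$ ($\psi_{m_0-1,k}$ denoting the scaling functions), and $\{\eta_{j',k'}\}$ is a periodized compactly supported $s_0$-regular (Daubechies-type) wavelet basis of $L^2[0,1]$ with coarsest level $m_0'$ (similarly with scaling functions at level $m_0'-1$). Any $f\in L^2([0,1]^2)$ is expanded as $f(u,x)=\sum_{j,j'}\sum_{k=0}^{2^j-1}\sum_{k'=0}^{2^{j'}-1}\beta_{j,k,j',k'}\psi_{j,k}(x)\eta_{j',k'}(u)$. Besov ball of mixed regularity: with $s_i^*=s_i+\frac12-\frac1p$, $B^{s_1,s_2}_{p,q}(A)$ is the set of $f\in L^2([0,1]^2)$ with $\Big(\sum_{j,j'}2^{(js_1^*+j's_2^* )q}\big(\sum_{k,k'}|\beta_{j,k,j',k'}|^p\big)^{q/p}\Big)^{1/q}\le A$ (usual modifications if $p$ or $q$ is $\infty$).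 Minimax risk: $R_\varepsilon(V)=\inf_{\tilde f}\sup_{f\in V}\mathbb E\|\tilde f-f\|^2$, where $\|\cdot\|$ is the $L^2$ norm and the infimum is over all estimators $\tilde f$ based on the observation $y$. *)

theory Defs
  imports "HOL-Probability.Probability"
begin

definition sq01 :: "(real \<times> real) set" where
  "sq01 = {0..1} \<times> {0..1}"

text \<open>Functions on [0,1]^2 are curried: h u x, first argument u, second argument x (or t).\<close>

definition L2sq2 :: "(real \<Rightarrow> real \<Rightarrow> real) \<Rightarrow> ennreal" where
  "L2sq2 h = (\<integral>\<^sup>+ z. indicator sq01 z * ennreal ((case_prod h z)\<^sup>2) \<partial>lborel)"

definition L2set2 :: "(real \<Rightarrow> real \<Rightarrow> real) set" where
  "L2set2 = {h. case_prod h \<in> borel_measurable borel \<and> L2sq2 h < \<infinity>}"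

definition ip2 :: "(real \<Rightarrow> real \<Rightarrow> real) \<Rightarrow> (real \<Rightarrow> real \<Rightarrow> real) \<Rightarrow> real" where
  "ip2 h k = (\<integral> z. indicator sq01 z * case_prod h z * case_prod k z \<partial>lborel)"

definition L2set_on :: "real set \<Rightarrow> (real \<Rightarrow> real) set" where
  "L2set_on S = {h. h \<in> borel_measurable borel \<and>
      (\<integral>\<^sup>+ x. indicator S x * ennreal ((h x)\<^sup>2) \<partial>lborel) < \<infinity>}"

definition ip_on :: "real set \<Rightarrow> (real \<Rightarrow> real) \<Rightarrow> (real \<Rightarrow> real) \<Rightarrow> real" where
  "ip_on S h k = (\<integral> x. indicator S x * h x * k x \<partial>lborel)"

definition ONB_on :: "real set \<Rightarrow> 'i set \<Rightarrow> ('i \<Rightarrow> real \<Rightarrow> real) \<Rightarrow> bool" where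
  "ONB_on S I e \<longleftrightarrow>
     (\<forall>i\<in>I. e i \<in> L2set_on S) \<and>
     (\<forall>i\<in>I. \<forall>i'\<in>I. ip_on S (e i) (e i') = (if i = i' then 1 else 0)) \<and>
     (\<forall>h\<in>L2set_on S. (\<forall>i\<in>I. ip_on S h (e i) = 0) \<longrightarrow> ip_on S h h = 0)"

definition wavsys :: "(real \<Rightarrow> real) \<Rightarrow> (real \<Rightarrow> real) \<Rightarrow> (int + nat \<times> int) \<Rightarrow> real \<Rightarrow> real" where
  "wavsys phi psi i x = (case i of
      Inl k \<Rightarrow> phi (x - real_of_int k)
    | Inr (j, k) \<Rightarrow> 2 powr (real j / 2) * psi (2 ^ j * x - real_of_int k))"

definition wavelet_ONB_R :: "(real \<Rightarrow> real) \<Rightarrow> (real \<Rightarrow> real) \<Rightarrow> bool" where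
  "wavelet_ONB_R phi psi \<longleftrightarrow> ONB_on UNIV UNIV (wavsys phi psi)"

definition per :: "(real \<Rightarrow> real) \<Rightarrow> nat \<Rightarrow> int \<Rightarrow> real \<Rightarrow> real" where
  "per h r k x = infsum (\<lambda>n::int. 2 powr (real r / 2) * h (2 ^ r * (x + real_of_int n) - real_of_int k)) UNIV"

text \<open>Index sets of a periodized basis with coarsest level m0: levels j >= m0 - 1; the index
  j = m0 - 1 carries the periodized scaling functions (at resolution m0), the levels j >= m0
  the periodized wavelets; at level j the shifts are k = 0, ..., 2^(max j m0) - 1.\<close>

definition kset :: "int \<Rightarrow> int \<Rightarrow> int set" where
  "kset m0 j = {0..<2 ^ nat (max j m0)}"

definition levels :: "int \<Rightarrow> int set" where
  "levels m0 = {m0 - 1..}"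

definition widx :: "int \<Rightarrow> (int \<times> int) set" where
  "widx m0 = {(j, k). j \<in> levels m0 \<and> k \<in> kset m0 j}"

definition periodized_from :: "int \<Rightarrow> (real \<Rightarrow> real) \<Rightarrow> (real \<Rightarrow> real) \<Rightarrow> (int \<Rightarrow> int \<Rightarrow> real \<Rightarrow> real) \<Rightarrow> bool" where
  "periodized_from m0 phi psi B \<longleftrightarrow>
     (\<forall>k\<in>kset m0 (m0 - 1). B (m0 - 1) k = per phi (nat m0) k) \<and>
     (\<forall>j\<ge>m0. \<forall>k\<in>kset m0 j. B j k = per psi (nat j) k) \<and>
     ONB_on {0..1} (widx m0) (\<lambda>(j, k). B j k)"

definition FT :: "(real \<Rightarrow> real) \<Rightarrow> real \<Rightarrow> complex" where
  "FT h \<omega> = (CLINT x|lborel. complex_of_real (h x) * cis (- \<omega> * x))"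

definition meyer_basis :: "int \<Rightarrow> (int \<Rightarrow> int \<Rightarrow> real \<Rightarrow> real) \<Rightarrow> bool" where
  "meyer_basis m0 B \<longleftrightarrow> 0 \<le> m0 \<and> (\<exists>phi psi.
     wavelet_ONB_R phi psi \<and> integrable lborel phi \<and> integrable lborel psi \<and>
     (\<forall>\<omega>. \<bar>\<omega>\<bar> > 4 * pi / 3 \<longrightarrow> FT phi \<omega> = 0) \<and>
     (\<forall>\<omega>. (\<bar>\<omega>\<bar> < 2 * pi / 3 \<or> \<bar>\<omega>\<bar> > 8 * pi / 3) \<longrightarrow> FT psi \<omega> = 0) \<and>
     periodized_from m0 phi psi B)"

definition Ck_real :: "nat \<Rightarrow> (real \<Rightarrow> real) \<Rightarrow> bool" where
  "Ck_real s h \<longleftrightarrow> (\<forall>i<s. \<forall>x. (deriv ^^ i) h differentiable (at x)) \<and>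
                    continuous_on UNIV ((deriv ^^ s) h)"

definition daub_basis :: "nat \<Rightarrow> int \<Rightarrow> (int \<Rightarrow> int \<Rightarrow> real \<Rightarrow> real) \<Rightarrow> bool" where
  "daub_basis s0 m0 H \<longleftrightarrow> 0 \<le> m0 \<and> (\<exists>phi psi.
     wavelet_ONB_R phi psi \<and>
     (\<exists>R. \<forall>x. \<bar>x\<bar> > R \<longrightarrow> phi x = 0 \<and> psi x = 0) \<and>
     Ck_real s0 phi \<and> Ck_real s0 psi \<and>
     periodized_from m0 phi psi H)"

definition invp :: "ennreal \<Rightarrow> real" where
  "invp p = (if p = \<infinity> then 0 else 1 / enn2real p)"

definition lpn :: "ennreal \<Rightarrow> 'a set \<Rightarrow> ('a \<Rightarrow> real) \<Rightarrow> real" where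
  "lpn p F b = (if p = \<infinity> then Max ((\<lambda>i. \<bar>b i\<bar>) ` F)
                else (\<Sum>i\<in>F. \<bar>b i\<bar> powr enn2real p) powr (1 / enn2real p))"

definition wcoef :: "(int \<Rightarrow> int \<Rightarrow> real \<Rightarrow> real) \<Rightarrow> (int \<Rightarrow> int \<Rightarrow> real \<Rightarrow> real) \<Rightarrow>
    (real \<Rightarrow> real \<Rightarrow> real) \<Rightarrow> int \<Rightarrow> int \<Rightarrow> int \<Rightarrow> int \<Rightarrow> real" where
  "wcoef B H f j k j' k' = ip2 f (\<lambda>u x. B j k x * H j' k' u)"

definition level_weight :: "(int \<Rightarrow> int \<Rightarrow> real \<Rightarrow> real) \<Rightarrow> (int \<Rightarrow> int \<Rightarrow> real \<Rightarrow> real) \<Rightarrow>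
    int \<Rightarrow> int \<Rightarrow> real \<Rightarrow> real \<Rightarrow> ennreal \<Rightarrow> (real \<Rightarrow> real \<Rightarrow> real) \<Rightarrow> int \<Rightarrow> int \<Rightarrow> real" where
  "level_weight B H m0 m0' s1 s2 p f j j' =
     2 powr (real_of_int j * (s1 + 1/2 - invp p) + real_of_int j' * (s2 + 1/2 - invp p)) *
     lpn p (kset m0 j \<times> kset m0' j') (\<lambda>(k, k'). wcoef B H f j k j' k')"

definition besov_ball :: "(int \<Rightarrow> int \<Rightarrow> real \<Rightarrow> real) \<Rightarrow> int \<Rightarrow> (int \<Rightarrow> int \<Rightarrow> real \<Rightarrow> real) \<Rightarrow> int \<Rightarrow>
    real \<Rightarrow> real \<Rightarrow> ennreal \<Rightarrow> ennreal \<Rightarrow> real \<Rightarrow> (real \<Rightarrow> real \<Rightarrow> real) set" where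
  "besov_ball B m0 H m0' s1 s2 p q A =
     {f \<in> L2set2.
        (if q = \<infinity> then
           (\<forall>j\<in>levels m0. \<forall>j'\<in>levels m0'. level_weight B H m0 m0' s1 s2 p f j j' \<le> A)
         else
           (\<integral>\<^sup>+ jj. ennreal (case_prod (level_weight B H m0 m0' s1 s2 p f) jj powr enn2real q)
              \<partial>count_space (levels m0 \<times> levels m0'))
             \<le> ennreal (A powr enn2real q))}"

definition gcoef :: "(real \<Rightarrow> real \<Rightarrow> real) \<Rightarrow> int \<Rightarrow> real \<Rightarrow> complex" where
  "gcoef g m u = (CLINT t|lborel. indicator {0..1} t * complex_of_real (g u t) * cis (- (2 * pi * real_of_int m * t)))"

definition Kop :: "(real \<Rightarrow> real \<Rightarrow> real) \<Rightarrow> (real \<Rightarrow> real \<Rightarrow> real) \<Rightarrow> real \<Rightarrow> real \<Rightarrow> real" where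
  "Kop g f u t = (\<integral> x. indicator {0..1} x * g u (t - x) * f u x \<partial>lborel)"

text \<open>Two-dimensional Gaussian white noise on [0,1]^2, as an isonormal Gaussian process
  W indexed by L^2([0,1]^2): a.s. linear, and W(phi) ~ N(0, ||phi||^2).\<close>

definition white_noise :: "'a measure \<Rightarrow> ('a \<Rightarrow> (real \<Rightarrow> real \<Rightarrow> real) \<Rightarrow> real) \<Rightarrow> bool" where
  "white_noise M W \<longleftrightarrow> prob_space M \<and>
     (\<forall>\<phi>\<in>L2set2. (\<lambda>\<omega>. W \<omega> \<phi>) \<in> borel_measurable M \<and>
        (\<forall>t. char (distr M borel (\<lambda>\<omega>. W \<omega> \<phi>)) t = complex_of_real (exp (- (t\<^sup>2 * ip2 \<phi> \<phi>) / 2)))) \<and>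
     (\<forall>\<phi>\<in>L2set2. \<forall>\<psi>\<in>L2set2. \<forall>a b. AE \<omega> in M.
        W \<omega> (\<lambda>u x. a * \<phi> u x + b * \<psi> u x) = a * W \<omega> \<phi> + b * W \<omega> \<psi>)"

text \<open>The observation y = Kf + eps z, seen through all L^2 test functions.\<close>

definition obs_space :: "((real \<Rightarrow> real \<Rightarrow> real) \<Rightarrow> real) measure" where
  "obs_space = Pi\<^sub>M L2set2 (\<lambda>_. borel)"

definition obs :: "(real \<Rightarrow> real \<Rightarrow> real) \<Rightarrow> (real \<Rightarrow> real \<Rightarrow> real) \<Rightarrow> real \<Rightarrow>
    ('a \<Rightarrow> (real \<Rightarrow> real \<Rightarrow> real) \<Rightarrow> real) \<Rightarrow> 'a \<Rightarrow> (real \<Rightarrow> real \<Rightarrow> real) \<Rightarrow> real" where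
  "obs g f \<epsilon> W \<omega> = restrict (\<lambda>\<phi>. ip2 (Kop g f) \<phi> + \<epsilon> * W \<omega> \<phi>) L2set2"

definition estimators :: "(((real \<Rightarrow> real \<Rightarrow> real) \<Rightarrow> real) \<Rightarrow> real \<Rightarrow> real \<Rightarrow> real) set" where
  "estimators = {fe. (\<lambda>(y, z). fe y (fst z) (snd z)) \<in> borel_measurable (obs_space \<Otimes>\<^sub>M (borel :: (real \<times> real) measure))}"

definition risk :: "'a measure \<Rightarrow> ('a \<Rightarrow> (real \<Rightarrow> real \<Rightarrow> real) \<Rightarrow> real) \<Rightarrow> (real \<Rightarrow> real \<Rightarrow> real) \<Rightarrow> real \<Rightarrow>
    (((real \<Rightarrow> real \<Rightarrow> real) \<Rightarrow> real) \<Rightarrow> real \<Rightarrow> real \<Rightarrow> real) \<Rightarrow> (real \<Rightarrow> real \<Rightarrow> real) \<Rightarrow> ennreal" where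
  "risk M W g \<epsilon> fe f = (\<integral>\<^sup>+ \<omega>. L2sq2 (\<lambda>u x. fe (obs g f \<epsilon> W \<omega>) u x - f u x) \<partial>M)"

definition minimax_risk :: "'a measure \<Rightarrow> ('a \<Rightarrow> (real \<Rightarrow> real \<Rightarrow> real) \<Rightarrow> real) \<Rightarrow> (real \<Rightarrow> real \<Rightarrow> real) \<Rightarrow> real \<Rightarrow>
    (real \<Rightarrow> real \<Rightarrow> real) set \<Rightarrow> ennreal" where
  "minimax_risk M W g \<epsilon> V = (INF fe\<in>estimators. SUP f\<in>V. risk M W g \<epsilon> fe f)"

end

theory Submission
  imports Defs
begin

text \<open>
  For a finite set of wavelet indices on one resolution level $(j,j')$, all sign patterns
  $f_\theta = \beta \sum_i \theta_i \psi_{j,k}\otimes\eta_{j',k'}$ with the same amplitude $\beta$ lie in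
  the Besov ball. Changing one sign moves the mean of the observation by $2\beta K(\psi\otimes\eta)$,
  and since $\psi_{j,k}$ is a trigonometric polynomial with frequencies of size about $2^j$, this has
  norm at most a constant times $\beta 2^{-\nu j}$. If that is at most $\varepsilon$, the two
  observations cannot be told apart, and Assouad's argument bounds the risk below by a constant
  times the number of indices times $\beta^2$. The three exponents come from letting $j'\to\infty$
  with all shifts $k'$, letting $j\to\infty$ with all shifts $k$, and letting $j\to\infty$ with a
  single index.
\<close>

section \<open>The law of white noise\<close>

text \<open>The noise is an abstract process on an arbitrary probability space, linear only almost
  surely for each pair of test functions, so no density of one observation law against another is at
  hand. What the definition does fix is the law on \<open>obs_space\<close>. This leads to a
  minorizing measure in place of likelihood ratios: a standard normal density moved by at most 1
  stays above \<open>std_normal_density 2\<close> on \<open>{0..1}\<close>, which is where that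
  constant comes from. The second obstacle is that band limitation is given for Fourier transforms
  on the line, whereas the basis consists of pointwise sums over translates, considered on the unit
  interval. Before the operator can be evaluated on such a function, it must be known to equal a
  finite trigonometric sum almost everywhere. That takes an unfolding of the periodization and a
  uniqueness theorem for Fourier coefficients. In the variable \<open>x\<close> only levels from
  \<open>m0\<close> on are used, because the scaling functions may contain frequency 0, where the
  kernel is not controlled.\<close>

lemma cis_borel_measurable [measurable]: "cis \<in> borel_measurable borel"
  by (intro borel_measurable_continuous_onI continuous_intros)

text \<open>The value at \<open>s = 0\<close> is the common total mass. Dividing by it turns the
  weighted measures into probability measures whose images under \<open>X\<close> and
  \<open>Y\<close> have the same characteristic function, so Levy's theorem applies. Mass zero is
  treated apart, since it cannot be normalized.\<close>

lemma weighted_char_eq: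
  fixes X w :: "'a \<Rightarrow> real" and Y v :: "'b \<Rightarrow> real"
  assumes M: "finite_measure M" and N: "finite_measure N"
    and X [measurable]: "X \<in> borel_measurable M" and Y [measurable]: "Y \<in> borel_measurable N"
    and w [measurable]: "w \<in> borel_measurable M" and v [measurable]: "v \<in> borel_measurable N"
    and wb: "\<And>x. 0 \<le> w x \<and> w x \<le> K" and vb: "\<And>y. 0 \<le> v y \<and> v y \<le> K"
    and eq: "\<And>s. (CLINT x|M. complex_of_real (w x) * cis (s * X x))
               = (CLINT y|N. complex_of_real (v y) * cis (s * Y y))"
    and A [measurable]: "A \<in> sets borel"
  shows "(\<integral>x. w x * indicator A (X x) \<partial>M) = (\<integral>y. v y * indicator A (Y y) \<partial>N)"
proof -
  interpret M: finite_measure M by (rule M)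
  interpret N: finite_measure N by (rule N)
  have iw: "integrable M w" by (rule M.integrable_const_bound[where B=K]) (use wb in auto)
  have iv: "integrable N v" by (rule N.integrable_const_bound[where B=K]) (use vb in auto)
  have K: "0 \<le> K" using wb[of undefined] by linarith
  have iwA: "integrable M (\<lambda>x. w x * indicator A (X x))"
    by (rule M.integrable_const_bound[where B=K]) (use wb K in \<open>auto split: split_indicator\<close>)
  have ivA: "integrable N (\<lambda>x. v x * indicator A (Y x))"
    by (rule N.integrable_const_bound[where B=K]) (use vb K in \<open>auto split: split_indicator\<close>)
  define c where "c = (\<integral>x. w x \<partial>M)"
  have c2: "c = (\<integral>x. v x \<partial>N)"
    using eq[of 0] by (simp add: c_def)
  have c0: "0 \<le> c" unfolding c_def using wb by simp
  show ?thesis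
  proof (cases "c = 0")
    case True
    have "(\<integral>x. w x * indicator A (X x) \<partial>M) \<le> c" unfolding c_def
      by (rule integral_mono[OF iwA iw]) (use wb in \<open>auto split: split_indicator\<close>)
    moreover have "0 \<le> (\<integral>x. w x * indicator A (X x) \<partial>M)" using wb by simp
    moreover have "(\<integral>x. v x * indicator A (Y x) \<partial>N) \<le> c" unfolding c2
      by (rule integral_mono[OF ivA iv]) (use vb in \<open>auto split: split_indicator\<close>)
    moreover have "0 \<le> (\<integral>x. v x * indicator A (Y x) \<partial>N)" using vb by simp
    ultimately show ?thesis using True by linarith
  next
    case False
    with c0 have c: "c > 0" by simp
    let ?P = "density M (\<lambda>x. ennreal (w x / c))" and ?Q = "density N (\<lambda>x. ennreal (v x / c))"
    have P: "prob_space ?P"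
    proof
      have "(\<integral>\<^sup>+x. ennreal (w x / c) \<partial>M) = ennreal (\<integral>x. w x / c \<partial>M)"
        by (rule nn_integral_eq_integral) (use wb iw c in auto)
      also have "\<dots> = 1" using c by (simp add: c_def)
      finally show "emeasure ?P (space ?P) = 1" by (simp add: emeasure_density)
    qed
    have Q: "prob_space ?Q"
    proof
      have "(\<integral>\<^sup>+x. ennreal (v x / c) \<partial>N) = ennreal (\<integral>x. v x / c \<partial>N)"
        by (rule nn_integral_eq_integral) (use vb iv c in auto)
      also have "\<dots> = 1" using c by (simp add: c2)
      finally show "emeasure ?Q (space ?Q) = 1" by (simp add: emeasure_density)
    qed
    interpret P: prob_space ?P by (rule P)
    interpret Q: prob_space ?Q by (rule Q)
    have "distr ?P borel X = distr ?Q borel Y"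
    proof (rule Levy_uniqueness)
      show "real_distribution (distr ?P borel X)" by (rule P.real_distribution_distr) simp
      show "real_distribution (distr ?Q borel Y)" by (rule Q.real_distribution_distr) simp
      show "char (distr ?P borel X) = char (distr ?Q borel Y)"
      proof
        fix s
        have "char (distr ?P borel X) s = (CLINT x|M. complex_of_real (w x) * cis (s * X x) / c)"
          by (simp add: char_def integral_distr integral_density wb c less_imp_le scaleR_conv_of_real cis_conv_exp)
        also have "\<dots> = (CLINT x|N. complex_of_real (v x) * cis (s * Y x) / c)" by (simp add: eq)
        also have "\<dots> = char (distr ?Q borel Y) s"
          by (simp add: char_def integral_distr integral_density vb c less_imp_le scaleR_conv_of_real cis_conv_exp)
        finally show "char (distr ?P borel X) s = char (distr ?Q borel Y) s" .
      qed
    qed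
    then have "(\<integral>x. indicator A x \<partial>distr ?P borel X) = (\<integral>x. indicator A x \<partial>distr ?Q borel Y :: real)"
      by simp
    then have "(\<integral>x. w x / c * indicator A (X x) \<partial>M) = (\<integral>x. v x / c * indicator A (Y x) \<partial>N)"
      by (simp add: integral_distr integral_density wb vb c less_imp_le del: integral_indicator Bochner_Integration.integral_indicator)
    then show ?thesis using c by simp
  qed
qed

text \<open>
  The coordinates are treated one at a time: the weights \<open>P (1 + cos (\<tau> - \<theta>))\<close> are
  nonnegative, so the one-dimensional Levy uniqueness theorem applies to them, and the values
  \<open>\<theta> = 0\<close> and \<open>\<theta> = pi/2\<close> recover the real and imaginary part.
\<close>

lemma joint_char_eq:
  fixes X :: "'i \<Rightarrow> 'a \<Rightarrow> real" and Y :: "'i \<Rightarrow> 'b \<Rightarrow> real"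
  assumes M: "prob_space M" and N: "prob_space N" and J: "finite J"
    and X: "\<And>j. j \<in> J \<Longrightarrow> X j \<in> borel_measurable M"
    and Y: "\<And>j. j \<in> J \<Longrightarrow> Y j \<in> borel_measurable N"
    and eq: "\<And>t. (CLINT x|M. cis (\<Sum>j\<in>J. t j * X j x)) = (CLINT y|N. cis (\<Sum>j\<in>J. t j * Y j y))"
    and A: "\<And>j. j \<in> J \<Longrightarrow> A j \<in> sets borel"
    and K: "K \<subseteq> J"
  shows "(CLINT x|M. complex_of_real (\<Prod>k\<in>K. indicator (A k) (X k x)) * cis (\<Sum>j\<in>J. t j * X j x))
       = (CLINT y|N. complex_of_real (\<Prod>k\<in>K. indicator (A k) (Y k y)) * cis (\<Sum>j\<in>J. t j * Y j y))"
proof -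
  interpret M: prob_space M by (rule M)
  interpret N: prob_space N by (rule N)
  have "finite K" using K J finite_subset by blast
  then show ?thesis using K
  proof (induction K arbitrary: t)
    case empty
    show ?case by (simp add: eq)
  next
    case (insert a K)
    then have a: "a \<in> J" and KJ: "K \<subseteq> J" by auto
    note IH = insert.IH[OF KJ]
    have XK [measurable]: "(\<lambda>x. \<Prod>k\<in>K. indicator (A k) (X k x) :: real) \<in> borel_measurable M"
      using KJ X A by (intro borel_measurable_prod borel_measurable_indicator') auto
    have YK [measurable]: "(\<lambda>x. \<Prod>k\<in>K. indicator (A k) (Y k x) :: real) \<in> borel_measurable N"
      using KJ Y A by (intro borel_measurable_prod borel_measurable_indicator') auto
    have XS [measurable]: "(\<lambda>x. \<Sum>j\<in>J. t j * X j x) \<in> borel_measurable M" for t :: "'i \<Rightarrow> real"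
      using X by (intro borel_measurable_sum) auto
    have YS [measurable]: "(\<lambda>x. \<Sum>j\<in>J. t j * Y j x) \<in> borel_measurable N" for t :: "'i \<Rightarrow> real"
      using Y by (intro borel_measurable_sum) auto
    note [measurable] = X[OF a] Y[OF a] A[OF a]
    note [measurable] = measurable_compose[OF _ cis_borel_measurable]
    define P where "P x = (\<Prod>k\<in>K. indicator (A k) (X k x) :: real)" for x
    define Q where "Q x = (\<Prod>k\<in>K. indicator (A k) (Y k x) :: real)" for x
    have [measurable]: "P \<in> borel_measurable M" "Q \<in> borel_measurable N"
      unfolding P_def Q_def by simp_all
    have P01: "0 \<le> P x" "P x \<le> 1" for x unfolding P_def
      by (auto intro!: prod_nonneg prod_le_1)
    have Q01: "0 \<le> Q x" "Q x \<le> 1" for x unfolding Q_def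
      by (auto intro!: prod_nonneg prod_le_1)
    \<comment> \<open>A frequency concentrated on coordinate \<open>a\<close>: it absorbs
      \<open>cis (s * X a x)\<close> into the joint exponent, so that the induction hypothesis
      covers it.\<close>
    define e where "e s = (\<lambda>j. if j = a then s else (0::real))" for s
    have esum: "(\<Sum>j\<in>J. e s j * Z j) = s * Z a" for s and Z :: "'i \<Rightarrow> real"
      using a J by (simp add: e_def if_distrib[where f="\<lambda>x. x * _"] cong: if_cong)
    \<comment> \<open>The cosine is half the sum of two exponentials, so the nonnegative weight
      becomes a combination of three exponentials, each of the kind treated by the induction
      hypothesis.\<close>
    have split: "complex_of_real (p * (1 + cos (\<tau> - \<theta>))) * cis r =
        of_real p * cis r + cis (-\<theta>) / 2 * (of_real p * cis (\<tau> + r)) + cis \<theta> / 2 * (of_real p * cis (-\<tau> + r))"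
      for p \<tau> \<theta> r :: real
    proof -
      have "complex_of_real (cos (\<tau> - \<theta>)) = (cis (\<tau> - \<theta>) + cis (-(\<tau> - \<theta>))) / 2"
        by (simp add: complex_eq_iff cos_diff sin_diff mult.commute)
      then have "complex_of_real (p * (1 + cos (\<tau> - \<theta>))) * cis r
          = of_real p * cis r + of_real p * (cis (\<tau> - \<theta>) * cis r) / 2 + of_real p * (cis (-(\<tau> - \<theta>)) * cis r) / 2"
        by (simp add: algebra_simps add_divide_distrib)
      also have "cis (\<tau> - \<theta>) * cis r = cis (-\<theta>) * cis (\<tau> + r)" by (simp add: cis_mult algebra_simps)
      also have "cis (-(\<tau> - \<theta>)) * cis r = cis \<theta> * cis (-\<tau> + r)" by (simp add: cis_mult algebra_simps)
      finally show ?thesis by (simp add: mult.left_commute)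
    qed
    have bM: "integrable M (\<lambda>x. complex_of_real (P x) * cis (\<Sum>j\<in>J. t j * X j x))" for t
      by (rule M.integrable_const_bound[where B=1]) (use P01 in \<open>auto simp: norm_mult\<close>)
    have bN: "integrable N (\<lambda>x. complex_of_real (Q x) * cis (\<Sum>j\<in>J. t j * Y j x))" for t
      by (rule N.integrable_const_bound[where B=1]) (use Q01 in \<open>auto simp: norm_mult\<close>)
    have wM: "complex_of_real (P x * (1 + cos ((\<Sum>j\<in>J. t j * X j x) - \<theta>))) * cis (s * X a x) =
       of_real (P x) * cis (\<Sum>j\<in>J. e s j * X j x)
       + cis (-\<theta>) / 2 * (of_real (P x) * cis (\<Sum>j\<in>J. (t j + e s j) * X j x))
       + cis \<theta> / 2 * (of_real (P x) * cis (\<Sum>j\<in>J. (- t j + e s j) * X j x))" for x s t \<theta>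
      by (simp only: split esum distrib_right sum.distrib mult_minus_left sum_negf)
    have wN: "complex_of_real (Q x * (1 + cos ((\<Sum>j\<in>J. t j * Y j x) - \<theta>))) * cis (s * Y a x) =
       of_real (Q x) * cis (\<Sum>j\<in>J. e s j * Y j x)
       + cis (-\<theta>) / 2 * (of_real (Q x) * cis (\<Sum>j\<in>J. (t j + e s j) * Y j x))
       + cis \<theta> / 2 * (of_real (Q x) * cis (\<Sum>j\<in>J. (- t j + e s j) * Y j x))" for x s t \<theta>
      by (simp only: split esum distrib_right sum.distrib mult_minus_left sum_negf)
    have ge: "0 \<le> p * (1 + cos r) \<and> p * (1 + cos r) \<le> 2" if "0 \<le> p" "p \<le> 1" for p r :: real
    proof -
      have c: "-1 \<le> cos r" "cos r \<le> 1" by simp_all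
      then have "0 \<le> 1 + cos r" "1 + cos r \<le> 2" by linarith+
      then show ?thesis using that mult_mono[of p 1 "1 + cos r" 2] by simp
    qed
    have main: "(\<integral>x. P x * (1 + cos ((\<Sum>j\<in>J. t j * X j x) - \<theta>)) * indicator (A a) (X a x) \<partial>M)
        = (\<integral>x. Q x * (1 + cos ((\<Sum>j\<in>J. t j * Y j x) - \<theta>)) * indicator (A a) (Y a x) \<partial>N)" for t \<theta>
    proof (rule weighted_char_eq[where K=2])
      show "finite_measure M" "finite_measure N" by unfold_locales
      fix s
      show "(CLINT x|M. complex_of_real (P x * (1 + cos ((\<Sum>j\<in>J. t j * X j x) - \<theta>))) * cis (s * X a x))
        = (CLINT x|N. complex_of_real (Q x * (1 + cos ((\<Sum>j\<in>J. t j * Y j x) - \<theta>))) * cis (s * Y a x))"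
        unfolding wM wN
        using IH[folded P_def Q_def] by (simp add: bM bN)
    qed (auto intro!: ge P01 Q01 simp: ge P01 Q01)
    define I where "I t \<theta> = (\<integral>x. P x * indicator (A a) (X a x) * cos ((\<Sum>j\<in>J. t j * X j x) - \<theta>) \<partial>M)" for t \<theta>
    define I' where "I' t \<theta> = (\<integral>x. Q x * indicator (A a) (Y a x) * cos ((\<Sum>j\<in>J. t j * Y j x) - \<theta>) \<partial>N)" for t \<theta>
    have iPc: "integrable M (\<lambda>x. P x * indicator (A a) (X a x) * cos ((\<Sum>j\<in>J. t j * X j x) - \<theta>))" for t \<theta>
      by (rule M.integrable_const_bound[where B=1])
        (use P01 in \<open>auto simp: abs_mult split: split_indicator intro!: mult_le_one\<close>)
    have iQc: "integrable N (\<lambda>x. Q x * indicator (A a) (Y a x) * cos ((\<Sum>j\<in>J. t j * Y j x) - \<theta>))" for t \<theta>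
      by (rule N.integrable_const_bound[where B=1])
        (use Q01 in \<open>auto simp: abs_mult split: split_indicator intro!: mult_le_one\<close>)
    have iP: "integrable M (\<lambda>x. P x * indicator (A a) (X a x))"
      using iPc[of "\<lambda>_. 0" 0] by simp
    have iQ: "integrable N (\<lambda>x. Q x * indicator (A a) (Y a x))"
      using iQc[of "\<lambda>_. 0" 0] by simp
    \<comment> \<open>The constant 1 in the weight contributes the value at \<open>t = 0\<close>,
      \<open>\<theta> = 0\<close>. The instance at exactly these values doubles it, so it can be
      subtracted afterwards.\<close>
    have s: "I (\<lambda>_. 0) 0 + I t \<theta> = I' (\<lambda>_. 0) 0 + I' t \<theta>" for t \<theta>
    proof -
      have "I (\<lambda>_. 0) 0 + I t \<theta> = (\<integral>x. P x * (1 + cos ((\<Sum>j\<in>J. t j * X j x) - \<theta>)) * indicator (A a) (X a x) \<partial>M)"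
        unfolding I_def
        by (subst Bochner_Integration.integral_add[symmetric, OF iPc iPc]) (simp add: algebra_simps)
      also have "\<dots> = (\<integral>x. Q x * (1 + cos ((\<Sum>j\<in>J. t j * Y j x) - \<theta>)) * indicator (A a) (Y a x) \<partial>N)"
        by (rule main)
      also have "\<dots> = I' (\<lambda>_. 0) 0 + I' t \<theta>" unfolding I'_def
        by (subst Bochner_Integration.integral_add[symmetric, OF iQc iQc]) (simp add: algebra_simps)
      finally show ?thesis .
    qed
    have II: "I t \<theta> = I' t \<theta>" for t \<theta>
      using s[of t \<theta>] s[of "\<lambda>_. 0" 0] by simp
    have cisd: "cis r = complex_of_real (cos (r - 0)) + \<i> * complex_of_real (cos (r - pi/2))" for r
      by (simp add: complex_eq_iff cos_diff)
    have LM: "(CLINT x|M. complex_of_real (P x * indicator (A a) (X a x)) * cis (\<Sum>j\<in>J. t j * X j x))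
       = complex_of_real (I t 0) + \<i> * complex_of_real (I t (pi/2))"
    proof -
      have "(CLINT x|M. complex_of_real (P x * indicator (A a) (X a x)) * cis (\<Sum>j\<in>J. t j * X j x))
        = (CLINT x|M. complex_of_real (P x * indicator (A a) (X a x) * cos ((\<Sum>j\<in>J. t j * X j x) - 0))
            + \<i> * complex_of_real (P x * indicator (A a) (X a x) * cos ((\<Sum>j\<in>J. t j * X j x) - pi/2)))"
        by (subst cisd) (simp add: algebra_simps)
      also have "\<dots> = complex_of_real (I t 0) + \<i> * complex_of_real (I t (pi/2))"
        unfolding I_def
        by (subst Bochner_Integration.integral_add)
          (use iPc[THEN integrable_of_real, where 'a=complex] iPc[of _ 0, THEN integrable_of_real, where 'a=complex] in \<open>auto simp del: of_real_mult\<close>)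
      finally show ?thesis .
    qed
    have LN: "(CLINT x|N. complex_of_real (Q x * indicator (A a) (Y a x)) * cis (\<Sum>j\<in>J. t j * Y j x))
       = complex_of_real (I' t 0) + \<i> * complex_of_real (I' t (pi/2))"
    proof -
      have "(CLINT x|N. complex_of_real (Q x * indicator (A a) (Y a x)) * cis (\<Sum>j\<in>J. t j * Y j x))
        = (CLINT x|N. complex_of_real (Q x * indicator (A a) (Y a x) * cos ((\<Sum>j\<in>J. t j * Y j x) - 0))
            + \<i> * complex_of_real (Q x * indicator (A a) (Y a x) * cos ((\<Sum>j\<in>J. t j * Y j x) - pi/2)))"
        by (subst cisd) (simp add: algebra_simps)
      also have "\<dots> = complex_of_real (I' t 0) + \<i> * complex_of_real (I' t (pi/2))"
        unfolding I'_def
        by (subst Bochner_Integration.integral_add)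
          (use iQc[THEN integrable_of_real, where 'a=complex] iQc[of _ 0, THEN integrable_of_real, where 'a=complex] in \<open>auto simp del: of_real_mult\<close>)
      finally show ?thesis .
    qed
    show ?case
      using LM LN II insert.hyps by (simp add: P_def Q_def mult.commute mult.left_commute)
  qed
qed

section \<open>The inner product of square-integrable functions on the unit square\<close>

lemma L2set2_measurable: "h \<in> L2set2 \<Longrightarrow> case_prod h \<in> borel_measurable borel"
  by (simp add: L2set2_def)

lemma sq01_borel [measurable]: "sq01 \<in> sets borel"
  unfolding sq01_def by (intro borel_closed closed_Times) auto

lemma L2set2_sq_integrable:
  assumes "h \<in> L2set2"
  shows "integrable lborel (\<lambda>z. indicator sq01 z * (case_prod h z)\<^sup>2 :: real)"
proof (rule integrableI_nonneg)
  note [measurable] = L2set2_measurable[OF assms]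
  show "(\<lambda>z. indicator sq01 z * (case_prod h z)\<^sup>2 :: real) \<in> borel_measurable lborel"
    by measurable
  have "(\<integral>\<^sup>+ z. ennreal (indicator sq01 z * (case_prod h z)\<^sup>2) \<partial>lborel) = L2sq2 h"
    unfolding L2sq2_def by (intro nn_integral_cong) (auto split: split_indicator)
  then show "(\<integral>\<^sup>+ z. ennreal (indicator sq01 z * (case_prod h z)\<^sup>2) \<partial>lborel) < \<infinity>"
    using assms by (simp add: L2set2_def)
qed auto

lemma L2set2_integrable:
  assumes h: "h \<in> L2set2" and k: "k \<in> L2set2"
  shows "integrable lborel (\<lambda>z. indicator sq01 z * case_prod h z * case_prod k z :: real)"
proof -
  note [measurable] = L2set2_measurable[OF h] L2set2_measurable[OF k]
  have "\<bar>a * b\<bar> \<le> a\<^sup>2 + b\<^sup>2" for a b :: real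
  proof -
    have "2 * (\<bar>a\<bar> * \<bar>b\<bar>) \<le> a\<^sup>2 + b\<^sup>2" using sum_squares_bound[of "\<bar>a\<bar>" "\<bar>b\<bar>"] by (simp add: mult.assoc)
    moreover have "0 \<le> \<bar>a\<bar> * \<bar>b\<bar>" by simp
    ultimately show ?thesis unfolding abs_mult by linarith
  qed
  note le = this
  show ?thesis
  proof (rule Bochner_Integration.integrable_bound)
    show "integrable lborel (\<lambda>z. indicator sq01 z * (case_prod h z)\<^sup>2 + indicator sq01 z * (case_prod k z)\<^sup>2 :: real)"
      using h k by (intro Bochner_Integration.integrable_add L2set2_sq_integrable)
    show "(\<lambda>z. indicator sq01 z * case_prod h z * case_prod k z) \<in> borel_measurable lborel"
      by measurable
    show "AE z in lborel. norm (indicator sq01 z * case_prod h z * case_prod k z)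
        \<le> norm (indicator sq01 z * (case_prod h z)\<^sup>2 + indicator sq01 z * (case_prod k z)\<^sup>2 :: real)"
      using le by (auto split: split_indicator)
  qed
qed

lemma L2sq2_eq_ip2:
  assumes "h \<in> L2set2"
  shows "L2sq2 h = ennreal (ip2 h h)"
proof -
  have "L2sq2 h = (\<integral>\<^sup>+ z. ennreal (indicator sq01 z * (case_prod h z)\<^sup>2) \<partial>lborel)"
    unfolding L2sq2_def by (intro nn_integral_cong) (auto split: split_indicator)
  also have "\<dots> = ennreal (\<integral> z. indicator sq01 z * (case_prod h z)\<^sup>2 \<partial>lborel)"
    by (intro nn_integral_eq_integral L2set2_sq_integrable assms) auto
  finally show ?thesis by (simp add: ip2_def power2_eq_square mult.assoc)
qed

lemma ip2_self_nonneg: "0 \<le> ip2 h h"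
  unfolding ip2_def by (rule Bochner_Integration.integral_nonneg) (auto split: split_indicator)

lemma ip2_commute: "ip2 h k = ip2 k h"
  unfolding ip2_def by (simp add: mult.commute mult.left_commute)

lemma L2set2_zero: "(\<lambda>u x. 0) \<in> L2set2"
  by (simp add: L2set2_def L2sq2_def case_prod_beta')

lemma L2set2_lin:
  assumes h: "h \<in> L2set2" and k: "k \<in> L2set2"
  shows "(\<lambda>u x. a * h u x + b * k u x) \<in> L2set2"
proof -
  note [measurable] = L2set2_measurable[OF h] L2set2_measurable[OF k]
  have eq: "case_prod (\<lambda>u x. a * h u x + b * k u x) = (\<lambda>z. a * case_prod h z + b * case_prod k z)"
    by auto
  have i: "integrable lborel (\<lambda>z. a\<^sup>2 * (indicator sq01 z * (case_prod h z)\<^sup>2)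
     + 2 * a * b * (indicator sq01 z * case_prod h z * case_prod k z)
     + b\<^sup>2 * (indicator sq01 z * (case_prod k z)\<^sup>2) :: real)"
    by (intro Bochner_Integration.integrable_add integrable_mult_right L2set2_sq_integrable L2set2_integrable h k)
  have "L2sq2 (\<lambda>u x. a * h u x + b * k u x) = (\<integral>\<^sup>+ z. ennreal (norm (a\<^sup>2 * (indicator sq01 z * (case_prod h z)\<^sup>2)
     + 2 * a * b * (indicator sq01 z * case_prod h z * case_prod k z)
     + b\<^sup>2 * (indicator sq01 z * (case_prod k z)\<^sup>2) :: real)) \<partial>lborel)"
    unfolding L2sq2_def eq
  proof (intro nn_integral_cong)
    fix z :: "real \<times> real"
    have "a\<^sup>2 * (case_prod h z)\<^sup>2 + 2 * a * b * (case_prod h z * case_prod k z) + b\<^sup>2 * (case_prod k z)\<^sup>2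
       = (a * case_prod h z + b * case_prod k z)\<^sup>2" by (simp add: power2_eq_square algebra_simps)
    then show "indicator sq01 z * ennreal ((a * case_prod h z + b * case_prod k z)\<^sup>2) =
         ennreal (norm (a\<^sup>2 * (indicator sq01 z * (case_prod h z)\<^sup>2)
         + 2 * a * b * (indicator sq01 z * case_prod h z * case_prod k z)
         + b\<^sup>2 * (indicator sq01 z * (case_prod k z)\<^sup>2)))"
      by (auto split: split_indicator)
  qed
  also have "\<dots> < \<infinity>" using i by (simp add: integrable_iff_bounded)
  finally show ?thesis by (simp add: L2set2_def eq)
qed

lemma ip2_lin_left:
  assumes h: "h \<in> L2set2" and k: "k \<in> L2set2" and l: "l \<in> L2set2"
  shows "ip2 (\<lambda>u x. a * h u x + b * k u x) l = a * ip2 h l + b * ip2 k l"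
proof -
  have "ip2 (\<lambda>u x. a * h u x + b * k u x) l =
     (\<integral> z. a * (indicator sq01 z * case_prod h z * case_prod l z) + b * (indicator sq01 z * case_prod k z * case_prod l z) \<partial>lborel)"
    unfolding ip2_def by (intro Bochner_Integration.integral_cong) (auto simp: algebra_simps)
  also have "\<dots> = a * ip2 h l + b * ip2 k l" unfolding ip2_def
    by (subst Bochner_Integration.integral_add) (use L2set2_integrable[OF h l] L2set2_integrable[OF k l] in auto)
  finally show ?thesis .
qed

lemma ip2_lin_right:
  assumes h: "h \<in> L2set2" and k: "k \<in> L2set2" and l: "l \<in> L2set2"
  shows "ip2 l (\<lambda>u x. a * h u x + b * k u x) = a * ip2 l h + b * ip2 l k"
  using ip2_lin_left[OF assms, of a b] by (simp add: ip2_commute)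

lemma L2set2_sum:
  assumes "finite I" "\<And>i. i \<in> I \<Longrightarrow> h i \<in> L2set2"
  shows "(\<lambda>u x. \<Sum>i\<in>I. c i * h i u x) \<in> L2set2"
  using assms
proof (induction I)
  case empty
  then show ?case by (simp add: L2set2_zero)
next
  case (insert i I)
  then show ?case using L2set2_lin[of "h i" "\<lambda>u x. \<Sum>i\<in>I. c i * h i u x" "c i" 1] by simp
qed

lemma ip2_sum_left:
  assumes "finite I" "\<And>i. i \<in> I \<Longrightarrow> h i \<in> L2set2" "l \<in> L2set2"
  shows "ip2 (\<lambda>u x. \<Sum>i\<in>I. c i * h i u x) l = (\<Sum>i\<in>I. c i * ip2 (h i) l)"
  using assms
proof (induction I)
  case empty
  then show ?case by (simp add: ip2_def case_prod_beta')
next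
  case (insert i I)
  then show ?case
    using ip2_lin_left[of "h i" "\<lambda>u x. \<Sum>i\<in>I. c i * h i u x" l "c i" 1] by (simp add: L2set2_sum)
qed

section \<open>Finite-dimensional laws of white noise and uniqueness of its law\<close>

lemma white_noise_prob_space: "white_noise M W \<Longrightarrow> prob_space M"
  by (simp add: white_noise_def)

lemma white_noise_measurable:
  "white_noise M W \<Longrightarrow> \<phi> \<in> L2set2 \<Longrightarrow> (\<lambda>\<omega>. W \<omega> \<phi>) \<in> borel_measurable M"
  by (simp add: white_noise_def)

lemma white_noise_char:
  "white_noise M W \<Longrightarrow> \<phi> \<in> L2set2 \<Longrightarrow>
    char (distr M borel (\<lambda>\<omega>. W \<omega> \<phi>)) t = complex_of_real (exp (- (t\<^sup>2 * ip2 \<phi> \<phi>) / 2))"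
  by (simp add: white_noise_def)

lemma white_noise_linear:
  "white_noise M W \<Longrightarrow> \<phi> \<in> L2set2 \<Longrightarrow> \<psi> \<in> L2set2 \<Longrightarrow>
    AE \<omega> in M. W \<omega> (\<lambda>u x. a * \<phi> u x + b * \<psi> u x) = a * W \<omega> \<phi> + b * W \<omega> \<psi>"
  by (simp add: white_noise_def)

lemma char_distr_cis:
  "X \<in> borel_measurable M \<Longrightarrow> char (distr M borel X) t = (CLINT \<omega>|M. cis (t * X \<omega>))"
  by (simp add: char_def integral_distr cis_conv_exp)

lemma white_noise_sum:
  assumes W: "white_noise M W" and J: "finite J" "J \<subseteq> L2set2"
  shows "AE \<omega> in M. W \<omega> (\<lambda>u x. \<Sum>\<phi>\<in>J. t \<phi> * \<phi> u x) = (\<Sum>\<phi>\<in>J. t \<phi> * W \<omega> \<phi>)"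
  using J
proof (induction J)
  case empty
  \<comment> \<open>Linearity with both coefficients 0 says that the noise vanishes at the zero
    function almost surely.\<close>
  show ?case using white_noise_linear[OF W L2set2_zero L2set2_zero, of 0 0] by simp
next
  case (insert \<psi> J)
  have "AE \<omega> in M. W \<omega> (\<lambda>u x. t \<psi> * \<psi> u x + 1 * (\<Sum>\<phi>\<in>J. t \<phi> * \<phi> u x))
      = t \<psi> * W \<omega> \<psi> + 1 * W \<omega> (\<lambda>u x. \<Sum>\<phi>\<in>J. t \<phi> * \<phi> u x)"
    using insert L2set2_sum[of J "\<lambda>\<phi>. \<phi>" t] by (intro white_noise_linear[OF W]) auto
  then show ?case using insert.IH insert by auto
qed

text \<open>Almost sure linearity reduces a joint characteristic function to the law of the noise at
  one combined test function. Hence \<open>ip2\<close> fixes all finite-dimensional laws, although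
  \<open>white_noise\<close> prescribes only one-dimensional ones.\<close>

lemma white_noise_joint_char:
  assumes W: "white_noise M W" and J: "finite J" "J \<subseteq> L2set2"
  shows "(CLINT \<omega>|M. cis (\<Sum>\<phi>\<in>J. t \<phi> * W \<omega> \<phi>))
    = complex_of_real (exp (- ip2 (\<lambda>u x. \<Sum>\<phi>\<in>J. t \<phi> * \<phi> u x) (\<lambda>u x. \<Sum>\<phi>\<in>J. t \<phi> * \<phi> u x) / 2))"
proof -
  let ?s = "\<lambda>u x. \<Sum>\<phi>\<in>J. t \<phi> * \<phi> u x"
  have s: "?s \<in> L2set2" using L2set2_sum[of J "\<lambda>\<phi>. \<phi>" t] J by auto
  have [measurable]: "(\<lambda>\<omega>. W \<omega> ?s) \<in> borel_measurable M"
    by (rule white_noise_measurable[OF W s])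
  have "(\<lambda>\<omega>. \<Sum>\<phi>\<in>J. t \<phi> * W \<omega> \<phi>) \<in> borel_measurable M"
    using J by (intro borel_measurable_sum borel_measurable_times white_noise_measurable[OF W]) auto
  then have "(CLINT \<omega>|M. cis (\<Sum>\<phi>\<in>J. t \<phi> * W \<omega> \<phi>)) = (CLINT \<omega>|M. cis (W \<omega> ?s))"
    using white_noise_sum[OF W J, of t]
    by (intro integral_cong_AE) (auto intro!: measurable_compose[OF _ cis_borel_measurable])
  also have "\<dots> = char (distr M borel (\<lambda>\<omega>. W \<omega> ?s)) 1"
    by (simp add: char_def integral_distr cis_conv_exp)
  also have "\<dots> = complex_of_real (exp (- (1\<^sup>2 * ip2 ?s ?s) / 2))"
    by (rule white_noise_char[OF W s])
  finally show ?thesis by simp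
qed

lemma white_noise_restrict_measurable:
  assumes "white_noise M W"
  shows "(\<lambda>\<omega>. restrict (W \<omega>) L2set2) \<in> measurable M obs_space"
  unfolding obs_space_def by (intro measurable_restrict white_noise_measurable[OF assms])

text \<open>
  The vacuous factor with frequency 0 gives the right-hand side the shape of \<open>joint_char_eq\<close>.
\<close>

lemma white_noise_emeasure_cylinder:
  assumes W: "white_noise M W" and J: "finite J" "J \<subseteq> L2set2" and A: "\<And>j. j \<in> J \<Longrightarrow> A j \<in> sets borel"
  shows "emeasure (distr M obs_space (\<lambda>\<omega>. restrict (W \<omega>) L2set2)) (prod_emb L2set2 (\<lambda>_. borel) J (Pi\<^sub>E J A))
     = ennreal (Re (CLINT x|M. complex_of_real (\<Prod>k\<in>J. indicator (A k) (W x k)) * cis (\<Sum>j\<in>J. 0 * W x j)))"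
proof -
  interpret prob_space M by (rule white_noise_prob_space[OF W])
  let ?S = "{\<omega> \<in> space M. \<forall>j\<in>J. W \<omega> j \<in> A j}"
  have S: "?S \<in> sets M"
  proof (rule sets.sets_Collect_finite_All[OF _ J(1)])
    fix j assume "j \<in> J"
    then have "(\<lambda>\<omega>. W \<omega> j) -` A j \<inter> space M \<in> sets M"
      using J A by (intro measurable_sets[OF white_noise_measurable[OF W]]) auto
    then show "{\<omega> \<in> space M. W \<omega> j \<in> A j} \<in> sets M"
      by (simp add: vimage_def Int_def conj_commute)
  qed
  have cyl: "prod_emb L2set2 (\<lambda>_. borel) J (Pi\<^sub>E J A) \<in> sets obs_space"
    unfolding obs_space_def using J A by (intro sets_PiM_I) auto
  have "emeasure (distr M obs_space (\<lambda>\<omega>. restrict (W \<omega>) L2set2)) (prod_emb L2set2 (\<lambda>_. borel) J (Pi\<^sub>E J A))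
    = emeasure M ((\<lambda>\<omega>. restrict (W \<omega>) L2set2) -` prod_emb L2set2 (\<lambda>_. borel) J (Pi\<^sub>E J A) \<inter> space M)"
    by (rule emeasure_distr[OF white_noise_restrict_measurable[OF W] cyl])
  also have "(\<lambda>\<omega>. restrict (W \<omega>) L2set2) -` prod_emb L2set2 (\<lambda>_. borel) J (Pi\<^sub>E J A) \<inter> space M = ?S"
  proof -
    have "restrict (W \<omega>) L2set2 \<in> prod_emb L2set2 (\<lambda>_. borel) J (Pi\<^sub>E J A) \<longleftrightarrow> (\<forall>j\<in>J. W \<omega> j \<in> A j)" for \<omega>
      using J(2) by (auto simp: prod_emb_iff PiE_iff subset_iff extensional_def)
    then show ?thesis by blast
  qed
  also have "emeasure M ?S = ennreal (\<integral>\<omega>. indicator ?S \<omega> \<partial>M)"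
    using S by (simp add: emeasure_eq_measure)
  also have "(\<integral>\<omega>. indicator ?S \<omega> \<partial>M) = (\<integral>\<omega>. (\<Prod>k\<in>J. indicator (A k) (W \<omega> k) :: real) \<partial>M)"
  proof (rule Bochner_Integration.integral_cong[OF refl])
    fix \<omega> assume \<omega>: "\<omega> \<in> space M"
    show "indicator ?S \<omega> = (\<Prod>k\<in>J. indicator (A k) (W \<omega> k) :: real)"
    proof (cases "\<forall>k\<in>J. W \<omega> k \<in> A k")
      case False
      then obtain k where "k \<in> J" "W \<omega> k \<notin> A k" by auto
      then have "\<exists>k\<in>J. indicator (A k) (W \<omega> k) = (0 :: real)" by (intro bexI[of _ k]) auto
      from prod_zero[OF J(1) this] False show ?thesis by simp
    qed (use \<omega> in simp)
  qed
  also have "ennreal \<dots> = ennreal (Re (CLINT x|M. complex_of_real (\<Prod>k\<in>J. indicator (A k) (W x k)) * cis (\<Sum>j\<in>J. 0 * W x j)))"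
    by (simp del: of_real_prod)
  finally show ?thesis .
qed

text \<open>Both laws agree on cylinders over finitely many test functions, and these generate
  \<open>obs_space\<close>. A given noise may therefore be exchanged for one built on a more
  convenient probability space.\<close>

lemma white_noise_law_unique:
  assumes W: "white_noise M W" and V: "white_noise N V"
  shows "distr M obs_space (\<lambda>\<omega>. restrict (W \<omega>) L2set2) = distr N obs_space (\<lambda>\<omega>. restrict (V \<omega>) L2set2)"
proof (rule measure_eqI_PiM_infinite[of _ L2set2 "\<lambda>_. borel"])
  show "sets (distr M obs_space (\<lambda>\<omega>. restrict (W \<omega>) L2set2)) = sets (Pi\<^sub>M L2set2 (\<lambda>_. borel))"
    "sets (distr N obs_space (\<lambda>\<omega>. restrict (V \<omega>) L2set2)) = sets (Pi\<^sub>M L2set2 (\<lambda>_. borel))"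
    by (simp_all only: obs_space_def sets_distr)
  interpret M: prob_space M by (rule white_noise_prob_space[OF W])
  interpret D: prob_space "distr M obs_space (\<lambda>\<omega>. restrict (W \<omega>) L2set2)"
    by (rule M.prob_space_distr[OF white_noise_restrict_measurable[OF W]])
  show "finite_measure (distr M obs_space (\<lambda>\<omega>. restrict (W \<omega>) L2set2))"
    by unfold_locales
  fix A and J :: "(real \<Rightarrow> real \<Rightarrow> real) set"
  assume J: "finite J" "J \<subseteq> L2set2" and A: "\<And>i. i \<in> J \<Longrightarrow> A i \<in> sets (borel :: real measure)"
  show "emeasure (distr M obs_space (\<lambda>\<omega>. restrict (W \<omega>) L2set2)) (prod_emb L2set2 (\<lambda>_. borel) J (Pi\<^sub>E J A))
    = emeasure (distr N obs_space (\<lambda>\<omega>. restrict (V \<omega>) L2set2)) (prod_emb L2set2 (\<lambda>_. borel) J (Pi\<^sub>E J A))"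
  proof -
    have "(CLINT x|M. complex_of_real (\<Prod>k\<in>J. indicator (A k) (W x k)) * cis (\<Sum>j\<in>J. 0 * W x j))
      = (CLINT x|N. complex_of_real (\<Prod>k\<in>J. indicator (A k) (V x k)) * cis (\<Sum>j\<in>J. 0 * V x j))"
    proof (rule joint_char_eq)
      show "prob_space M" "prob_space N" using W V white_noise_prob_space by auto
      show "(CLINT x|M. cis (\<Sum>j\<in>J. t j * W x j)) = (CLINT y|N. cis (\<Sum>j\<in>J. t j * V y j))" for t
        by (simp only: white_noise_joint_char[OF W J] white_noise_joint_char[OF V J])
      show "(\<lambda>x. W x j) \<in> borel_measurable M" "(\<lambda>x. V x j) \<in> borel_measurable N" if "j \<in> J" for j
        using that J(2) white_noise_measurable[OF W] white_noise_measurable[OF V] by auto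
    qed (use J A in auto)
    moreover note white_noise_emeasure_cylinder[OF W J, of A] white_noise_emeasure_cylinder[OF V J, of A]
    ultimately show ?thesis using A by (simp only:)
  qed
qed

section \<open>Indistinguishability of nearby means\<close>

text \<open>
  The component of the noise along \<open>e\<close> is replaced by a standard normal variable living on an
  additional factor. The result is again a white noise, so it has the same law, and a shift along
  \<open>e\<close> becomes a translation of that one variable; no Cameron-Martin theorem is needed.
\<close>

lemma white_noise_split:
  assumes W: "white_noise M W" and e: "e \<in> L2set2" and e1: "ip2 e e = 1"
  shows "white_noise (std_normal_distribution \<Otimes>\<^sub>M M)
    (\<lambda>z \<phi>. ip2 \<phi> e * fst z + W (snd z) (\<lambda>u x. 1 * \<phi> u x + (- ip2 \<phi> e) * e u x))"
    (is "white_noise ?P ?X")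
proof -
  interpret N: real_distribution std_normal_distribution by (rule real_dist_normal_dist)
  interpret M: prob_space M by (rule white_noise_prob_space[OF W])
  interpret NM: pair_prob_space std_normal_distribution M ..
  define r where "r \<phi> = (\<lambda>u x. 1 * \<phi> u x + (- ip2 \<phi> e) * e u x)" for \<phi>
  have rL: "r \<phi> \<in> L2set2" if "\<phi> \<in> L2set2" for \<phi>
    unfolding r_def by (rule L2set2_lin[OF that e])
  have meas: "(\<lambda>z. ?X z \<phi>) \<in> borel_measurable ?P" if "\<phi> \<in> L2set2" for \<phi>
  proof -
    note [measurable] = white_noise_measurable[OF W rL[OF that], unfolded r_def]
    have [measurable]: "fst \<in> borel_measurable ?P"
      using measurable_fst[of std_normal_distribution M] by (simp cong: measurable_cong_sets)
    show ?thesis by measurable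
  qed
  note cm' [measurable] = measurable_compose[OF _ cis_borel_measurable]
  have ch: "char (distr ?P borel (\<lambda>z. ?X z \<phi>)) t = complex_of_real (exp (- (t\<^sup>2 * ip2 \<phi> \<phi>) / 2))"
    if \<phi>: "\<phi> \<in> L2set2" for \<phi> t
  proof -
    define c where "c = ip2 \<phi> e"
    note [measurable] = white_noise_measurable[OF W rL[OF \<phi>]] meas[OF \<phi>]
    \<comment> \<open>Pythagoras: \<open>r \<phi>\<close> is orthogonal to \<open>e\<close>, so the
      variances of the two independent contributions add up to the squared norm of
      \<open>\<phi>\<close>.\<close>
    have nr: "ip2 \<phi> \<phi> = c\<^sup>2 + ip2 (r \<phi>) (r \<phi>)"
    proof -
      have "ip2 (r \<phi>) (r \<phi>) = ip2 \<phi> (r \<phi>) - c * ip2 e (r \<phi>)"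
        by (subst (1) r_def, subst ip2_lin_left[OF \<phi> e rL[OF \<phi>]]) (simp add: c_def)
      also have "ip2 \<phi> (r \<phi>) = ip2 \<phi> \<phi> - c * c"
        unfolding r_def by (subst ip2_lin_right[OF \<phi> e \<phi>]) (simp add: c_def)
      also have "ip2 e (r \<phi>) = 0"
        unfolding r_def by (subst ip2_lin_right[OF \<phi> e e]) (simp add: e1 ip2_commute[of e \<phi>])
      finally show ?thesis by (simp add: power2_eq_square)
    qed
    have "char (distr ?P borel (\<lambda>z. ?X z \<phi>)) t = (CLINT z|?P. cis (t * ?X z \<phi>))"
      by (rule char_distr_cis[OF meas[OF \<phi>]])
    also have "\<dots> = (CLINT z|?P. cis (t * c * fst z) * cis (t * W (snd z) (r \<phi>)))"
      by (simp add: cis_mult c_def r_def algebra_simps)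
    also have "\<dots> = (CLINT x|std_normal_distribution. (CLINT \<omega>|M. cis (t * c * x) * cis (t * W \<omega> (r \<phi>))))"
    proof -
      have "integrable ?P (\<lambda>z. cis (t * c * fst z) * cis (t * W (snd z) (r \<phi>)))"
      proof (rule NM.P.integrable_const_bound[where B=1])
        have [measurable]: "fst \<in> borel_measurable ?P"
          using measurable_fst[of std_normal_distribution M] by (simp cong: measurable_cong_sets)
        show "(\<lambda>z. cis (t * c * fst z) * cis (t * W (snd z) (r \<phi>))) \<in> borel_measurable ?P"
          by measurable
      qed (auto simp: norm_mult)
      then show ?thesis by (subst NM.integral_fst'[symmetric]) auto
    qed
    also have "\<dots> = (CLINT x|std_normal_distribution. cis (t * c * x)) * (CLINT \<omega>|M. cis (t * W \<omega> (r \<phi>)))"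
      by simp
    also have "(CLINT x|std_normal_distribution. cis (t * c * x)) = char std_normal_distribution (t * c)"
      by (simp add: char_def cis_conv_exp)
    also have "(CLINT \<omega>|M. cis (t * W \<omega> (r \<phi>))) = char (distr M borel (\<lambda>\<omega>. W \<omega> (r \<phi>))) t"
      by (rule char_distr_cis[symmetric]) measurable
    also have "char std_normal_distribution (t * c) * char (distr M borel (\<lambda>\<omega>. W \<omega> (r \<phi>))) t
       = complex_of_real (exp (- ((t * c)\<^sup>2) / 2) * exp (- (t\<^sup>2 * ip2 (r \<phi>) (r \<phi>)) / 2))"
      by (simp add: white_noise_char[OF W rL[OF \<phi>]] char_std_normal_distribution)
    also have "exp (- ((t * c)\<^sup>2) / 2) * exp (- (t\<^sup>2 * ip2 (r \<phi>) (r \<phi>)) / 2) = exp (- (t\<^sup>2 * ip2 \<phi> \<phi>) / 2)"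
      unfolding nr by (simp add: field_simps flip: exp_add)
    finally show ?thesis .
  qed
  have Xr: "?X z \<phi> = ip2 \<phi> e * fst z + W (snd z) (r \<phi>)" for z \<phi>
    by (simp only: r_def)
  have lin: "AE z in ?P. ?X z (\<lambda>u x. a * \<phi> u x + b * \<psi> u x) = a * ?X z \<phi> + b * ?X z \<psi>"
    if \<phi>: "\<phi> \<in> L2set2" and \<psi>: "\<psi> \<in> L2set2" for \<phi> \<psi> a b
  proof -
    define \<zeta> where "\<zeta> = (\<lambda>u x. a * \<phi> u x + b * \<psi> u x)"
    have \<zeta>: "\<zeta> \<in> L2set2" unfolding \<zeta>_def by (rule L2set2_lin[OF \<phi> \<psi>])
    have c: "ip2 \<zeta> e = a * ip2 \<phi> e + b * ip2 \<psi> e"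
      unfolding \<zeta>_def by (rule ip2_lin_left[OF \<phi> \<psi> e])
    have "r \<zeta> = (\<lambda>u x. a * r \<phi> u x + b * r \<psi> u x)"
      unfolding r_def c by (simp add: fun_eq_iff \<zeta>_def algebra_simps)
    then have "AE \<omega> in M. W \<omega> (r \<zeta>) = a * W \<omega> (r \<phi>) + b * W \<omega> (r \<psi>)"
      using white_noise_linear[OF W rL[OF \<phi>] rL[OF \<psi>], of a b] by simp
    \<comment> \<open>The exceptional null set in \<open>M\<close> does not depend on
      \<open>x\<close>; measurability of the set of equality then carries the statement to the
      product space.\<close>
    then have ae: "AE \<omega> in M. ?X (x, \<omega>) \<zeta> = a * ?X (x, \<omega>) \<phi> + b * ?X (x, \<omega>) \<psi>" for x
      unfolding Xr unfolding c by eventually_elim (simp add: algebra_simps)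
    note [measurable] = meas[OF \<phi>] meas[OF \<psi>] meas[OF \<zeta>]
    have "{z \<in> space ?P. ?X z \<zeta> = a * ?X z \<phi> + b * ?X z \<psi>} \<in> sets ?P" by measurable
    then have "AE z in ?P. ?X z \<zeta> = a * ?X z \<phi> + b * ?X z \<psi>"
      by (rule NM.AE_pair_measure) (use ae in auto)
    then show ?thesis by (simp add: \<zeta>_def)
  qed
  show ?thesis
    unfolding white_noise_def using meas ch lin NM.P.prob_space_axioms by blast
qed

text \<open>Each coordinate involves the noise at one fixed test function and \<open>x\<close>
  linearly, so the observation is jointly measurable in \<open>x\<close> and
  \<open>\<omega>\<close>. The linearity of the outer integral in the next two bounds rests on
  this.\<close>

lemma split_observation_measurable:
  assumes W: "white_noise M W" and e: "e \<in> L2set2"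
    and F [measurable]: "F \<in> borel_measurable obs_space"
  shows "(\<lambda>\<omega>. \<integral>\<^sup>+x. indicator {0..1} x *
      F (restrict (\<lambda>\<phi>. m \<phi> + \<epsilon> * (ip2 \<phi> e * x + W \<omega> (\<lambda>u v. 1 * \<phi> u v + (- ip2 \<phi> e) * e u v))) L2set2) \<partial>lborel)
    \<in> borel_measurable M"
proof -
  define Z where "Z x \<omega> = restrict (\<lambda>\<phi>. m \<phi> + \<epsilon> * (ip2 \<phi> e * x + W \<omega> (\<lambda>u v. 1 * \<phi> u v + (- ip2 \<phi> e) * e u v))) L2set2" for x \<omega>
  have "(\<lambda>z. Z (fst z) (snd z)) \<in> measurable (borel \<Otimes>\<^sub>M M) obs_space"
    unfolding Z_def obs_space_def
  proof (intro measurable_restrict)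
    fix \<phi> assume \<phi>: "\<phi> \<in> L2set2"
    note [measurable] = white_noise_measurable[OF W L2set2_lin[OF \<phi> e, of 1 "- ip2 \<phi> e"]]
    show "(\<lambda>z. m \<phi> + \<epsilon> * (ip2 \<phi> e * fst z + W (snd z) (\<lambda>u v. 1 * \<phi> u v + (- ip2 \<phi> e) * e u v))) \<in> borel_measurable (borel \<Otimes>\<^sub>M M)"
      by measurable
  qed
  then have "(\<lambda>z. F (Z (fst z) (snd z))) \<in> borel_measurable (borel \<Otimes>\<^sub>M M)" by measurable
  then have [measurable]: "(\<lambda>(\<omega>, x). F (Z x \<omega>)) \<in> borel_measurable (M \<Otimes>\<^sub>M lborel)"
    by (subst measurable_pair_swap_iff) (simp add: case_prod_beta' cong: measurable_cong_sets sets_pair_measure_cong)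
  have "(\<lambda>\<omega>. \<integral>\<^sup>+x. indicator {0..1} x * F (Z x \<omega>) \<partial>lborel) \<in> borel_measurable M"
    by measurable
  then show ?thesis by (simp only: Z_def)
qed

text \<open>After the split, a shift of the mean by \<open>b\<close> along \<open>e\<close>
  translates the normal variable by \<open>b / \<epsilon>\<close>, which has size at most 1. For
  \<open>x\<close> in \<open>{0..1}\<close> the translated density is evaluated between -1 and 2,
  hence is at least \<open>std_normal_density 2\<close>. All these observation laws thus dominate
  one measure that does not depend on \<open>b\<close>.\<close>

lemma shifted_observation_lower_bound:
  assumes W: "white_noise M W" and e: "e \<in> L2set2" and e1: "ip2 e e = 1"
    and eps: "\<epsilon> > 0" and b: "\<bar>b\<bar> \<le> \<epsilon>"
    and F [measurable]: "F \<in> borel_measurable obs_space"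
  shows "ennreal (std_normal_density 2) *
      (\<integral>\<^sup>+\<omega>. (\<integral>\<^sup>+x. indicator {0..1} x *
          F (restrict (\<lambda>\<phi>. m \<phi> + \<epsilon> * (ip2 \<phi> e * x + W \<omega> (\<lambda>u v. 1 * \<phi> u v + (- ip2 \<phi> e) * e u v))) L2set2) \<partial>lborel) \<partial>M)
    \<le> (\<integral>\<^sup>+\<omega>. F (restrict (\<lambda>\<phi>. (m \<phi> + b * ip2 e \<phi>) + \<epsilon> * W \<omega> \<phi>) L2set2) \<partial>M)"
proof -
  let ?N = "std_normal_distribution"
  interpret N: real_distribution ?N by (rule real_dist_normal_dist)
  interpret M: prob_space M by (rule white_noise_prob_space[OF W])
  interpret NM: pair_prob_space ?N M ..
  define r where "r \<phi> = (\<lambda>u x. 1 * \<phi> u x + (- ip2 \<phi> e) * e u x)" for \<phi>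
  have rL: "r \<phi> \<in> L2set2" if "\<phi> \<in> L2set2" for \<phi>
    unfolding r_def by (rule L2set2_lin[OF that e])
  define X where "X = (\<lambda>(z :: real \<times> 'a) \<phi>. ip2 \<phi> e * fst z + W (snd z) (r \<phi>))"
  have XW: "white_noise (?N \<Otimes>\<^sub>M M) X"
    unfolding X_def r_def by (rule white_noise_split[OF W e e1])
  define G where "G y = F (restrict (\<lambda>\<phi>. (m \<phi> + b * ip2 e \<phi>) + \<epsilon> * y \<phi>) L2set2)" for y
  have G [measurable]: "G \<in> borel_measurable obs_space"
    unfolding G_def
    by (rule measurable_compose[OF _ F]) (auto simp: obs_space_def intro!: measurable_restrict)
  define Z where "Z x \<omega> = restrict (\<lambda>\<phi>. m \<phi> + \<epsilon> * (ip2 \<phi> e * x + W \<omega> (r \<phi>))) L2set2" for x \<omega>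
  have Z [measurable]: "(\<lambda>x. Z x \<omega>) \<in> measurable borel obs_space" for \<omega>
    unfolding Z_def obs_space_def by (intro measurable_restrict) measurable
  have Gr: "G (restrict y L2set2) = G y" for y
    unfolding G_def by (intro arg_cong[where f=F]) (auto simp: restrict_def fun_eq_iff)
  have GX: "G (X (x, \<omega>)) = F (Z (x + b / \<epsilon>) \<omega>)" for x \<omega>
    unfolding G_def Z_def X_def using eps
    by (intro arg_cong[where f=F]) (auto simp: restrict_def fun_eq_iff field_simps ip2_commute[of e])
  have "(\<integral>\<^sup>+\<omega>. F (restrict (\<lambda>\<phi>. (m \<phi> + b * ip2 e \<phi>) + \<epsilon> * W \<omega> \<phi>) L2set2) \<partial>M)
      = (\<integral>\<^sup>+\<omega>. G (restrict (W \<omega>) L2set2) \<partial>M)"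
    unfolding Gr by (simp add: G_def)
  also have "\<dots> = (\<integral>\<^sup>+y. G y \<partial>distr M obs_space (\<lambda>\<omega>. restrict (W \<omega>) L2set2))"
    by (intro nn_integral_distr[symmetric] white_noise_restrict_measurable[OF W]) simp
  also have "\<dots> = (\<integral>\<^sup>+y. G y \<partial>distr (?N \<Otimes>\<^sub>M M) obs_space (\<lambda>\<omega>. restrict (X \<omega>) L2set2))"
    by (simp only: white_noise_law_unique[OF W XW])
  also have "\<dots> = (\<integral>\<^sup>+z. G (restrict (X z) L2set2) \<partial>(?N \<Otimes>\<^sub>M M))"
    by (intro nn_integral_distr white_noise_restrict_measurable[OF XW]) simp
  also have "\<dots> = (\<integral>\<^sup>+\<omega>. \<integral>\<^sup>+x. G (restrict (X (x, \<omega>)) L2set2) \<partial>?N \<partial>M)"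
    by (intro NM.nn_integral_snd[symmetric] measurable_compose[OF white_noise_restrict_measurable[OF XW] G])
  also have "\<dots> = (\<integral>\<^sup>+\<omega>. \<integral>\<^sup>+x. F (Z (x + b / \<epsilon>) \<omega>) \<partial>?N \<partial>M)"
    by (simp only: Gr GX)
  also have "\<dots> = (\<integral>\<^sup>+\<omega>. \<integral>\<^sup>+x. ennreal (std_normal_density (x - b / \<epsilon>)) * F (Z x \<omega>) \<partial>lborel \<partial>M)"
  proof (intro nn_integral_cong)
    fix \<omega>
    have "(\<integral>\<^sup>+x. F (Z (x + b / \<epsilon>) \<omega>) \<partial>?N) = (\<integral>\<^sup>+x. ennreal (std_normal_density x) * F (Z (x + b / \<epsilon>) \<omega>) \<partial>lborel)"
      by (intro nn_integral_density) measurable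
    also have "\<dots> = (\<integral>\<^sup>+x. ennreal (std_normal_density (x - b / \<epsilon>)) * F (Z x \<omega>) \<partial>lborel)"
      by (subst nn_integral_real_affine[of "\<lambda>x. ennreal (std_normal_density (x - b / \<epsilon>)) * F (Z x \<omega>)" 1 "b / \<epsilon>"])
        (auto simp: add.commute)
    finally show "(\<integral>\<^sup>+x. F (Z (x + b / \<epsilon>) \<omega>) \<partial>?N) = (\<integral>\<^sup>+x. ennreal (std_normal_density (x - b / \<epsilon>)) * F (Z x \<omega>) \<partial>lborel)" .
  qed
  also have "\<dots> \<ge> (\<integral>\<^sup>+\<omega>. (\<integral>\<^sup>+x. ennreal (std_normal_density 2) * (indicator {0..1} x * F (Z x \<omega>)) \<partial>lborel) \<partial>M)"
  proof (intro nn_integral_mono)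
    fix \<omega> x
    show "ennreal (std_normal_density 2) * (indicator {0..1} x * F (Z x \<omega>)) \<le> ennreal (std_normal_density (x - b / \<epsilon>)) * F (Z x \<omega>)"
    proof (cases "x \<in> {0..1}")
      case True
      have "\<bar>b / \<epsilon>\<bar> \<le> 1" using b eps by (simp add: abs_divide)
      then have "\<bar>x - b / \<epsilon>\<bar> \<le> 2" using True unfolding abs_le_iff atLeastAtMost_iff by linarith
      then have "(x - b / \<epsilon>)\<^sup>2 \<le> 2\<^sup>2" by (metis abs_numeral abs_le_square_iff)
      then have "std_normal_density 2 \<le> std_normal_density (x - b / \<epsilon>)"
        unfolding std_normal_density_def by (intro mult_left_mono) auto
      then show ?thesis using True by (auto intro!: mult_right_mono ennreal_leI)
    qed simp
  qed
  also have "(\<integral>\<^sup>+\<omega>. (\<integral>\<^sup>+x. ennreal (std_normal_density 2) * (indicator {0..1} x * F (Z x \<omega>)) \<partial>lborel) \<partial>M)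
    = (\<integral>\<^sup>+\<omega>. ennreal (std_normal_density 2) * (\<integral>\<^sup>+x. (indicator {0..1} x * F (Z x \<omega>)) \<partial>lborel) \<partial>M)"
    by (intro nn_integral_cong nn_integral_cmult) measurable
  also have "\<dots> = ennreal (std_normal_density 2) * (\<integral>\<^sup>+\<omega>. (\<integral>\<^sup>+x. (indicator {0..1} x * F (Z x \<omega>)) \<partial>lborel) \<partial>M)"
    unfolding Z_def r_def by (rule nn_integral_cmult[OF split_observation_measurable[OF W e F]])
  finally show ?thesis
    by (simp only: Z_def r_def)
qed

text \<open>The laws with and without the shift dominate the same measure of total mass
  \<open>std_normal_density 2\<close>, and under that measure the two losses can be added
  pointwise.\<close>

lemma two_point_lower_bound:
  assumes W: "white_noise M W" and e: "e \<in> L2set2" and e1: "ip2 e e = 1"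
    and eps: "\<epsilon> > 0" and b: "\<bar>b\<bar> \<le> \<epsilon>"
    and F0: "F0 \<in> borel_measurable obs_space" and F1: "F1 \<in> borel_measurable obs_space"
    and D: "\<And>y. D \<le> F0 y + F1 y"
  shows "ennreal (std_normal_density 2) * D
    \<le> (\<integral>\<^sup>+\<omega>. F0 (restrict (\<lambda>\<phi>. m \<phi> + \<epsilon> * W \<omega> \<phi>) L2set2) \<partial>M)
      + (\<integral>\<^sup>+\<omega>. F1 (restrict (\<lambda>\<phi>. (m \<phi> + b * ip2 e \<phi>) + \<epsilon> * W \<omega> \<phi>) L2set2) \<partial>M)"
proof -
  interpret M: prob_space M by (rule white_noise_prob_space[OF W])
  define Z where "Z x \<omega> = restrict (\<lambda>\<phi>. m \<phi> + \<epsilon> * (ip2 \<phi> e * x + W \<omega> (\<lambda>u v. 1 * \<phi> u v + (- ip2 \<phi> e) * e u v))) L2set2" for x \<omega>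
  have Zm: "(\<lambda>x. Z x \<omega>) \<in> measurable borel obs_space" for \<omega>
    unfolding Z_def obs_space_def by (intro measurable_restrict) measurable
  note [measurable] = measurable_compose[OF Zm F0] measurable_compose[OF Zm F1]
  note fm = split_observation_measurable[OF W e F0, of m \<epsilon>, folded Z_def]
    split_observation_measurable[OF W e F1, of m \<epsilon>, folded Z_def]
  have "D = (\<integral>\<^sup>+\<omega>. (\<integral>\<^sup>+x. indicator {0..1::real} x * D \<partial>lborel) \<partial>M)"
    by (simp add: nn_integral_multc M.emeasure_space_1)
  also have "\<dots> \<le> (\<integral>\<^sup>+\<omega>. (\<integral>\<^sup>+x. indicator {0..1} x * F0 (Z x \<omega>) + indicator {0..1} x * F1 (Z x \<omega>) \<partial>lborel) \<partial>M)"
    using D by (intro nn_integral_mono) (auto split: split_indicator)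
  also have "\<dots> = (\<integral>\<^sup>+\<omega>. (\<integral>\<^sup>+x. indicator {0..1} x * F0 (Z x \<omega>) \<partial>lborel) + (\<integral>\<^sup>+x. indicator {0..1} x * F1 (Z x \<omega>) \<partial>lborel) \<partial>M)"
    by (intro nn_integral_cong nn_integral_add) measurable
  also have "\<dots> = (\<integral>\<^sup>+\<omega>. (\<integral>\<^sup>+x. indicator {0..1} x * F0 (Z x \<omega>) \<partial>lborel) \<partial>M) + (\<integral>\<^sup>+\<omega>. (\<integral>\<^sup>+x. indicator {0..1} x * F1 (Z x \<omega>) \<partial>lborel) \<partial>M)"
    by (rule nn_integral_add[OF fm])
  finally have le: "D \<le> (\<integral>\<^sup>+\<omega>. (\<integral>\<^sup>+x. indicator {0..1} x * F0 (Z x \<omega>) \<partial>lborel) \<partial>M)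
     + (\<integral>\<^sup>+\<omega>. (\<integral>\<^sup>+x. indicator {0..1} x * F1 (Z x \<omega>) \<partial>lborel) \<partial>M)" .
  have "ennreal (std_normal_density 2) * D \<le>
     ennreal (std_normal_density 2) * ((\<integral>\<^sup>+\<omega>. (\<integral>\<^sup>+x. indicator {0..1} x * F0 (Z x \<omega>) \<partial>lborel) \<partial>M)
     + (\<integral>\<^sup>+\<omega>. (\<integral>\<^sup>+x. indicator {0..1} x * F1 (Z x \<omega>) \<partial>lborel) \<partial>M))"
    by (rule mult_left_mono[OF le]) simp
  also have "\<dots> = ennreal (std_normal_density 2) * (\<integral>\<^sup>+\<omega>. (\<integral>\<^sup>+x. indicator {0..1} x * F0 (Z x \<omega>) \<partial>lborel) \<partial>M)
     + ennreal (std_normal_density 2) * (\<integral>\<^sup>+\<omega>. (\<integral>\<^sup>+x. indicator {0..1} x * F1 (Z x \<omega>) \<partial>lborel) \<partial>M)"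
    by (rule distrib_left)
  \<comment> \<open>The unshifted observation is the case \<open>b = 0\<close> of the same
    bound.\<close>
  also have "\<dots> \<le> (\<integral>\<^sup>+\<omega>. F0 (restrict (\<lambda>\<phi>. (m \<phi> + 0 * ip2 e \<phi>) + \<epsilon> * W \<omega> \<phi>) L2set2) \<partial>M)
      + (\<integral>\<^sup>+\<omega>. F1 (restrict (\<lambda>\<phi>. (m \<phi> + b * ip2 e \<phi>) + \<epsilon> * W \<omega> \<phi>) L2set2) \<partial>M)"
    unfolding Z_def
    by (intro add_mono shifted_observation_lower_bound[OF W e e1 eps] F0 F1 b) (use eps in simp)
  finally show ?thesis by simp
qed

section \<open>Coefficients of estimators and Assouad's argument\<close>

lemma ip2_null:
  assumes k: "k \<in> L2set2" and 0: "ip2 k k = 0"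
  shows "ip2 k \<phi> = 0"
proof -
  note [measurable] = L2set2_measurable[OF k]
  have "(\<integral>\<^sup>+ z. indicator sq01 z * ennreal ((case_prod k z)\<^sup>2) \<partial>lborel) = 0"
    using L2sq2_eq_ip2[OF k] 0 by (simp add: L2sq2_def)
  then have "AE z in lborel. indicator sq01 z * ennreal ((case_prod k z)\<^sup>2) = 0"
    by (subst (asm) nn_integral_0_iff_AE) auto
  then have "AE z in lborel. indicator sq01 z * case_prod k z * case_prod \<phi> z = 0"
    by eventually_elim (auto split: split_indicator_asm)
  then show ?thesis unfolding ip2_def by (rule integral_eq_zero_AE)
qed

text \<open>Supplies the unit direction that the two-point bound asks for. A null \<open>k\<close>
  has no direction of its own, so \<open>e0\<close> with coefficient 0 stands in for it.\<close>

lemma normalized_direction: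
  assumes k: "k \<in> L2set2" and e0: "e0 \<in> L2set2" "ip2 e0 e0 = 1" and c: "c\<^sup>2 * ip2 k k \<le> \<epsilon>\<^sup>2" and eps: "\<epsilon> > 0"
  obtains e b where "e \<in> L2set2" "ip2 e e = 1" "\<bar>b\<bar> \<le> \<epsilon>" "\<And>\<phi>. \<phi> \<in> L2set2 \<Longrightarrow> c * ip2 k \<phi> = b * ip2 e \<phi>"
proof (cases "ip2 k k = 0")
  case True
  show ?thesis
    by (rule that[of e0 0]) (use e0 eps ip2_null[OF k True] in auto)
next
  case False
  then have pos: "ip2 k k > 0" using ip2_self_nonneg[of k] by simp
  define \<kappa> where "\<kappa> = sqrt (ip2 k k)"
  have \<kappa>: "\<kappa> > 0" "\<kappa>\<^sup>2 = ip2 k k" using pos by (auto simp: \<kappa>_def)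
  define e where "e = (\<lambda>u x. (1 / \<kappa>) * k u x + 0 * k u x)"
  have eL: "e \<in> L2set2" unfolding e_def by (rule L2set2_lin[OF k k])
  have ek: "ip2 e \<phi> = ip2 k \<phi> / \<kappa>" if "\<phi> \<in> L2set2" for \<phi>
    unfolding e_def by (subst ip2_lin_left[OF k k that]) simp
  have "ip2 e e = ip2 k k / \<kappa>\<^sup>2"
    by (simp add: ek[OF eL] ip2_commute[of k e] ek[OF k] power2_eq_square)
  then have "ip2 e e = 1" unfolding \<kappa>(2) using pos by simp
  moreover have "\<bar>c * \<kappa>\<bar> \<le> \<epsilon>"
  proof -
    have "(c * \<kappa>)\<^sup>2 \<le> \<epsilon>\<^sup>2" using c \<kappa> by (simp add: power_mult_distrib)
    then show ?thesis using eps by (simp add: abs_le_square_iff[symmetric])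
  qed
  ultimately show ?thesis using eL ek \<kappa> by (intro that[of e "c * \<kappa>"]) auto
qed

lemma bessel:
  assumes I: "finite I" "\<And>i. i \<in> I \<Longrightarrow> e i \<in> L2set2"
    and on: "\<And>i j. i \<in> I \<Longrightarrow> j \<in> I \<Longrightarrow> ip2 (e i) (e j) = (if i = j then 1 else 0)"
    and d: "d \<in> L2set2"
  shows "(\<Sum>i\<in>I. (ip2 d (e i))\<^sup>2) \<le> ip2 d d"
proof -
  define p where "p = (\<lambda>u x. \<Sum>i\<in>I. ip2 d (e i) * e i u x)"
  have p: "p \<in> L2set2" unfolding p_def by (rule L2set2_sum[OF I])
  define r where "r = (\<lambda>u x. 1 * d u x + (-1) * p u x)"
  have r: "r \<in> L2set2" unfolding r_def by (rule L2set2_lin[OF d p])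
  let ?s = "\<Sum>i\<in>I. (ip2 d (e i))\<^sup>2"
  have pd: "ip2 p d = ?s"
    unfolding p_def by (subst ip2_sum_left[OF I d]) (auto simp: ip2_commute[of _ d] power2_eq_square)
  have pe: "ip2 p (e j) = ip2 d (e j)" if "j \<in> I" for j
  proof -
    have "ip2 p (e j) = (\<Sum>i\<in>I. ip2 d (e i) * ip2 (e i) (e j))"
      unfolding p_def by (rule ip2_sum_left[OF I I(2)[OF that]])
    also have "\<dots> = (\<Sum>i\<in>I. if i = j then ip2 d (e j) else 0)"
      by (intro sum.cong refl) (simp add: on that)
    finally show ?thesis using that I(1) by simp
  qed
  have pp: "ip2 p p = ?s"
  proof -
    have "ip2 p p = (\<Sum>i\<in>I. ip2 d (e i) * ip2 (e i) p)"
      by (subst (1) p_def) (rule ip2_sum_left[OF I p])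
    also have "\<dots> = ?s" using pe by (intro sum.cong) (auto simp: ip2_commute[of _ p] power2_eq_square)
    finally show ?thesis .
  qed
  have "0 \<le> ip2 r r" by (rule ip2_self_nonneg)
  also have "ip2 r r = 1 * ip2 d r + (-1) * ip2 p r"
    by (subst (1) r_def) (rule ip2_lin_left[OF d p r])
  also have "ip2 d r = ip2 d d - ip2 d p" unfolding r_def by (subst ip2_lin_right[OF d p d]) simp
  also have "ip2 p r = ip2 p d - ip2 p p" unfolding r_def by (subst ip2_lin_right[OF d p p]) simp
  finally show ?thesis by (simp add: pd pp ip2_commute[of d p])
qed

text \<open>Bessel's inequality for the difference splits the integrated loss into losses of single
  coefficients. Since an estimator is merely measurable, the loss may be infinite, and then nothing
  is to be shown; a finite loss puts the difference into \<open>L2set2\<close>.\<close>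

lemma L2sq2_diff_ge_coefficients:
  assumes I: "finite I" "\<And>i. i \<in> I \<Longrightarrow> e i \<in> L2set2"
    and on: "\<And>i j. i \<in> I \<Longrightarrow> j \<in> I \<Longrightarrow> ip2 (e i) (e j) = (if i = j then 1 else 0)"
    and h: "case_prod h \<in> borel_measurable borel"
  shows "(\<Sum>i\<in>I. ennreal ((ip2 h (e i) - c i)\<^sup>2)) \<le> L2sq2 (\<lambda>u x. h u x - (\<Sum>i\<in>I. c i * e i u x))"
proof (cases "L2sq2 (\<lambda>u x. h u x - (\<Sum>i\<in>I. c i * e i u x)) = \<infinity>")
  case False
  define f where "f = (\<lambda>u x. \<Sum>i\<in>I. c i * e i u x)"
  have f: "f \<in> L2set2" unfolding f_def by (rule L2set2_sum[OF I])
  define d where "d = (\<lambda>u x. h u x - f u x)"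
  have "case_prod d = (\<lambda>z. case_prod h z - case_prod f z)" by (auto simp: d_def)
  then have "case_prod d \<in> borel_measurable borel"
    using borel_measurable_diff[OF h L2set2_measurable[OF f]] by (simp only:)
  moreover have "L2sq2 d < \<infinity>" using False by (simp add: d_def f_def less_top)
  ultimately have d: "d \<in> L2set2" by (simp add: L2set2_def)
  have hd: "h = (\<lambda>u x. 1 * d u x + 1 * f u x)" by (auto simp: d_def)
  have fe: "ip2 f (e i) = c i" if "i \<in> I" for i
  proof -
    have "ip2 f (e i) = (\<Sum>j\<in>I. c j * ip2 (e j) (e i))"
      unfolding f_def by (rule ip2_sum_left[OF I I(2)[OF that]])
    also have "\<dots> = (\<Sum>j\<in>I. if j = i then c i else 0)"
      by (intro sum.cong refl) (simp add: on that)
    finally show ?thesis using that I(1) by simp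
  qed
  have "ip2 h (e i) - c i = ip2 d (e i)" if "i \<in> I" for i
    using ip2_lin_left[OF d f I(2)[OF that], of 1 1] fe[OF that] unfolding hd[symmetric] by simp
  then have "(\<Sum>i\<in>I. ennreal ((ip2 h (e i) - c i)\<^sup>2)) = ennreal (\<Sum>i\<in>I. (ip2 d (e i))\<^sup>2)"
    by simp
  also have "\<dots> \<le> ennreal (ip2 d d)" by (intro ennreal_leI bessel[OF I on d])
  also have "\<dots> = L2sq2 d" by (rule L2sq2_eq_ip2[OF d, symmetric])
  finally show ?thesis by (simp add: d_def f_def)
qed simp

text \<open>Pairs every sign pattern that is negative at \<open>i\<close> with the one that differs
  from it only at \<open>i\<close>.\<close>

lemma sum_Pow_split:
  assumes "finite I" "i \<in> I"
  shows "(\<Sum>S\<in>Pow I. f S) = (\<Sum>S\<in>Pow (I - {i}). f S + f (insert i S))"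
proof -
  have I: "I = insert i (I - {i})" using assms by auto
  have disj: "Pow (I - {i}) \<inter> insert i ` Pow (I - {i}) = {}" by auto
  have inj: "inj_on (insert i) (Pow (I - {i}))" by (rule inj_onI) blast
  have "(\<Sum>S\<in>Pow I. f S) = (\<Sum>S\<in>Pow (I - {i}) \<union> insert i ` Pow (I - {i}). f S)"
    by (subst I, subst Pow_insert) simp
  also have "\<dots> = (\<Sum>S\<in>Pow (I - {i}). f S) + (\<Sum>S\<in>insert i ` Pow (I - {i}). f S)"
    using assms disj by (intro sum.union_disjoint) auto
  also have "\<dots> = (\<Sum>S\<in>Pow (I - {i}). f S + f (insert i S))"
    by (simp add: sum.reindex[OF inj] sum.distrib)
  finally show ?thesis .
qed

text \<open>Joint measurability of the estimator in the observation and the point of the square is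
  what makes its coefficients random variables, so that the risk can be exchanged with the sum over
  indices.\<close>

lemma estimator_coefficient_measurable:
  assumes fe: "fe \<in> estimators" and e: "e \<in> L2set2"
  shows "(\<lambda>y. ip2 (fe y) e) \<in> borel_measurable obs_space"
proof -
  have sb: "sets (obs_space \<Otimes>\<^sub>M (lborel :: (real \<times> real) measure)) = sets (obs_space \<Otimes>\<^sub>M borel)"
    by (rule sets_pair_measure_cong) auto
  have mf: "(\<lambda>p. fe (fst p) (fst (snd p)) (snd (snd p))) \<in> borel_measurable (obs_space \<Otimes>\<^sub>M (lborel :: (real \<times> real) measure))"
    using fe unfolding estimators_def measurable_cong_sets[OF sb refl] by (simp add: case_prod_beta')
  have me: "case_prod e \<in> borel_measurable lborel" using L2set2_measurable[OF e] by simp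
  have mi: "(\<lambda>p. indicator sq01 (snd p) :: real) \<in> borel_measurable (obs_space \<Otimes>\<^sub>M (lborel :: (real \<times> real) measure))"
    by measurable
  have "(\<lambda>p. indicator sq01 (snd p) * fe (fst p) (fst (snd p)) (snd (snd p)) * case_prod e (snd p))
      \<in> borel_measurable (obs_space \<Otimes>\<^sub>M (lborel :: (real \<times> real) measure))"
    by (intro borel_measurable_times mi mf measurable_compose[OF measurable_snd me])
  then have "(\<lambda>(y, z). indicator sq01 z * fe y (fst z) (snd z) * case_prod e z)
      \<in> borel_measurable (obs_space \<Otimes>\<^sub>M (lborel :: (real \<times> real) measure))"
    by (simp only: case_prod_beta' fst_conv snd_conv)
  then have "(\<lambda>y. \<integral>z. indicator sq01 z * fe y (fst z) (snd z) * case_prod e z \<partial>lborel) \<in> borel_measurable obs_space"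
    by (rule lborel.borel_measurable_lebesgue_integral)
  then show ?thesis by (simp add: ip2_def case_prod_beta')
qed

lemma estimator_section_measurable:
  assumes fe: "fe \<in> estimators" and y: "y \<in> space obs_space"
  shows "case_prod (fe y) \<in> borel_measurable borel"
proof -
  have "(\<lambda>z. (y, z)) \<in> measurable borel (obs_space \<Otimes>\<^sub>M (borel :: (real \<times> real) measure))"
    using y by simp
  moreover have "(\<lambda>(y, z). fe y (fst z) (snd z)) \<in> borel_measurable (obs_space \<Otimes>\<^sub>M (borel :: (real \<times> real) measure))"
    using fe by (simp add: estimators_def)
  ultimately have "(\<lambda>z. case_prod (\<lambda>y z. fe y (fst z) (snd z)) (y, z)) \<in> borel_measurable borel"
    by (rule measurable_compose)
  then show ?thesis by (simp add: case_prod_beta')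
qed

lemma obs_measurable:
  assumes "white_noise M W"
  shows "obs g f \<epsilon> W \<in> measurable M obs_space"
proof -
  note [measurable] = white_noise_measurable[OF assms]
  show ?thesis unfolding obs_def[abs_def] obs_space_def by (intro measurable_restrict) measurable
qed

text \<open>The operator enters only through linearity and the images \<open>k i\<close>. The
  supremum over \<open>V\<close> dominates the average over all sign patterns. In this average the
  loss at each index is summed over pairs of patterns that differ there, and the two-point bound
  treats each pair, the norm condition on \<open>2 * \<beta>\<close> times \<open>k i\<close> being
  exactly the smallness it requires.\<close>

theorem assouad_lower_bound:
  fixes e k :: "'i \<Rightarrow> real \<Rightarrow> real \<Rightarrow> real"
  assumes W: "white_noise M W" and eps: "\<epsilon> > 0"
    and I: "finite I" "\<And>i. i \<in> I \<Longrightarrow> e i \<in> L2set2"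
    and on: "\<And>i j. i \<in> I \<Longrightarrow> j \<in> I \<Longrightarrow> ip2 (e i) (e j) = (if i = j then 1 else 0)"
    and V: "\<And>\<theta>. (\<forall>i. \<bar>\<theta> i\<bar> = 1) \<Longrightarrow> (\<lambda>u x. \<Sum>i\<in>I. \<beta> * \<theta> i * e i u x) \<in> V"
    and K: "\<And>\<theta> \<phi>. \<phi> \<in> L2set2 \<Longrightarrow>
        ip2 (Kop g (\<lambda>u x. \<Sum>i\<in>I. \<beta> * \<theta> i * e i u x)) \<phi> = (\<Sum>i\<in>I. \<beta> * \<theta> i * ip2 (k i) \<phi>)"
    and k: "\<And>i. i \<in> I \<Longrightarrow> k i \<in> L2set2" "\<And>i. i \<in> I \<Longrightarrow> (2 * \<beta>)\<^sup>2 * ip2 (k i) (k i) \<le> \<epsilon>\<^sup>2"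
  shows "ennreal (std_normal_density 2 * real (card I) * \<beta>\<^sup>2) \<le> minimax_risk M W g \<epsilon> V"
  unfolding minimax_risk_def
proof (rule INF_greatest)
  fix fe assume fe: "fe \<in> estimators"
  \<comment> \<open>Subsets encode sign patterns, so that flipping a minus sign at \<open>i\<close>
    becomes \<open>insert i\<close>.\<close>
  define s where "s S i = (if i \<in> S then 1 else -1 :: real)" for S :: "'i set" and i
  define f where "f S = (\<lambda>u x. \<Sum>i\<in>I. \<beta> * s S i * e i u x)" for S
  define L where "L S i = (\<integral>\<^sup>+\<omega>. ennreal ((ip2 (fe (obs g (f S) \<epsilon> W \<omega>)) (e i) - \<beta> * s S i)\<^sup>2) \<partial>M)" for S i
  have coef: "(\<lambda>y. ennreal ((ip2 (fe y) (e i) - c)\<^sup>2)) \<in> borel_measurable obs_space" if "i \<in> I" for i c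
  proof -
    note [measurable] = estimator_coefficient_measurable[OF fe I(2)[OF that]]
    show ?thesis by measurable
  qed
  have riskL: "(\<Sum>i\<in>I. L S i) \<le> risk M W g \<epsilon> fe (f S)" for S
  proof -
    have "(\<Sum>i\<in>I. L S i) = (\<integral>\<^sup>+\<omega>. (\<Sum>i\<in>I. ennreal ((ip2 (fe (obs g (f S) \<epsilon> W \<omega>)) (e i) - \<beta> * s S i)\<^sup>2)) \<partial>M)"
      unfolding L_def
      by (intro nn_integral_sum[symmetric] measurable_compose[OF obs_measurable[OF W] coef])
    also have "\<dots> \<le> risk M W g \<epsilon> fe (f S)"
      unfolding risk_def f_def
    proof (rule nn_integral_mono)
      fix \<omega> assume "\<omega> \<in> space M"
      then have "obs g (f S) \<epsilon> W \<omega> \<in> space obs_space"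
        using measurable_space[OF obs_measurable[OF W]] by blast
      from L2sq2_diff_ge_coefficients[OF I on estimator_section_measurable[OF fe this], of "\<lambda>i. \<beta> * s S i"]
      show "(\<Sum>i\<in>I. ennreal ((ip2 (fe (obs g (\<lambda>u x. \<Sum>i\<in>I. \<beta> * s S i * e i u x) \<epsilon> W \<omega>)) (e i) - \<beta> * s S i)\<^sup>2))
        \<le> L2sq2 (\<lambda>u x. fe (obs g (\<lambda>u x. \<Sum>i\<in>I. \<beta> * s S i * e i u x) \<epsilon> W \<omega>) u x - (\<Sum>i\<in>I. \<beta> * s S i * e i u x))"
        unfolding f_def .
    qed
    finally show ?thesis .
  qed
  have pair: "ennreal (std_normal_density 2) * ennreal (2 * \<beta>\<^sup>2) \<le> L S i + L (insert i S) i"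
    if i: "i \<in> I" and S: "S \<subseteq> I - {i}" for S i
  proof -
    obtain d b where d: "d \<in> L2set2" "ip2 d d = 1" and b: "\<bar>b\<bar> \<le> \<epsilon>"
      and db: "\<And>\<phi>. \<phi> \<in> L2set2 \<Longrightarrow> (2 * \<beta>) * ip2 (k i) \<phi> = b * ip2 d \<phi>"
      using normalized_direction[OF k(1)[OF i] I(2)[OF i] _ k(2)[OF i] eps] on[OF i i] by auto
    define m where "m \<phi> = ip2 (Kop g (f S)) \<phi>" for \<phi>
    have sS: "s (insert i S) j = (if j = i then 1 else s S j)" for j by (auto simp: s_def)
    have m': "ip2 (Kop g (f (insert i S))) \<phi> = m \<phi> + b * ip2 d \<phi>" if \<phi>: "\<phi> \<in> L2set2" for \<phi>
    proof -
      have "ip2 (Kop g (f (insert i S))) \<phi> - m \<phi> = (\<Sum>j\<in>I. \<beta> * s (insert i S) j * ip2 (k j) \<phi> - \<beta> * s S j * ip2 (k j) \<phi>)"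
        unfolding m_def f_def K[OF \<phi>] by (simp add: sum_subtractf)
      also have "\<dots> = (\<Sum>j\<in>I. if j = i then (2 * \<beta>) * ip2 (k i) \<phi> else 0)"
        using S by (intro sum.cong) (auto simp: s_def)
      also have "\<dots> = b * ip2 d \<phi>" using i I db[OF \<phi>] by simp
      finally show ?thesis by simp
    qed
    have o0: "obs g (f S) \<epsilon> W \<omega> = restrict (\<lambda>\<phi>. m \<phi> + \<epsilon> * W \<omega> \<phi>) L2set2" for \<omega>
      by (simp add: obs_def m_def)
    have o1: "obs g (f (insert i S)) \<epsilon> W \<omega> = restrict (\<lambda>\<phi>. (m \<phi> + b * ip2 d \<phi>) + \<epsilon> * W \<omega> \<phi>) L2set2" for \<omega>
      unfolding obs_def by (rule restrict_ext) (simp add: m')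
    have s0: "s S i = -1" "s (insert i S) i = 1" using S by (auto simp: s_def)
    show ?thesis unfolding L_def o0 o1
    proof (rule two_point_lower_bound[OF W d eps b coef[OF i] coef[OF i]])
      fix y
      \<comment> \<open>No number is close to both \<open>\<beta>\<close> and
        \<open>- \<beta>\<close>: the right-hand side exceeds the left by twice the square of the
        estimated coefficient.\<close>
      have "2 * \<beta>\<^sup>2 \<le> (ip2 (fe y) (e i) + \<beta>)\<^sup>2 + (ip2 (fe y) (e i) - \<beta>)\<^sup>2"
        using zero_le_power2[of "ip2 (fe y) (e i)"] by (simp add: power2_eq_square algebra_simps)
      then show "ennreal (2 * \<beta>\<^sup>2) \<le> ennreal ((ip2 (fe y) (e i) - \<beta> * s S i)\<^sup>2) + ennreal ((ip2 (fe y) (e i) - \<beta> * s (insert i S) i)\<^sup>2)"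
        unfolding s0 by (simp add: ennreal_leI flip: ennreal_plus)
    qed
  qed
  let ?R = "SUP f\<in>V. risk M W g \<epsilon> fe f"
  let ?D = "std_normal_density 2 * real (card I) * \<beta>\<^sup>2"
  have cardP: "card (Pow I) = 2 ^ card I" using I by (simp add: card_Pow)
  \<comment> \<open>Each index has \<open>2 ^ (card I - 1)\<close> pairs, and the factor 2 in
    \<open>2 * \<beta>\<^sup>2\<close> completes this to the number \<open>2 ^ card I\<close> of
    sign patterns.\<close>
  have "ennreal (real (card (Pow I)) * ?D) = (\<Sum>i\<in>I. \<Sum>S\<in>Pow (I - {i}). ennreal (std_normal_density 2) * ennreal (2 * \<beta>\<^sup>2))"
  proof -
    have "(\<Sum>i\<in>I. \<Sum>S\<in>Pow (I - {i}). ennreal (std_normal_density 2) * ennreal (2 * \<beta>\<^sup>2))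
       = (\<Sum>i\<in>I. ennreal (2 ^ (card I - 1) * (std_normal_density 2 * (2 * \<beta>\<^sup>2))))"
      using I by (intro sum.cong refl)
        (simp add: card_Pow ennreal_mult[symmetric] ennreal_of_nat_eq_real_of_nat)
    also have "\<dots> = ennreal (real (card I) * (2 ^ (card I - 1) * (std_normal_density 2 * (2 * \<beta>\<^sup>2))))"
      by (simp add: ennreal_mult[symmetric] ennreal_of_nat_eq_real_of_nat)
    also have "real (card I) * (2 ^ (card I - 1) * (std_normal_density 2 * (2 * \<beta>\<^sup>2))) = real (card (Pow I)) * ?D"
      unfolding cardP by (cases "card I") auto
    finally show ?thesis by simp
  qed
  also have "\<dots> \<le> (\<Sum>i\<in>I. \<Sum>S\<in>Pow (I - {i}). L S i + L (insert i S) i)"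
    by (intro sum_mono pair) auto
  also have "\<dots> = (\<Sum>i\<in>I. \<Sum>S\<in>Pow I. L S i)"
    using I(1) by (intro sum.cong refl sum_Pow_split[symmetric])
  also have "\<dots> = (\<Sum>S\<in>Pow I. \<Sum>i\<in>I. L S i)" by (rule sum.swap)
  also have "\<dots> \<le> (\<Sum>S\<in>Pow I. ?R)"
  proof (rule sum_mono)
    fix S
    have "f S \<in> V" unfolding f_def by (rule V) (simp add: s_def)
    then show "(\<Sum>i\<in>I. L S i) \<le> ?R" by (intro order_trans[OF riskL] SUP_upper)
  qed
  also have "\<dots> = ennreal (real (card (Pow I))) * ?R" by (simp add: ennreal_of_nat_eq_real_of_nat)
  finally have "ennreal (real (card (Pow I))) * ennreal ?D \<le> ennreal (real (card (Pow I))) * ?R"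
    by (subst (asm) ennreal_mult) auto
  then show "ennreal ?D \<le> ?R"
    using cardP by (subst (asm) ennreal_mult_le_mult_iff) (auto simp: I)
qed

section \<open>Band-limited periodized wavelets\<close>

inductive trigpoly :: "(real \<Rightarrow> complex) \<Rightarrow> bool" where
  monom: "trigpoly (\<lambda>x. c * cis (real_of_int m * x))"
| add: "trigpoly f \<Longrightarrow> trigpoly g \<Longrightarrow> trigpoly (\<lambda>x. f x + g x)"

text \<open>
  Closure under products is what the Stone-Weierstrass theorem on the unit circle needs.
\<close>

lemma trigpoly_mult:
  assumes "trigpoly f" "trigpoly g"
  shows "trigpoly (\<lambda>x. f x * g x)"
  using assms
proof (induction f)
  case (monom c m)
  then show ?case
  proof (induction g)
    case (monom d n)
    have "(\<lambda>x. c * cis (real_of_int m * x) * (d * cis (real_of_int n * x)))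
       = (\<lambda>x. (c * d) * cis (real_of_int (m + n) * x))"
      by (simp add: fun_eq_iff distrib_right flip: cis_mult)
    then show ?case by (simp only: trigpoly.monom)
  next
    case (add f g)
    then show ?case by (simp add: distrib_left trigpoly.add)
  qed
next
  case (add f g)
  then show ?case by (simp add: distrib_right trigpoly.add)
qed

lemma trigpoly_integral_zero:
  assumes h: "integrable lborel h"
    and z: "\<And>m::int. (CLINT x|lborel. h x * cis (- (2 * pi * real_of_int m * x))) = 0"
    and f: "trigpoly f"
  shows "integrable lborel (\<lambda>x. h x * f (2 * pi * x)) \<and> (CLINT x|lborel. h x * f (2 * pi * x)) = 0"
  using f
proof induction
  case (monom c m)
  have [measurable]: "h \<in> borel_measurable borel" using h by auto
  have i: "integrable lborel (\<lambda>x. h x * cis (2 * pi * real_of_int m * x))"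
    by (rule Bochner_Integration.integrable_bound[OF h]) (auto simp: norm_mult)
  have eq: "h x * (c * cis (real_of_int m * (2 * pi * x))) = c * (h x * cis (2 * pi * real_of_int m * x))" for x
    by (simp add: mult_ac)
  show ?case unfolding eq using i z[of "-m"] by simp
next
  case (add f g)
  then show ?case by (simp add: distrib_left)
qed

text \<open>Continuous functions of \<open>cis (2 * pi * x)\<close> are uniform limits of
  trigonometric polynomials by Stone-Weierstrass on the unit circle, and \<open>h\<close> integrates
  to zero against those. Composing with \<open>cis\<close> builds the periodicity in.\<close>

lemma continuous_integral_zero:
  assumes h: "integrable lborel h"
    and z: "\<And>m::int. (CLINT x|lborel. h x * cis (- (2 * pi * real_of_int m * x))) = 0"
    and F: "continuous_on UNIV (F :: complex \<Rightarrow> real)"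
  shows "(CLINT x|lborel. h x * complex_of_real (F (cis (2 * pi * x)))) = 0"
proof -
  have [measurable]: "h \<in> borel_measurable borel" using h by auto
  have [measurable]: "F \<in> borel_measurable borel" using F by (rule borel_measurable_continuous_onI)
  \<comment> \<open>The algebra for Stone-Weierstrass: real functions on the plane that become
    trigonometric polynomials on the circle. \<open>Re\<close> and \<open>Im\<close> belong to it
    and separate points.\<close>
  define P where "P f \<longleftrightarrow> continuous_on UNIV f \<and> trigpoly (\<lambda>x. complex_of_real (f (cis x)))"
    for f :: "complex \<Rightarrow> real"
  have PRe: "P Re"
  proof -
    have "(\<lambda>x. complex_of_real (Re (cis x))) = (\<lambda>x. 1/2 * cis (real_of_int 1 * x) + 1/2 * cis (real_of_int (-1) * x))"
      by (simp add: fun_eq_iff complex_eq_iff)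
    then show ?thesis unfolding P_def
      by (simp only: trigpoly.add trigpoly.monom) (simp add: continuous_intros)
  qed
  have PIm: "P Im"
  proof -
    have "(\<lambda>x. complex_of_real (Im (cis x))) = (\<lambda>x. (-\<i>/2) * cis (real_of_int 1 * x) + (\<i>/2) * cis (real_of_int (-1) * x))"
      by (simp add: fun_eq_iff complex_eq_iff)
    then show ?thesis unfolding P_def
      by (simp only: trigpoly.add trigpoly.monom) (simp add: continuous_intros)
  qed
  have dense: "\<exists>g. P g \<and> (\<forall>x\<in>sphere 0 1. \<bar>F x - g x\<bar> < e)" if "0 < e" for e
  proof (rule Stone_Weierstrass_HOL[where P=P])
    show "compact (sphere (0::complex) 1)" by simp
    show "P (\<lambda>x. c)" for c
      using trigpoly.monom[of "complex_of_real c" 0] by (simp add: P_def)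
    show "continuous_on (sphere 0 1) f" if "P f" for f
      using that continuous_on_subset by (auto simp: P_def)
    show "P (\<lambda>x. f x + g x)" if "P f \<and> P g" for f g
      using that by (auto simp: P_def intro: trigpoly.add continuous_intros)
    show "P (\<lambda>x. f x * g x)" if "P f \<and> P g" for f g
      using that by (auto simp: P_def intro: trigpoly_mult continuous_intros)
    show "\<exists>f. P f \<and> f x \<noteq> f y" if "x \<in> sphere 0 1 \<and> y \<in> sphere 0 1 \<and> x \<noteq> y" for x y
      using that PRe PIm by (metis complex_eqI)
    show "continuous_on (sphere 0 1) F" using F continuous_on_subset by blast
  qed (rule that)
  have "compact (F ` sphere 0 1)"
    by (intro compact_continuous_image continuous_on_subset[OF F]) auto
  then have "bounded (F ` sphere 0 1)" by (rule compact_imp_bounded)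
  then obtain C where "\<forall>y\<in>F ` sphere 0 1. norm y \<le> C" unfolding bounded_iff by blast
  then have C: "\<bar>F x\<bar> \<le> C" if "x \<in> sphere 0 1" for x using that by auto
  have iF: "integrable lborel (\<lambda>x. h x * complex_of_real (F (cis (2 * pi * x))))"
  proof (rule Bochner_Integration.integrable_bound)
    show "integrable lborel (\<lambda>x. C * norm (h x))" using h by simp
    have "norm (h x * complex_of_real (F (cis (2 * pi * x)))) \<le> norm (C * norm (h x))" for x
    proof -
      have "\<bar>F (cis (2 * pi * x))\<bar> \<le> C" by (rule C) simp
      then show ?thesis using mult_right_mono[of "\<bar>F (cis (2 * pi * x))\<bar>" C "norm (h x)"]
        by (auto simp: norm_mult mult.commute abs_mult)
    qed
    then show "AE x in lborel. norm (h x * complex_of_real (F (cis (2 * pi * x)))) \<le> norm (C * norm (h x))" by simp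
  qed measurable
  have "norm (CLINT x|lborel. h x * complex_of_real (F (cis (2 * pi * x)))) \<le> e * (\<integral>x. norm (h x) \<partial>lborel)"
    if e: "0 < e" for e
  proof -
    obtain g where g: "P g" and ge: "\<And>x. x \<in> sphere 0 1 \<Longrightarrow> \<bar>F x - g x\<bar> < e"
      using dense[OF e] by auto
    have ig: "integrable lborel (\<lambda>x. h x * complex_of_real (g (cis (2 * pi * x))))"
      and g0: "(CLINT x|lborel. h x * complex_of_real (g (cis (2 * pi * x)))) = 0"
      using trigpoly_integral_zero[OF h z] g by (auto simp: P_def)
    have "(CLINT x|lborel. h x * complex_of_real (F (cis (2 * pi * x))))
      = (CLINT x|lborel. h x * complex_of_real (F (cis (2 * pi * x))) - h x * complex_of_real (g (cis (2 * pi * x))))"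
      by (simp add: iF ig g0)
    also have "norm \<dots> \<le> (\<integral>x. norm (h x * complex_of_real (F (cis (2 * pi * x))) - h x * complex_of_real (g (cis (2 * pi * x)))) \<partial>lborel)"
      by (rule integral_norm_bound)
    also have "\<dots> \<le> (\<integral>x. e * norm (h x) \<partial>lborel)"
    proof (rule integral_mono)
      fix x :: real
      have "\<bar>F (cis (2 * pi * x)) - g (cis (2 * pi * x))\<bar> \<le> e" using ge[of "cis (2 * pi * x)"] by simp
      then have "norm (h x) * \<bar>F (cis (2 * pi * x)) - g (cis (2 * pi * x))\<bar> \<le> norm (h x) * e"
        by (intro mult_left_mono) auto
      moreover have "h x * complex_of_real (F (cis (2 * pi * x))) - h x * complex_of_real (g (cis (2 * pi * x)))
         = h x * complex_of_real (F (cis (2 * pi * x)) - g (cis (2 * pi * x)))" by (simp add: algebra_simps)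
      ultimately show "norm (h x * complex_of_real (F (cis (2 * pi * x))) - h x * complex_of_real (g (cis (2 * pi * x)))) \<le> e * norm (h x)"
        by (simp only: norm_mult norm_of_real mult.commute[of e])
    qed (use h iF ig in auto)
    finally show ?thesis by simp
  qed
  note bound = this
  have "norm (CLINT x|lborel. h x * complex_of_real (F (cis (2 * pi * x)))) \<le> 0 + e" if "0 < e" for e
  proof -
    define I where "I = (\<integral>x. norm (h x) \<partial>lborel)"
    have I: "0 \<le> I" by (simp add: I_def)
    \<comment> \<open>The added 1 keeps the denominator positive when \<open>h\<close> is
      null.\<close>
    have "e / (I + 1) * I \<le> e" using that I by (simp add: field_simps)
    moreover have "0 < e / (I + 1)" using that I by simp
    from bound[OF this] have "norm (CLINT x|lborel. h x * complex_of_real (F (cis (2 * pi * x)))) \<le> e / (I + 1) * I"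
      by (simp only: I_def)
    ultimately show ?thesis by linarith
  qed
  then have "norm (CLINT x|lborel. h x * complex_of_real (F (cis (2 * pi * x)))) \<le> 0"
    by (rule field_le_epsilon)
  then show ?thesis by simp
qed

text \<open>Truncated multiples of the distance to the image of \<open>K\<close> on the circle
  converge to the indicator of that image, so dominated convergence leads from continuous functions
  to \<open>K\<close>. The points 0 and 1 have the same image on the circle, which is why
  \<open>h\<close> and \<open>K\<close> are confined to the open interval.\<close>

lemma compact_integral_zero:
  assumes h: "integrable lborel h"
    and z: "\<And>m::int. (CLINT x|lborel. h x * cis (- (2 * pi * real_of_int m * x))) = 0"
    and supp: "\<And>x. x \<notin> {0<..<1} \<Longrightarrow> h x = 0"
    and K: "compact K" "K \<subseteq> {0<..<1}"
  shows "(CLINT x|lborel. h x * indicator K x) = 0"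
proof (cases "K = {}")
  case False
  have [measurable]: "h \<in> borel_measurable borel" using h by auto
  have [measurable]: "K \<in> sets borel" using K by (simp add: borel_compact)
  define A where "A = (\<lambda>x. cis (2 * pi * x)) ` K"
  have "compact A" unfolding A_def by (intro compact_continuous_image continuous_intros K)
  then have A: "closed A" "A \<noteq> {}" using False by (auto simp: compact_imp_closed A_def)
  have AK: "cis (2 * pi * x) \<in> A \<longleftrightarrow> x \<in> K" if x: "x \<in> {0<..<1}" for x
  proof
    assume "cis (2 * pi * x) \<in> A"
    then obtain y where y: "y \<in> K" "cis (2 * pi * x) = cis (2 * pi * y)" by (auto simp: A_def)
    with K have y01: "y \<in> {0<..<1}" by auto
    from y(2) have "sin (2 * pi * x) = sin (2 * pi * y) \<and> cos (2 * pi * x) = cos (2 * pi * y)"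
      by (simp add: complex_eq_iff)
    then obtain n :: int where "2 * pi * x = 2 * pi * y + 2 * pi * n" by (auto simp: sin_cos_eq_iff)
    then have n: "x = y + n" by (simp flip: distrib_left)
    with x y01 have "n = 0" by auto
    then show "x \<in> K" using y n by simp
  qed (auto simp: A_def)
  define F where "F n z = max 0 (1 - real n * infdist z A)" for n z
  have cF: "continuous_on UNIV (F n)" for n
    unfolding F_def by (intro continuous_intros)
  have F01: "\<bar>F n z\<bar> \<le> 1" for n z unfolding F_def using infdist_nonneg[of z A] by auto
  have [measurable]: "F n \<in> borel_measurable borel" for n using cF by (rule borel_measurable_continuous_onI)
  have lim: "(\<lambda>n. F n z) \<longlonglongrightarrow> indicator A z" for z
  proof (cases "z \<in> A")
    case True
    then have "infdist z A = 0" by simp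
    then show ?thesis using True by (simp add: F_def)
  next
    case False
    then have d: "infdist z A > 0" using A by (simp add: infdist_pos_not_in_closed)
    have "eventually (\<lambda>n. F n z = 0) sequentially"
    proof -
      obtain N :: nat where N: "1 / infdist z A < real N" using reals_Archimedean2 by blast
      have "F n z = 0" if "N \<le> n" for n
      proof -
        have "1 / infdist z A < real n" using N that by simp
        then show ?thesis using d by (simp add: F_def field_simps)
      qed
      then show ?thesis unfolding eventually_sequentially by blast
    qed
    then have "(\<lambda>n. F n z) \<longlonglongrightarrow> 0" by (rule tendsto_eventually)
    then show ?thesis using False by simp
  qed
  have "(\<lambda>n. CLINT x|lborel. h x * complex_of_real (F n (cis (2 * pi * x)))) \<longlonglongrightarrow> (CLINT x|lborel. h x * indicator K x)"
  proof (rule integral_dominated_convergence)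
    show "integrable lborel (\<lambda>x. norm (h x))" using h by simp
    show "AE x in lborel. (\<lambda>n. h x * complex_of_real (F n (cis (2 * pi * x)))) \<longlonglongrightarrow> h x * indicator K x"
    proof (intro AE_I2)
      fix x :: real
      show "(\<lambda>n. h x * complex_of_real (F n (cis (2 * pi * x)))) \<longlonglongrightarrow> h x * indicator K x"
      proof (cases "x \<in> {0<..<1}")
        case True
        have "indicator K x = complex_of_real (indicator A (cis (2 * pi * x)))"
          using AK[OF True] by (auto simp: indicator_def)
        then show ?thesis by (simp only:) (intro tendsto_intros lim)
      qed (simp add: supp)
    qed
    show "AE x in lborel. norm (h x * complex_of_real (F n (cis (2 * pi * x)))) \<le> norm (h x)" for n
      using F01 by (intro AE_I2) (simp add: norm_mult mult_left_le)
  qed measurable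
  moreover have "(CLINT x|lborel. h x * complex_of_real (F n (cis (2 * pi * x)))) = 0" for n
    by (rule continuous_integral_zero[OF h z cF])
  ultimately show ?thesis by (simp add: LIMSEQ_const_iff)
qed simp

text \<open>The density \<open>ennreal (k x)\<close> is the positive part of \<open>k\<close> and
  defines a finite measure. Inner regularity computes the mass of \<open>{x. k x > 0}\<close> from
  its compact subsets, and all of these have mass zero.\<close>

lemma AE_nonpos_of_compact_integrals:
  fixes k :: "real \<Rightarrow> real"
  assumes k: "integrable lborel k"
    and z: "\<And>K. compact K \<Longrightarrow> K \<subseteq> {x. k x > 0} \<Longrightarrow> (\<integral>x. k x * indicator K x \<partial>lborel) = 0"
  shows "AE x in lborel. k x \<le> 0"
proof -
  have [measurable]: "k \<in> borel_measurable borel" using k by auto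
  let ?\<nu> = "density lborel (\<lambda>x. ennreal (k x))" and ?E = "{x. k x > 0}"
  have fin: "emeasure ?\<nu> (space ?\<nu>) \<noteq> \<infinity>"
    using k by (auto simp: emeasure_density real_integrable_def top_unique)
  have E: "?E \<in> sets borel" by measurable
  have "emeasure ?\<nu> K = 0" if K: "K \<subseteq> ?E" "compact K" for K
  proof -
    have [measurable]: "K \<in> sets borel" using K by (simp add: borel_compact)
    have "emeasure ?\<nu> K = (\<integral>\<^sup>+x. ennreal (k x * indicator K x) \<partial>lborel)"
      by (auto simp: emeasure_density intro!: nn_integral_cong split: split_indicator)
    also have "\<dots> = ennreal (\<integral>x. k x * indicator K x \<partial>lborel)"
    proof (rule nn_integral_eq_integral)
      show "integrable lborel (\<lambda>x. k x * indicator K x)"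
        by (rule Bochner_Integration.integrable_bound[OF k]) (auto split: split_indicator)
      show "AE x in lborel. 0 \<le> k x * indicator K x"
        using K by (auto split: split_indicator intro: less_imp_le)
    qed
    finally show ?thesis using z[OF K(2,1)] by simp
  qed
  then have "(SUP K\<in>{K. K \<subseteq> ?E \<and> compact K}. emeasure ?\<nu> K) \<le> 0"
    by (intro SUP_least) auto
  then have "emeasure ?\<nu> ?E = 0"
    by (subst inner_regular[OF _ fin E]) auto
  then have "(\<integral>\<^sup>+x. ennreal (k x) * indicator ?E x \<partial>lborel) = 0"
    by (simp add: emeasure_density)
  then have "AE x in lborel. ennreal (k x) * indicator ?E x = 0"
    by (subst (asm) nn_integral_0_iff_AE) auto
  then show ?thesis
    by eventually_elim (auto split: split_indicator_asm simp: ennreal_eq_0_iff)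
qed

text \<open>Multiplying \<open>h\<close> by 1, -1, \<open>\<i>\<close> and \<open>-\<i>\<close> and
  taking real parts gives four functions that are at most 0 almost everywhere, so both parts of
  \<open>h\<close> vanish. The set where such a real part is positive lies in the open interval,
  hence \<open>compact_integral_zero\<close> applies to its compact subsets.\<close>

theorem fourier_coefficients_unique:
  assumes h: "integrable lborel h"
    and z: "\<And>m::int. (CLINT x|lborel. h x * cis (- (2 * pi * real_of_int m * x))) = 0"
    and supp: "\<And>x. x \<notin> {0<..<1} \<Longrightarrow> h x = 0"
  shows "AE x in lborel. h x = 0"
proof -
  have main: "AE x in lborel. Re (c * h x) \<le> 0" for c
  proof (rule AE_nonpos_of_compact_integrals)
    show "integrable lborel (\<lambda>x. Re (c * h x))" using h by (intro integrable_Re) simp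
    fix K assume K: "compact K" "K \<subseteq> {x. Re (c * h x) > 0}"
    have K01: "K \<subseteq> {0<..<1}" using K(2) supp by force
    have [measurable]: "K \<in> sets borel" using K by (simp add: borel_compact)
    have iK: "integrable lborel (\<lambda>x. h x * indicator K x)"
      using h by (intro Bochner_Integration.integrable_bound[OF h]) (auto split: split_indicator)
    have "(\<integral>x. Re (c * h x) * indicator K x \<partial>lborel) = (\<integral>x. Re (c * (h x * indicator K x)) \<partial>lborel)"
      by (intro Bochner_Integration.integral_cong) (auto split: split_indicator)
    also have "\<dots> = Re (CLINT x|lborel. c * (h x * indicator K x))"
      using iK by (intro integral_Re) simp
    also have "\<dots> = 0" using compact_integral_zero[OF h z supp K(1) K01] by simp
    finally show "(\<integral>x. Re (c * h x) * indicator K x \<partial>lborel) = 0" .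
  qed
  show ?thesis
    using main[of 1] main[of "-1"] main[of \<i>] main[of "-\<i>"]
    by eventually_elim (simp add: complex_eq_iff)
qed

text \<open>The line is cut into unit intervals, which are moved back to the first one.
  \<open>infsum\<close> takes the value 0 where the series fails to converge, but integrability of
  \<open>G\<close> forces absolute convergence almost everywhere.\<close>

lemma periodization_integral:
  fixes G :: "real \<Rightarrow> complex"
  assumes G: "integrable lborel G"
    and meas: "(\<lambda>x. indicator {0..1} x * infsum (\<lambda>n::int. G (x + real_of_int n)) UNIV) \<in> borel_measurable borel"
  shows "(CLINT x|lborel. indicator {0..1} x * infsum (\<lambda>n::int. G (x + real_of_int n)) UNIV) = (CLINT x|lborel. G x)"
proof -
  have [measurable]: "G \<in> borel_measurable borel" using G by auto
  \<comment> \<open>\<open>int_decode\<close> lists the integers along the natural numbers, as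
    countable additivity and \<open>suminf\<close> require.\<close>
  define A where "A i = {real_of_int (int_decode i)..<real_of_int (int_decode i) + 1}" for i
  have disj: "A i \<inter> A j = {}" if "i \<noteq> j" for i j
  proof (rule ccontr)
    assume "A i \<inter> A j \<noteq> {}"
    then obtain x where "x \<in> A i" "x \<in> A j" by auto
    then have "\<lfloor>x\<rfloor> = int_decode i" "\<lfloor>x\<rfloor> = int_decode j" by (auto simp: A_def floor_eq_iff)
    then have "int_decode i = int_decode j" by simp
    then show False using that inj_int_decode[of UNIV] by (simp add: inj_eq)
  qed
  have un: "(\<Union>i. A i) = UNIV"
  proof -
    have "x \<in> A (int_encode \<lfloor>x\<rfloor>)" for x by (simp add: A_def)
    then show ?thesis by blast
  qed
  have [measurable]: "A i \<in> sets borel" for i by (simp add: A_def)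
  define f where "f i x = indicator {0..<1} x *\<^sub>R G (x + real_of_int (int_decode i))" for i and x :: real
  have fA: "f i x = indicator (A i) (real_of_int (int_decode i) + 1 * x) *\<^sub>R G (real_of_int (int_decode i) + 1 * x)" for i x
    by (auto simp: f_def A_def indicator_def add.commute)
  have iA: "integrable lborel (\<lambda>x. indicator (A i) x *\<^sub>R G x)" for i
    using G by (intro integrable_mult_indicator) auto
  have iF: "integrable lborel (f i)" for i
    unfolding fA by (rule lborel_integrable_real_affine[OF iA]) simp
  have If: "(CLINT x|lborel. f i x) = (CLINT x|lborel. indicator (A i) x *\<^sub>R G x)" for i
    unfolding fA by (subst lborel_integral_real_affine[of 1 _ "real_of_int (int_decode i)"]) auto
  have In: "(\<integral>x. norm (f i x) \<partial>lborel) = (\<integral>x. indicator (A i) x *\<^sub>R norm (G x) \<partial>lborel)" for i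
    unfolding fA by (subst (2) lborel_integral_real_affine[of 1 _ "real_of_int (int_decode i)"]) auto
  have nnf: "(\<integral>\<^sup>+x. ennreal (norm (f i x)) \<partial>lborel) = (\<integral>\<^sup>+x. ennreal (indicator (A i) x *\<^sub>R norm (G x)) \<partial>lborel)" for i
    using iF[of i] iA[of i, THEN integrable_norm] In[of i]
    by (subst (1 2) nn_integral_eq_integral) auto
  have tot: "(\<Sum>i. \<integral>\<^sup>+x. ennreal (norm (f i x)) \<partial>lborel) < \<infinity>"
  proof -
    have "(\<Sum>i. \<integral>\<^sup>+x. ennreal (norm (f i x)) \<partial>lborel) = (\<integral>\<^sup>+x. (\<Sum>i. ennreal (indicator (A i) x *\<^sub>R norm (G x))) \<partial>lborel)"
      unfolding nnf by (subst nn_integral_suminf) auto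
    also have "\<dots> = (\<integral>\<^sup>+x. ennreal (norm (G x)) \<partial>lborel)"
    proof (intro nn_integral_cong)
      fix x
      have "(\<Sum>i. ennreal (indicator (A i) x *\<^sub>R norm (G x))) = (\<Sum>i. ennreal (norm (G x)) * indicator (A i) x)"
        by (intro suminf_cong) (auto split: split_indicator)
      also have "\<dots> = ennreal (norm (G x)) * indicator (\<Union>i. A i) x"
        using disj by (subst ennreal_suminf_cmult) (auto simp: suminf_indicator disjoint_family_on_def)
      finally show "(\<Sum>i. ennreal (indicator (A i) x *\<^sub>R norm (G x))) = ennreal (norm (G x))"
        by (simp add: un)
    qed
    also have "\<dots> < \<infinity>" using G by (simp add: integrable_iff_bounded)
    finally show ?thesis .
  qed
  have AEs: "AE x in lborel. summable (\<lambda>i. norm (f i x))"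
  proof -
    have "(\<integral>\<^sup>+x. (\<Sum>i. ennreal (norm (f i x))) \<partial>lborel) \<noteq> \<infinity>"
      using tot iF by (subst nn_integral_suminf) auto
    then have "AE x in lborel. (\<Sum>i. ennreal (norm (f i x))) \<noteq> \<infinity>"
      using iF by (intro nn_integral_PInf_AE) auto
    then show ?thesis
      by eventually_elim (auto intro: summable_suminf_not_top)
  qed
  have sumn: "summable (\<lambda>i. \<integral>x. norm (f i x) \<partial>lborel)"
  proof (rule summable_suminf_not_top)
    have "(\<Sum>i. ennreal (\<integral>x. norm (f i x) \<partial>lborel)) = (\<Sum>i. \<integral>\<^sup>+x. ennreal (norm (f i x)) \<partial>lborel)"
      using iF by (intro suminf_cong nn_integral_eq_integral[symmetric]) auto
    then show "(\<Sum>i. ennreal (\<integral>x. norm (f i x) \<partial>lborel)) \<noteq> top" using tot by simp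
  qed simp
  have "(CLINT x|lborel. G x) = (CLINT x:(\<Union>i. A i)|lborel. G x)"
    by (simp add: un set_lebesgue_integral_def)
  also have "\<dots> = (\<Sum>i. CLINT x:A i|lborel. G x)"
    using G by (intro lebesgue_integral_countable_add disj) (auto simp: un set_integrable_def)
  also have "\<dots> = (\<Sum>i. CLINT x|lborel. f i x)"
    by (simp add: If set_lebesgue_integral_def)
  also have "\<dots> = (CLINT x|lborel. (\<Sum>i. f i x))"
    by (rule integral_suminf[symmetric, OF iF AEs sumn])
  also have "\<dots> = (CLINT x|lborel. indicator {0..1} x * infsum (\<lambda>n::int. G (x + real_of_int n)) UNIV)"
  proof (rule integral_cong_AE)
    show "(\<lambda>x. \<Sum>i. f i x) \<in> borel_measurable lborel"
      using iF by (intro borel_measurable_suminf) auto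
    \<comment> \<open>The pieces are half-open while the interval in the claim is closed; the two
      sides may differ at \<open>x = 1\<close>.\<close>
    have *: "AE x in lborel. x \<noteq> 1 \<longrightarrow> summable (\<lambda>i. norm (f i x)) \<longrightarrow>
       (\<Sum>i. f i x) = indicator {0..1} x * infsum (\<lambda>n::int. G (x + real_of_int n)) UNIV"
    proof (intro AE_I2 impI)
      fix x :: real assume x: "x \<noteq> 1" and s: "summable (\<lambda>i. norm (f i x))"
      show "(\<Sum>i. f i x) = indicator {0..1} x * infsum (\<lambda>n::int. G (x + real_of_int n)) UNIV"
      proof (cases "x \<in> {0..<1}")
        case True
        have "((\<lambda>i. f i x) has_sum (\<Sum>i. f i x)) UNIV"
          by (rule norm_summable_imp_has_sum[OF s summable_sums[OF summable_norm_cancel[OF s]]])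
        then have "(\<Sum>i. f i x) = infsum (\<lambda>i. f i x) UNIV" by (simp add: infsumI)
        also have "\<dots> = infsum (\<lambda>i. G (x + real_of_int (int_decode i))) UNIV"
          using True by (simp add: f_def)
        also have "\<dots> = infsum (\<lambda>n::int. G (x + real_of_int n)) UNIV"
          by (rule infsum_reindex_bij_betw[OF bij_int_decode])
        finally show ?thesis using True by simp
      next
        case False
        then show ?thesis using x by (auto simp: f_def indicator_def)
      qed
    qed
    have ne: "AE x in lborel. x \<noteq> (1 :: real)" by (rule AE_lborel_singleton)
    show eq: "AE x in lborel. (\<Sum>i. f i x) = indicator {0..1} x * infsum (\<lambda>n::int. G (x + real_of_int n)) UNIV"
      using * AEs ne by eventually_elim auto
    show "(\<lambda>x. indicator {0..1} x * infsum (\<lambda>n::int. G (x + real_of_int n)) UNIV) \<in> borel_measurable lborel"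
      using meas by simp
  qed
  finally show ?thesis by simp
qed

section \<open>Periodized functions and finite trigonometric sums\<close>

lemma cis_2pi_int: "cis (2 * pi * real_of_int n) = 1"
  by (metis cis_multiple_2pi Ints_of_int)

lemma integral_cis_int:
  "(CLINT x|lborel. indicator {0..1} x * cis (2 * pi * real_of_int k * x)) = (if k = 0 then 1 else 0)"
proof (cases "k = 0")
  case True
  have eq: "(\<lambda>x. indicator {0..1::real} x * 1) = (\<lambda>x. indicator {0..1} x *\<^sub>R (1 :: complex))"
    by (auto simp: fun_eq_iff split: split_indicator)
  have "(CLINT x|lborel. indicator {0..1::real} x * 1) = 1" unfolding eq by simp
  then show ?thesis using True by simp
next
  case False
  define a where "a = 2 * pi * real_of_int k"
  have a: "a \<noteq> 0" using False by (simp add: a_def)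
  have cis_int: "cis a = 1" unfolding a_def by (rule cis_2pi_int)
  have "(CLINT x|lborel. indicator {0..1} x *\<^sub>R cis (a * x)) = cis (a * 1) / (\<i> * a) - cis (a * 0) / (\<i> * a)"
  proof (rule integral_FTC_Icc)
    show "continuous_on {0..1} (\<lambda>x. cis (a * x))" by (intro continuous_intros)
    fix x :: real
    show "((\<lambda>x. cis (a * x) / (\<i> * a)) has_vector_derivative cis (a * x)) (at x within {0..1})"
    proof -
      have "((\<lambda>z. exp (\<i> * a * z) / (\<i> * a)) has_field_derivative exp (\<i> * a * of_real x)) (at (of_real x))"
        using a by (auto intro!: derivative_eq_intros)
      from has_vector_derivative_real_field[OF this, of "{0..1}"] show ?thesis
        by (simp add: cis_conv_exp mult.assoc)
    qed
  qed simp
  also have "\<dots> = 0" by (simp add: cis_int)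
  also have "(\<lambda>x. indicator {0..1} x *\<^sub>R cis (a * x)) = (\<lambda>x. indicator {0..1} x * cis (2 * pi * real_of_int k * x))"
    by (auto simp: fun_eq_iff a_def split: split_indicator)
  finally show ?thesis using False by simp
qed

lemma integrable_01_mult_cis:
  assumes "integrable lborel (\<lambda>x. indicator {0..1} x * p x :: complex)"
  shows "integrable lborel (\<lambda>x. indicator {0..1} x * p x * cis (a * x))"
proof -
  have [measurable]: "(\<lambda>x. indicator {0..1} x * p x :: complex) \<in> borel_measurable borel"
    using assms by auto
  show ?thesis
    by (rule Bochner_Integration.integrable_bound[OF assms]) (auto simp: norm_mult)
qed

lemma integrable_01_cis: "integrable lborel (\<lambda>x. indicator {0..1} x * cis (a * x))"
proof -
  have "integrable lborel (\<lambda>x. complex_of_real (indicator {0..1::real} x))"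
    by (intro integrable_of_real integrable_real_indicator) auto
  moreover have "(\<lambda>x. complex_of_real (indicator {0..1::real} x)) = (\<lambda>x. indicator {0..1} x * 1)"
    by (auto simp: fun_eq_iff split: split_indicator)
  ultimately have "integrable lborel (\<lambda>x. indicator {0..1::real} x * (1 :: complex))" by simp
  from integrable_01_mult_cis[OF this, of a] show ?thesis by simp
qed

definition fcoef :: "(real \<Rightarrow> real) \<Rightarrow> int \<Rightarrow> complex" where
  "fcoef b m = (CLINT x|lborel. indicator {0..1} x * complex_of_real (b x) * cis (- (2 * pi * real_of_int m * x)))"

text \<open>Without summability both sides take the default value 0. This case matters because
  \<open>per\<close> is a pointwise \<open>infsum\<close> that need not converge everywhere.\<close>

lemma infsum_complex_of_real: "infsum (\<lambda>x. complex_of_real (f x)) A = complex_of_real (infsum f A)"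
proof (cases "f summable_on A")
  case True
  then show ?thesis by (metis has_sum_infsum has_sum_of_real infsumI)
next
  case False
  have "\<not> (\<lambda>x. complex_of_real (f x)) summable_on A"
  proof
    assume "(\<lambda>x. complex_of_real (f x)) summable_on A"
    then have "((\<lambda>x. Re (complex_of_real (f x))) has_sum Re (infsum (\<lambda>x. complex_of_real (f x)) A)) A"
      by (intro has_sum_Re has_sum_infsum)
    with False show False by (auto simp: summable_on_def)
  qed
  with False show ?thesis by (simp add: infsum_not_exists)
qed

text \<open>Unfolding the periodization turns the Fourier coefficient on the unit interval into a
  multiple of the Fourier transform on the line at \<open>2 * pi * m / 2 ^ r\<close>. The multiple
  is irrelevant for vanishing; the constant \<open>c\<close> collects the normalization and the
  phase due to the shift \<open>k\<close>.\<close>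

lemma fcoef_per_eq_0:
  assumes h: "integrable lborel h" and meas: "per h r k \<in> borel_measurable borel"
    and FT0: "FT h (2 * pi * real_of_int m / 2 ^ r) = 0"
  shows "fcoef (per h r k) m = 0"
proof -
  define \<omega> where "\<omega> = 2 * pi * real_of_int m / 2 ^ r"
  define f where "f y = complex_of_real (h y) * cis (- \<omega> * y)" for y
  define c where "c = complex_of_real (2 powr (real r / 2)) * cis (- \<omega> * real_of_int k)"
  define G where "G x = c * f (- real_of_int k + 2 ^ r * x)" for x
  have [measurable]: "h \<in> borel_measurable borel" using h by auto
  have "integrable lborel (\<lambda>y. complex_of_real (h y))" using h by simp
  then have f: "integrable lborel f"
    unfolding f_def by (rule Bochner_Integration.integrable_bound) (auto simp: norm_mult)
  have G: "integrable lborel G"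
    unfolding G_def by (intro integrable_mult_right lborel_integrable_real_affine f) simp
  have Geq: "G x = complex_of_real (2 powr (real r / 2) * h (2 ^ r * x - real_of_int k)) * cis (- (2 * pi * real_of_int m * x))" for x
  proof -
    have "cis (- \<omega> * real_of_int k) * cis (- \<omega> * (- real_of_int k + 2 ^ r * x)) = cis (- (2 * pi * real_of_int m * x))"
      by (simp add: cis_mult \<omega>_def field_simps)
    then show ?thesis by (simp add: G_def c_def f_def mult_ac)
  qed
  \<comment> \<open>The exponential has period 1, so it is common to all translates and can be taken
    out of the sum.\<close>
  have Gn: "G (x + real_of_int n) = complex_of_real (2 powr (real r / 2) * h (2 ^ r * (x + real_of_int n) - real_of_int k)) * cis (- (2 * pi * real_of_int m * x))" for x n
  proof -
    have "cis (- (2 * pi * real_of_int m * (x + real_of_int n))) = cis (- (2 * pi * real_of_int m * x)) * cis (2 * pi * real_of_int (- m * n))"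
      by (simp add: cis_mult algebra_simps)
    then show ?thesis unfolding Geq cis_2pi_int by simp
  qed
  have sumG: "infsum (\<lambda>n::int. G (x + real_of_int n)) UNIV = complex_of_real (per h r k x) * cis (- (2 * pi * real_of_int m * x))" for x
    unfolding Gn per_def infsum_cmult_left' by (simp only: infsum_complex_of_real)
  have "fcoef (per h r k) m = (CLINT x|lborel. indicator {0..1} x * infsum (\<lambda>n::int. G (x + real_of_int n)) UNIV)"
    by (simp add: fcoef_def sumG mult.assoc)
  also have "\<dots> = (CLINT x|lborel. G x)"
  proof (rule periodization_integral[OF G])
    note [measurable] = meas
    show "(\<lambda>x. indicator {0..1} x * infsum (\<lambda>n::int. G (x + real_of_int n)) UNIV) \<in> borel_measurable borel"
      unfolding sumG by measurable
  qed
  also have "\<dots> = c * (CLINT x|lborel. f (- real_of_int k + 2 ^ r * x))"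
    unfolding G_def by simp
  also have "(CLINT x|lborel. f (- real_of_int k + 2 ^ r * x)) = 0"
  proof -
    have "(CLINT y|lborel. f y) = 0" using FT0 by (simp add: f_def FT_def \<omega>_def)
    then show ?thesis
      by (subst (asm) lborel_integral_real_affine[of "2 ^ r" _ "- real_of_int k"]) auto
  qed
  finally show ?thesis by simp
qed

lemma trigonometric_sum_times_cnj:
  assumes "finite F"
  shows "complex_of_real ((cmod (\<Sum>m\<in>F. a m * cis (2 * pi * real_of_int m * x)))\<^sup>2)
    = (\<Sum>m\<in>F. \<Sum>n\<in>F. a m * cnj (a n) * cis (2 * pi * real_of_int (m - n) * x))"
proof -
  have "cis (2 * pi * real_of_int m * x) * cnj (cis (2 * pi * real_of_int n * x)) = cis (2 * pi * real_of_int (m - n) * x)" for m n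
    by (simp add: cis_cnj cis_mult algebra_simps)
  note cc = this
  have eq: "a m * cis (2 * pi * real_of_int m * x) * cnj (a n * cis (2 * pi * real_of_int n * x))
      = a m * cnj (a n) * cis (2 * pi * real_of_int (m - n) * x)" for m n
  proof -
    have "a m * cis (2 * pi * real_of_int m * x) * cnj (a n * cis (2 * pi * real_of_int n * x))
      = a m * cnj (a n) * (cis (2 * pi * real_of_int m * x) * cnj (cis (2 * pi * real_of_int n * x)))"
      by (simp only: complex_cnj_mult mult_ac)
    also note cc
    finally show ?thesis .
  qed
  show ?thesis unfolding complex_norm_square cnj_sum sum_product eq ..
qed

lemma parseval_finite:
  assumes F: "finite F"
  shows "integrable lborel (\<lambda>x. indicator {0..1} x * (cmod (\<Sum>m\<in>F. a m * cis (2 * pi * real_of_int m * x)))\<^sup>2)" (is ?I)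
    and "(\<integral>x. indicator {0..1} x * (cmod (\<Sum>m\<in>F. a m * cis (2 * pi * real_of_int m * x)))\<^sup>2 \<partial>lborel) = (\<Sum>m\<in>F. (cmod (a m))\<^sup>2)" (is ?E)
proof -
  let ?S = "\<lambda>x. indicator {0..1} x * (cmod (\<Sum>m\<in>F. a m * cis (2 * pi * real_of_int m * x)))\<^sup>2"
  have eq: "complex_of_real (?S x) = (\<Sum>m\<in>F. \<Sum>n\<in>F. a m * cnj (a n) * (indicator {0..1} x * cis (2 * pi * real_of_int (m - n) * x)))" for x
  proof -
    have "complex_of_real (?S x) = indicator {0..1} x * complex_of_real ((cmod (\<Sum>m\<in>F. a m * cis (2 * pi * real_of_int m * x)))\<^sup>2)"
      by (auto split: split_indicator)
    then show ?thesis unfolding trigonometric_sum_times_cnj[OF F] sum_distrib_left by (simp add: mult_ac)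
  qed
  have i: "integrable lborel (\<lambda>x. complex_of_real (?S x))" unfolding eq
    by (intro Bochner_Integration.integrable_sum integrable_mult_right integrable_01_cis)
  then show ?I by (simp only: complex_of_real_integrable_eq)
  have "complex_of_real (\<integral>x. ?S x \<partial>lborel) = (CLINT x|lborel. complex_of_real (?S x))"
    by (rule integral_complex_of_real[symmetric])
  also have "\<dots> = (\<Sum>m\<in>F. \<Sum>n\<in>F. a m * cnj (a n) * (CLINT x|lborel. indicator {0..1} x * cis (2 * pi * real_of_int (m - n) * x)))"
    unfolding eq
    by (subst Bochner_Integration.integral_sum, intro Bochner_Integration.integrable_sum integrable_mult_right integrable_01_cis,
      intro sum.cong refl, subst Bochner_Integration.integral_sum, intro integrable_mult_right integrable_01_cis, simp)
  also have "\<dots> = (\<Sum>m\<in>F. \<Sum>n\<in>F. if n = m then a m * cnj (a m) else 0)"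
    unfolding integral_cis_int by (intro sum.cong refl) auto
  also have "\<dots> = (\<Sum>m\<in>F. complex_of_real ((cmod (a m))\<^sup>2))"
    using F by (simp add: complex_norm_square del: of_real_power)
  finally show ?E by (simp flip: of_real_sum add: of_real_eq_iff del: of_real_power)
qed

text \<open>The difference of \<open>b\<close> and the sum has only vanishing Fourier coefficients:
  inside \<open>F\<close> by orthogonality, outside \<open>F\<close> by hypothesis. Uniqueness then
  makes it null.\<close>

lemma AE_eq_trigonometric_sum:
  assumes b: "integrable lborel (\<lambda>x. indicator {0..1} x * complex_of_real (b x))"
    and F: "finite F" and z: "\<And>m. m \<notin> F \<Longrightarrow> fcoef b m = 0"
  shows "AE x in lborel. x \<in> {0..1} \<longrightarrow> complex_of_real (b x) = (\<Sum>m\<in>F. fcoef b m * cis (2 * pi * real_of_int m * x))"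
proof -
  let ?T = "\<lambda>x. \<Sum>m\<in>F. fcoef b m * cis (2 * pi * real_of_int m * x)"
  have T: "integrable lborel (\<lambda>x. indicator {0..1} x * ?T x)"
    unfolding sum_distrib_left mult.left_commute[of "indicator _ _"]
    by (intro Bochner_Integration.integrable_sum integrable_mult_right integrable_01_cis)
  define h where "h x = indicator {0..1} x * complex_of_real (b x) - indicator {0..1} x * ?T x" for x
  \<comment> \<open>The uniqueness theorem asks for a function that vanishes off the open interval;
    only the two endpoints are affected.\<close>
  define h' where "h' x = indicator {0<..<1::real} x * h x" for x
  have ih: "integrable lborel h" unfolding h_def by (intro Bochner_Integration.integrable_diff b T)
  then have [measurable]: "h \<in> borel_measurable borel" by auto
  have ih': "integrable lborel h'"
    unfolding h'_def by (rule Bochner_Integration.integrable_bound[OF ih]) (auto split: split_indicator)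
  have hh: "AE x in lborel. h' x = h x"
  proof -
    have "AE x in lborel. x \<noteq> (0::real)" "AE x in lborel. x \<noteq> (1::real)" by (rule AE_lborel_singleton)+
    then show ?thesis by eventually_elim (auto simp: h'_def h_def split: split_indicator)
  qed
  have "AE x in lborel. h' x = 0"
  proof (rule fourier_coefficients_unique[OF ih'])
    show "h' x = 0" if "x \<notin> {0<..<1}" for x using that by (simp add: h'_def)
    fix n :: int
    have "(CLINT x|lborel. h' x * cis (- (2 * pi * real_of_int n * x))) = (CLINT x|lborel. h x * cis (- (2 * pi * real_of_int n * x)))"
      by (rule integral_cong_AE) (use hh in \<open>auto simp: h'_def\<close>)
    also have "\<dots> = (CLINT x|lborel. indicator {0..1} x * complex_of_real (b x) * cis (- (2 * pi * real_of_int n * x)) -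
        (\<Sum>m\<in>F. fcoef b m * (indicator {0..1} x * cis (2 * pi * real_of_int (m - n) * x))))"
    proof (intro Bochner_Integration.integral_cong refl)
      fix x :: real
      have "indicator {0..1} x * ?T x * cis (- (2 * pi * real_of_int n * x)) =
         (\<Sum>m\<in>F. fcoef b m * (indicator {0..1} x * (cis (2 * pi * real_of_int m * x) * cis (- (2 * pi * real_of_int n * x)))))"
        by (simp add: sum_distrib_left sum_distrib_right mult_ac)
      also have "\<dots> = (\<Sum>m\<in>F. fcoef b m * (indicator {0..1} x * cis (2 * pi * real_of_int (m - n) * x)))"
        by (simp add: cis_mult algebra_simps)
      finally show "h x * cis (- (2 * pi * real_of_int n * x)) = indicator {0..1} x * complex_of_real (b x) * cis (- (2 * pi * real_of_int n * x)) -
        (\<Sum>m\<in>F. fcoef b m * (indicator {0..1} x * cis (2 * pi * real_of_int (m - n) * x)))"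
        by (simp add: h_def left_diff_distrib)
    qed
    also have "\<dots> = fcoef b n - (\<Sum>m\<in>F. fcoef b m * (CLINT x|lborel. indicator {0..1} x * cis (2 * pi * real_of_int (m - n) * x)))"
    proof (subst Bochner_Integration.integral_diff)
      show "integrable lborel (\<lambda>x. indicator {0..1} x * complex_of_real (b x) * cis (- (2 * pi * real_of_int n * x)))"
        using integrable_01_mult_cis[OF b, of "- (2 * pi * real_of_int n)"] by simp
      show "integrable lborel (\<lambda>x. \<Sum>m\<in>F. fcoef b m * (indicator {0..1} x * cis (2 * pi * real_of_int (m - n) * x)))"
        by (intro Bochner_Integration.integrable_sum integrable_mult_right integrable_01_cis)
      show "(CLINT x|lborel. indicator {0..1} x * complex_of_real (b x) * cis (- (2 * pi * real_of_int n * x))) -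
          (CLINT x|lborel. \<Sum>m\<in>F. fcoef b m * (indicator {0..1} x * cis (2 * pi * real_of_int (m - n) * x)))
        = fcoef b n - (\<Sum>m\<in>F. fcoef b m * (CLINT x|lborel. indicator {0..1} x * cis (2 * pi * real_of_int (m - n) * x)))"
        by (subst Bochner_Integration.integral_sum, intro integrable_mult_right integrable_01_cis) (simp add: fcoef_def)
    qed
    also have "(\<Sum>m\<in>F. fcoef b m * (CLINT x|lborel. indicator {0..1} x * cis (2 * pi * real_of_int (m - n) * x)))
       = (\<Sum>m\<in>F. if m = n then fcoef b n else 0)"
      unfolding integral_cis_int by (intro sum.cong) auto
    also have "\<dots> = fcoef b n" using F z by simp
    finally show "(CLINT x|lborel. h' x * cis (- (2 * pi * real_of_int n * x))) = 0" by simp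
  qed
  with hh show ?thesis by eventually_elim (auto simp: h_def)
qed

section \<open>Convolution with periodic kernels\<close>

lemma periodic_add_int:
  assumes "\<And>x::real. p (x + 1) = p x"
  shows "p (x + real_of_int n) = p x"
proof -
  have nat: "p (x + real n) = p x" for n :: nat and x
    by (induction n) (use assms in \<open>simp_all add: add.assoc[symmetric] add.commute[of 1]\<close>)
  show ?thesis
  proof (cases "0 \<le> n")
    case True
    then show ?thesis using nat[of x "nat n"] by simp
  next
    case False
    then show ?thesis using nat[of "x + real_of_int n" "nat (-n)"] by simp
  qed
qed

lemma integral_reflected_period:
  fixes p :: "real \<Rightarrow> complex"
  assumes per: "\<And>x. p (x + 1) = p x"
    and i: "integrable lborel (\<lambda>x. indicator {0..1} x * p x)"
  shows "integrable lborel (\<lambda>x. indicator {0..1} x * p (t - x))" (is ?I)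
    and "(CLINT x|lborel. indicator {0..1} x * p (t - x)) = (CLINT x|lborel. indicator {0..1} x * p x)" (is ?E)
proof -
  define n where "n = \<lfloor>t\<rfloor>"
  define a where "a = t - n"
  have a: "0 \<le> a" "a < 1" unfolding a_def n_def by linarith+
  have pn: "p (y + real_of_int n) = p y" for y n by (rule periodic_add_int[of p, OF per])
  \<comment> \<open>With \<open>a\<close> the fractional part of \<open>t\<close>, the reflection
    sends \<open>(0,a]\<close> onto \<open>[0,a)\<close> and, after adding one period,
    \<open>(a,1]\<close> onto \<open>[a,1)\<close>. Together the two images fill one period.\<close>
  define p1 where "p1 x = indicator {0..<a} x * p x" for x
  define p2 where "p2 x = indicator {a..<1} x * p x" for x
  have [measurable]: "(\<lambda>x. indicator {0..1} x * p x) \<in> borel_measurable borel" using i by auto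
  have eq1: "p1 = (\<lambda>x. indicator {0..<a} x * (indicator {0..1} x * p x))"
    and eq2: "p2 = (\<lambda>x. indicator {a..<1} x * (indicator {0..1} x * p x))"
    using a by (auto simp: p1_def p2_def fun_eq_iff split: split_indicator)
  have i1: "integrable lborel p1" unfolding eq1
    by (rule Bochner_Integration.integrable_bound[OF i]) (auto split: split_indicator)
  have i2: "integrable lborel p2" unfolding eq2
    by (rule Bochner_Integration.integrable_bound[OF i]) (auto split: split_indicator)
  have i1': "integrable lborel (\<lambda>x. p1 (a + (-1) * x))" by (rule lborel_integrable_real_affine[OF i1]) simp
  have i2': "integrable lborel (\<lambda>x. p2 (a + 1 + (-1) * x))" by (rule lborel_integrable_real_affine[OF i2]) simp
  have e0: "AE x in lborel. x \<noteq> (0::real)" "AE x in lborel. x \<noteq> (1::real)" "AE x in lborel. x \<noteq> a"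
    by (rule AE_lborel_singleton)+
  have key: "AE x in lborel. indicator {0..1} x * p (t - x) = p1 (a + (-1) * x) + p2 (a + 1 + (-1) * x)"
    using e0
  proof eventually_elim
    case (elim x)
    have "p (t - x) = p (a - x)" using pn[of "a - x" n] by (simp add: a_def algebra_simps)
    moreover have "p (a + 1 - x) = p (a - x)" using per[of "a - x"] by (simp add: algebra_simps)
    ultimately show ?case using elim a
      by (auto simp: p1_def p2_def indicator_def)
  qed
  have key2: "AE x in lborel. indicator {0..1} x * p x = p1 x + p2 x"
    using e0 by eventually_elim (use a in \<open>auto simp: p1_def p2_def indicator_def\<close>)
  \<comment> \<open>Measurability is known on the unit interval only; the fractional part extends it
    to the line, which the reflected argument \<open>t - x\<close> requires.\<close>
  have mp: "p \<in> borel_measurable borel"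
  proof -
    have "p = (\<lambda>x. indicator {0..1} (frac x) * p (frac x))"
    proof
      fix x
      have "p x = p (frac x)" using pn[of "frac x" "\<lfloor>x\<rfloor>"] by (simp add: frac_def)
      then show "p x = indicator {0..1} (frac x) * p (frac x)"
        using frac_ge_0[of x] frac_lt_1[of x] by (simp add: less_imp_le)
    qed
    moreover have "(\<lambda>x. indicator {0..1} (frac x) * p (frac x)) \<in> borel_measurable borel"
      by (rule measurable_compose[of frac borel borel "\<lambda>x. indicator {0..1} x * p x"])
        (auto simp: frac_def[abs_def])
    ultimately show ?thesis by simp
  qed
  note [measurable] = mp
  have m1: "(\<lambda>x. indicator {0..1} x * p (t - x)) \<in> borel_measurable lborel" by measurable
  show ?I
    by (subst integrable_cong_AE[OF m1 _ key]) (use i1' i2' in auto)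
  have "(CLINT x|lborel. indicator {0..1} x * p (t - x)) = (CLINT x|lborel. p1 (a + (-1) * x) + p2 (a + 1 + (-1) * x))"
    by (rule integral_cong_AE[OF m1 _ key]) (use i1' i2' in auto)
  also have "\<dots> = (CLINT x|lborel. p1 (a + (-1) * x)) + (CLINT x|lborel. p2 (a + 1 + (-1) * x))"
    by (rule Bochner_Integration.integral_add[OF i1' i2'])
  also have "(CLINT x|lborel. p1 (a + (-1) * x)) = (CLINT x|lborel. p1 x)"
    by (subst (2) lborel_integral_real_affine[of "-1" _ a]) auto
  also have "(CLINT x|lborel. p2 (a + 1 + (-1) * x)) = (CLINT x|lborel. p2 x)"
    by (subst (2) lborel_integral_real_affine[of "-1" _ "a + 1"]) auto
  also have "(CLINT x|lborel. p1 x) + (CLINT x|lborel. p2 x) = (CLINT x|lborel. p1 x + p2 x)"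
    by (rule Bochner_Integration.integral_add[symmetric, OF i1 i2])
  also have "\<dots> = (CLINT x|lborel. indicator {0..1} x * p x)"
    by (rule integral_cong_AE[symmetric, OF _ _ key2]) (use i1 i2 in auto)
  finally show ?E .
qed

text \<open>Exponentials are eigenfunctions of convolution with a periodic kernel, the eigenvalues
  being the Fourier coefficients of \<open>\<kappa>\<close>; reflecting the period shows that they
  do not depend on \<open>t\<close>.\<close>

lemma convolution_trigonometric_sum:
  fixes \<kappa> b :: "real \<Rightarrow> real"
  assumes per: "\<And>t. \<kappa> (t + 1) = \<kappa> t" and \<kappa>: "set_integrable lborel {0..1} \<kappa>"
    and bm [measurable]: "b \<in> borel_measurable borel"
    and F: "finite F"
    and ae: "AE x in lborel. x \<in> {0..1} \<longrightarrow> complex_of_real (b x) = (\<Sum>m\<in>F. c m * cis (2 * pi * real_of_int m * x))"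
  shows "integrable lborel (\<lambda>x. indicator {0..1} x * \<kappa> (t - x) * b x)" (is ?I)
    and "complex_of_real (\<integral>x. indicator {0..1} x * \<kappa> (t - x) * b x \<partial>lborel)
      = (\<Sum>m\<in>F. c m * (CLINT x|lborel. indicator {0..1} x * complex_of_real (\<kappa> x) * cis (- (2 * pi * real_of_int m * x)))
          * cis (2 * pi * real_of_int m * t))" (is ?E)
proof -
  define p where "p m x = complex_of_real (\<kappa> x) * cis (- (2 * pi * real_of_int m * x))" for m x
  have pper: "p m (x + 1) = p m x" for m x
  proof -
    have "cis (- (2 * pi * real_of_int m * (x + 1))) = cis (- (2 * pi * real_of_int m * x)) * cis (2 * pi * real_of_int (- m))"
      by (simp add: cis_mult algebra_simps)
    then show ?thesis unfolding cis_2pi_int by (simp add: p_def per)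
  qed
  have \<kappa>c: "integrable lborel (\<lambda>x. indicator {0..1} x * complex_of_real (\<kappa> x))"
  proof -
    have "integrable lborel (\<lambda>x. complex_of_real (indicator {0..1} x *\<^sub>R \<kappa> x))"
      using \<kappa> unfolding set_integrable_def by (rule integrable_of_real)
    moreover have "(\<lambda>x. complex_of_real (indicator {0..1} x *\<^sub>R \<kappa> x)) = (\<lambda>x. indicator {0..1} x * complex_of_real (\<kappa> x))"
      by (auto simp: fun_eq_iff split: split_indicator)
    ultimately show ?thesis by simp
  qed
  have ip: "integrable lborel (\<lambda>x. indicator {0..1} x * p m x)" for m
    using integrable_01_mult_cis[OF \<kappa>c, of "- (2 * pi * real_of_int m)"] by (simp add: p_def mult.assoc)
  have R: "integrable lborel (\<lambda>x. indicator {0..1} x * p m (t - x))"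
    "(CLINT x|lborel. indicator {0..1} x * p m (t - x)) = (CLINT x|lborel. indicator {0..1} x * p m x)" for m
    using integral_reflected_period[of "p m" t] pper ip by auto
  have summand: "c m * cis (2 * pi * real_of_int m * t) * (indicator {0..1} x * p m (t - x))
     = indicator {0..1} x * complex_of_real (\<kappa> (t - x)) * (c m * cis (2 * pi * real_of_int m * x))" for m x
  proof -
    have "cis (2 * pi * real_of_int m * t) * cis (- (2 * pi * real_of_int m * (t - x))) = cis (2 * pi * real_of_int m * x)"
      by (simp add: cis_mult algebra_simps)
    then show ?thesis by (simp add: p_def mult_ac)
  qed
  let ?S = "\<lambda>x. \<Sum>m\<in>F. c m * cis (2 * pi * real_of_int m * t) * (indicator {0..1} x * p m (t - x))"
  have S: "integrable lborel ?S" using R(1) by (intro Bochner_Integration.integrable_sum integrable_mult_right)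
  have eq: "AE x in lborel. complex_of_real (indicator {0..1} x * \<kappa> (t - x) * b x) = ?S x"
    using ae
  proof eventually_elim
    case (elim x)
    show ?case unfolding summand using elim by (auto simp: sum_distrib_left split: split_indicator)
  qed
  have mp: "(\<lambda>x. indicator {0..1} x * complex_of_real (\<kappa> (t - x))) \<in> borel_measurable borel"
    using integral_reflected_period(1)[of "\<lambda>x. complex_of_real (\<kappa> x)" t] \<kappa>c per by auto
  have m: "(\<lambda>x. complex_of_real (indicator {0..1} x * \<kappa> (t - x) * b x)) \<in> borel_measurable lborel"
  proof -
    have "(\<lambda>x. complex_of_real (indicator {0..1} x * \<kappa> (t - x) * b x)) = (\<lambda>x. (indicator {0..1} x * complex_of_real (\<kappa> (t - x))) * complex_of_real (b x))"
      by (auto simp: fun_eq_iff split: split_indicator)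
    then show ?thesis using mp by simp
  qed
  have I: "integrable lborel (\<lambda>x. complex_of_real (indicator {0..1} x * \<kappa> (t - x) * b x))"
    by (subst integrable_cong_AE[OF m _ eq]) (use S in auto)
  then show ?I by (simp only: complex_of_real_integrable_eq)
  have "complex_of_real (\<integral>x. indicator {0..1} x * \<kappa> (t - x) * b x \<partial>lborel)
     = (CLINT x|lborel. complex_of_real (indicator {0..1} x * \<kappa> (t - x) * b x))"
    by (rule integral_complex_of_real[symmetric])
  also have "\<dots> = (CLINT x|lborel. ?S x)"
    by (rule integral_cong_AE[OF m _ eq]) (use S in auto)
  also have "\<dots> = (\<Sum>m\<in>F. c m * cis (2 * pi * real_of_int m * t) * (CLINT x|lborel. indicator {0..1} x * p m x))"
    by (subst Bochner_Integration.integral_sum) (use R in auto)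
  finally show ?E by (simp add: p_def mult_ac)
qed

section \<open>Products of one-dimensional functions and their images under the operator\<close>

lemma L2set_on_sq_integrable:
  assumes "b \<in> L2set_on {0..1}"
  shows "integrable lborel (\<lambda>x. indicator {0..1} x * (b x)\<^sup>2 :: real)"
proof (rule integrableI_nonneg)
  have [measurable]: "b \<in> borel_measurable borel" using assms by (simp add: L2set_on_def)
  show "(\<lambda>x. indicator {0..1} x * (b x)\<^sup>2 :: real) \<in> borel_measurable lborel" by measurable
  have "(\<integral>\<^sup>+x. ennreal (indicator {0..1} x * (b x)\<^sup>2) \<partial>lborel) = (\<integral>\<^sup>+x. indicator {0..1} x * ennreal ((b x)\<^sup>2) \<partial>lborel)"
    by (intro nn_integral_cong) (auto split: split_indicator)
  then show "(\<integral>\<^sup>+x. ennreal (indicator {0..1} x * (b x)\<^sup>2) \<partial>lborel) < \<infinity>"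
    using assms by (simp add: L2set_on_def)
qed auto

lemma L2set_on_nn_integral:
  assumes "b \<in> L2set_on {0..1}"
  shows "(\<integral>\<^sup>+x. indicator {0..1} x * ennreal ((b x)\<^sup>2) \<partial>lborel) = ennreal (ip_on {0..1} b b)"
proof -
  have "(\<integral>\<^sup>+x. indicator {0..1} x * ennreal ((b x)\<^sup>2) \<partial>lborel) = (\<integral>\<^sup>+x. ennreal (indicator {0..1} x * (b x)\<^sup>2) \<partial>lborel)"
    by (intro nn_integral_cong) (auto split: split_indicator)
  also have "\<dots> = ennreal (\<integral>x. indicator {0..1} x * (b x)\<^sup>2 \<partial>lborel)"
    by (intro nn_integral_eq_integral L2set_on_sq_integrable assms) auto
  finally show ?thesis by (simp add: ip_on_def power2_eq_square mult.assoc)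
qed

lemma L2set_on_integrable:
  assumes "b \<in> L2set_on {0..1}"
  shows "integrable lborel (\<lambda>x. indicator {0..1} x * complex_of_real (b x))"
proof (rule Bochner_Integration.integrable_bound)
  have [measurable]: "b \<in> borel_measurable borel" using assms by (simp add: L2set_on_def)
  show "integrable lborel (\<lambda>x. indicator {0..1} x + indicator {0..1} x * (b x)\<^sup>2 :: real)"
    by (intro Bochner_Integration.integrable_add L2set_on_sq_integrable assms integrable_real_indicator) auto
  have "\<bar>y\<bar> \<le> 1 + y\<^sup>2" for y :: real
    using sum_squares_bound[of "\<bar>y\<bar>" 1] abs_ge_zero[of y] by simp
  then show "AE x in lborel. norm (indicator {0..1} x * complex_of_real (b x))
      \<le> norm (indicator {0..1} x + indicator {0..1} x * (b x)\<^sup>2 :: real)"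
    by (auto split: split_indicator)
qed (use assms in \<open>auto simp: L2set_on_def\<close>)

lemma sum_fcoef_sq:
  assumes b: "b \<in> L2set_on {0..1}" and F: "finite F" "\<And>m. m \<notin> F \<Longrightarrow> fcoef b m = 0"
  shows "(\<Sum>m\<in>F. (cmod (fcoef b m))\<^sup>2) = ip_on {0..1} b b"
proof -
  have [measurable]: "b \<in> borel_measurable borel" using b by (simp add: L2set_on_def)
  let ?T = "\<lambda>x. \<Sum>m\<in>F. fcoef b m * cis (2 * pi * real_of_int m * x)"
  have ae: "AE x in lborel. x \<in> {0..1} \<longrightarrow> complex_of_real (b x) = ?T x"
    by (rule AE_eq_trigonometric_sum[OF L2set_on_integrable[OF b] F])
  have "ip_on {0..1} b b = (\<integral>x. indicator {0..1} x * (cmod (?T x))\<^sup>2 \<partial>lborel)"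
    unfolding ip_on_def
  proof (rule integral_cong_AE)
    show "AE x in lborel. indicator {0..1} x * b x * b x = indicator {0..1} x * (cmod (?T x))\<^sup>2"
      using ae
    proof eventually_elim
      case (elim x)
      show ?case
      proof (cases "x \<in> {0..1}")
        case True
        with elim have "?T x = complex_of_real (b x)" by simp
        then have "cmod (?T x) = \<bar>b x\<bar>" by (simp only: norm_of_real)
        then show ?thesis using True by (simp add: power2_eq_square)
      qed simp
    qed
    show "(\<lambda>x. indicator {0..1} x * (cmod (?T x))\<^sup>2) \<in> borel_measurable lborel"
      using parseval_finite(1)[OF F(1), of "fcoef b"] by simp
  qed measurable
  then show ?thesis using parseval_finite(2)[OF F(1)] by simp
qed

lemma tensor_L2set2:
  assumes b: "b \<in> L2set_on {0..1}" and \<eta>: "\<eta> \<in> L2set_on {0..1}"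
  shows "(\<lambda>u x. b x * \<eta> u) \<in> L2set2"
proof -
  have [measurable]: "b \<in> borel_measurable borel" "\<eta> \<in> borel_measurable borel"
    using b \<eta> by (auto simp: L2set_on_def)
  have "L2sq2 (\<lambda>u x. b x * \<eta> u) = (\<integral>\<^sup>+z. (indicator {0..1} (fst z) * ennreal ((\<eta> (fst z))\<^sup>2)) * (indicator {0..1} (snd z) * ennreal ((b (snd z))\<^sup>2)) \<partial>(lborel \<Otimes>\<^sub>M lborel))"
    unfolding L2sq2_def lborel_prod
    by (intro nn_integral_cong) (auto simp: sq01_def indicator_def power_mult_distrib ennreal_mult mult.commute split: prod.splits)
  also have "\<dots> = (\<integral>\<^sup>+u. \<integral>\<^sup>+x. (indicator {0..1} u * ennreal ((\<eta> u)\<^sup>2)) * (indicator {0..1} x * ennreal ((b x)\<^sup>2)) \<partial>lborel \<partial>lborel)"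
    by (subst lborel.nn_integral_fst[symmetric]) auto
  also have "\<dots> = ennreal (ip_on {0..1} \<eta> \<eta>) * ennreal (ip_on {0..1} b b)"
    by (simp add: nn_integral_cmult nn_integral_multc L2set_on_nn_integral[OF b] L2set_on_nn_integral[OF \<eta>])
  finally have "L2sq2 (\<lambda>u x. b x * \<eta> u) < \<infinity>"
    by (simp add: ennreal_mult_less_top)
  moreover have "case_prod (\<lambda>u x. b x * \<eta> u) \<in> borel_measurable borel"
  proof -
    have "case_prod (\<lambda>u x. b x * \<eta> u) = (\<lambda>z. b (snd z) * \<eta> (fst z))" by auto
    moreover have "(\<lambda>z. b (snd z) * \<eta> (fst z)) \<in> borel_measurable (borel \<Otimes>\<^sub>M borel)" by measurable
    ultimately show ?thesis by (simp add: borel_prod)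
  qed
  ultimately show ?thesis by (simp add: L2set2_def)
qed

lemma ip2_tensor:
  assumes "b \<in> L2set_on {0..1}" "\<eta> \<in> L2set_on {0..1}" "b' \<in> L2set_on {0..1}" "\<eta>' \<in> L2set_on {0..1}"
  shows "ip2 (\<lambda>u x. b x * \<eta> u) (\<lambda>u x. b' x * \<eta>' u) = ip_on {0..1} b b' * ip_on {0..1} \<eta> \<eta>'"
proof -
  note L = L2set2_integrable[OF tensor_L2set2[OF assms(1,2)] tensor_L2set2[OF assms(3,4)]]
  have eq: "indicator sq01 z * case_prod (\<lambda>u x. b x * \<eta> u) z * case_prod (\<lambda>u x. b' x * \<eta>' u) z
    = (indicator {0..1} (fst z) * \<eta> (fst z) * \<eta>' (fst z)) * (indicator {0..1} (snd z) * b (snd z) * b' (snd z))" for z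
    by (auto simp: sq01_def indicator_def split: prod.splits)
  have "ip2 (\<lambda>u x. b x * \<eta> u) (\<lambda>u x. b' x * \<eta>' u) = (\<integral>z. (indicator {0..1} (fst z) * \<eta> (fst z) * \<eta>' (fst z)) * (indicator {0..1} (snd z) * b (snd z) * b' (snd z)) \<partial>(lborel \<Otimes>\<^sub>M lborel))"
    unfolding ip2_def eq lborel_prod ..
  also have "\<dots> = (\<integral>u. (\<integral>x. (indicator {0..1} u * \<eta> u * \<eta>' u) * (indicator {0..1} x * b x * b' x) \<partial>lborel) \<partial>lborel)"
    using L unfolding eq by (subst lborel_pair.integral_fst'[symmetric]) (auto simp: lborel_prod)
  also have "\<dots> = ip_on {0..1} b b' * ip_on {0..1} \<eta> \<eta>'"
    by (simp add: ip_on_def)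
  finally show ?thesis .
qed

lemma Kop_measurable:
  assumes g: "case_prod g \<in> borel_measurable borel" and f: "case_prod f \<in> borel_measurable borel"
  shows "case_prod (Kop g f) \<in> borel_measurable borel"
proof -
  have "sets ((borel :: (real \<times> real) measure) \<Otimes>\<^sub>M (lborel :: real measure)) = sets ((borel :: (real \<times> real) measure) \<Otimes>\<^sub>M (borel :: real measure))"
    by (rule sets_pair_measure_cong) auto
  then have sb: "sets ((borel :: (real \<times> real) measure) \<Otimes>\<^sub>M (lborel :: real measure)) = sets borel"
    unfolding borel_prod .
  have "(\<lambda>z :: (real \<times> real) \<times> real. (fst (fst z), snd (fst z) - snd z)) \<in> borel_measurable borel"
    by (intro borel_measurable_continuous_onI continuous_intros)
  from measurable_compose[OF this g]
  have mg: "(\<lambda>z. case_prod g (fst (fst z), snd (fst z) - snd z)) \<in> borel_measurable ((borel :: (real \<times> real) measure) \<Otimes>\<^sub>M lborel)"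
    by (simp only: measurable_cong_sets[OF sb refl])
  have "(\<lambda>z :: (real \<times> real) \<times> real. (fst (fst z), snd z)) \<in> borel_measurable borel"
    by (intro borel_measurable_continuous_onI continuous_intros)
  from measurable_compose[OF this f]
  have mf: "(\<lambda>z. case_prod f (fst (fst z), snd z)) \<in> borel_measurable ((borel :: (real \<times> real) measure) \<Otimes>\<^sub>M lborel)"
    by (simp only: measurable_cong_sets[OF sb refl])
  have mi: "(\<lambda>z. indicator {0..1} (snd z) :: real) \<in> borel_measurable ((borel :: (real \<times> real) measure) \<Otimes>\<^sub>M (lborel :: real measure))"
    by measurable
  have "(\<lambda>z. indicator {0..1} (snd z) * case_prod g (fst (fst z), snd (fst z) - snd z) * case_prod f (fst (fst z), snd z))
      \<in> borel_measurable ((borel :: (real \<times> real) measure) \<Otimes>\<^sub>M lborel)"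
    by (intro borel_measurable_times mi mg mf)
  then have "(\<lambda>(w, x). indicator {0..1} x * case_prod g (fst w, snd w - x) * case_prod f (fst w, x))
      \<in> borel_measurable ((borel :: (real \<times> real) measure) \<Otimes>\<^sub>M lborel)"
    by (simp only: case_prod_beta' fst_conv snd_conv)
  then have "(\<lambda>w. \<integral>x. indicator {0..1} x * case_prod g (fst w, snd w - x) * case_prod f (fst w, x) \<partial>lborel) \<in> borel_measurable (borel :: (real \<times> real) measure)"
    by (rule lborel.borel_measurable_lebesgue_integral)
  moreover have "case_prod (Kop g f) = (\<lambda>w. \<integral>x. indicator {0..1} x * case_prod g (fst w, snd w - x) * case_prod f (fst w, x) \<partial>lborel)"
    by (auto simp: Kop_def)
  ultimately show ?thesis by simp
qed

text \<open>For \<open>u\<close> in the unit interval the image is \<open>\<eta> u\<close> times a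
  trigonometric sum in \<open>t\<close> with coefficients \<open>fcoef b m * gcoef g m u\<close>.
  Parseval bounds its squared norm by \<open>D\<close>, which has to control only the frequencies in
  \<open>F\<close>, and the integral over \<open>u\<close> then sees the norm of
  \<open>\<eta>\<close>. The integrability statement serves the linearity of \<open>Kop\<close> on
  finite sums.\<close>

lemma Kop_tensor:
  assumes g: "case_prod g \<in> borel_measurable borel"
    and per: "\<forall>u t. g u (t + 1) = g u t"
    and gi: "\<forall>u\<in>{0..1}. set_integrable lborel {0..1} (g u)"
    and b: "b \<in> L2set_on {0..1}" "ip_on {0..1} b b = 1"
    and \<eta>: "\<eta> \<in> L2set_on {0..1}" "ip_on {0..1} \<eta> \<eta> = 1"
    and F: "finite F" "\<And>m. m \<notin> F \<Longrightarrow> fcoef b m = 0"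
    and D: "\<And>m u. m \<in> F \<Longrightarrow> u \<in> {0..1} \<Longrightarrow> (cmod (gcoef g m u))\<^sup>2 \<le> D" and D0: "0 \<le> D"
  shows "u \<in> {0..1} \<Longrightarrow> integrable lborel (\<lambda>x. indicator {0..1} x * g u (t - x) * (b x * \<eta> u))"
    and "Kop g (\<lambda>u x. b x * \<eta> u) \<in> L2set2"
    and "ip2 (Kop g (\<lambda>u x. b x * \<eta> u)) (Kop g (\<lambda>u x. b x * \<eta> u)) \<le> D"
proof -
  have [measurable]: "b \<in> borel_measurable borel" "\<eta> \<in> borel_measurable borel"
    using b \<eta> by (auto simp: L2set_on_def)
  define G where "G u t = (\<integral>x. indicator {0..1} x * g u (t - x) * b x \<partial>lborel)" for u t
  note conv = convolution_trigonometric_sum[of "g u" b F "fcoef b" t for u t]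
  have ae: "AE x in lborel. x \<in> {0..1} \<longrightarrow> complex_of_real (b x) = (\<Sum>m\<in>F. fcoef b m * cis (2 * pi * real_of_int m * x))"
    by (rule AE_eq_trigonometric_sum[OF L2set_on_integrable[OF b(1)] F])
  have Gi: "integrable lborel (\<lambda>x. indicator {0..1} x * g u (t - x) * b x)" if "u \<in> {0..1}" for u t
    by (rule conv) (use that per gi F ae in auto)
  have Gs: "complex_of_real (G u t) = (\<Sum>m\<in>F. (fcoef b m * gcoef g m u) * cis (2 * pi * real_of_int m * t))" if "u \<in> {0..1}" for u t
    unfolding G_def gcoef_def by (rule conv) (use that per gi F ae in auto)
  have KG: "Kop g (\<lambda>u x. b x * \<eta> u) u t = \<eta> u * G u t" for u t
    unfolding Kop_def G_def by (simp add: mult_ac flip: integral_mult_right_zero)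
  show "integrable lborel (\<lambda>x. indicator {0..1} x * g u (t - x) * (b x * \<eta> u))" if "u \<in> {0..1}"
    using integrable_mult_right[OF Gi[OF that, of t], of "\<eta> u"] by (simp add: mult_ac)
  have Gn: "(\<integral>\<^sup>+t. indicator {0..1} t * ennreal ((G u t)\<^sup>2) \<partial>lborel) \<le> ennreal D" if u: "u \<in> {0..1}" for u
  proof -
    let ?a = "\<lambda>m. fcoef b m * gcoef g m u"
    have sq: "(G u t)\<^sup>2 = (cmod (\<Sum>m\<in>F. ?a m * cis (2 * pi * real_of_int m * t)))\<^sup>2" for t
      unfolding Gs[OF u, symmetric] by simp
    have "(\<integral>\<^sup>+t. indicator {0..1} t * ennreal ((G u t)\<^sup>2) \<partial>lborel)
        = (\<integral>\<^sup>+t. ennreal (indicator {0..1} t * (cmod (\<Sum>m\<in>F. ?a m * cis (2 * pi * real_of_int m * t)))\<^sup>2) \<partial>lborel)"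
      unfolding sq by (intro nn_integral_cong) (auto split: split_indicator)
    also have "\<dots> = ennreal (\<Sum>m\<in>F. (cmod (?a m))\<^sup>2)"
      unfolding parseval_finite(2)[OF F(1), symmetric]
      by (intro nn_integral_eq_integral parseval_finite F) auto
    also have "(\<Sum>m\<in>F. (cmod (?a m))\<^sup>2) \<le> (\<Sum>m\<in>F. D * (cmod (fcoef b m))\<^sup>2)"
    proof (rule sum_mono)
      fix m assume "m \<in> F"
      then have "(cmod (gcoef g m u))\<^sup>2 * (cmod (fcoef b m))\<^sup>2 \<le> D * (cmod (fcoef b m))\<^sup>2"
        by (intro mult_right_mono D u) auto
      then show "(cmod (?a m))\<^sup>2 \<le> D * (cmod (fcoef b m))\<^sup>2"
        by (simp add: norm_mult power_mult_distrib mult.commute)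
    qed
    also have "\<dots> = D" by (simp add: sum_fcoef_sq[OF b(1) F] b(2) flip: sum_distrib_left)
    finally show ?thesis by (auto intro: ennreal_leI)
  qed
  have meas: "case_prod (Kop g (\<lambda>u x. b x * \<eta> u)) \<in> borel_measurable borel"
    by (rule Kop_measurable[OF g L2set2_measurable[OF tensor_L2set2[OF b(1) \<eta>(1)]]])
  have "L2sq2 (Kop g (\<lambda>u x. b x * \<eta> u)) = (\<integral>\<^sup>+z. indicator sq01 z * ennreal ((case_prod (Kop g (\<lambda>u x. b x * \<eta> u)) z)\<^sup>2) \<partial>(lborel \<Otimes>\<^sub>M lborel))"
    unfolding L2sq2_def lborel_prod ..
  also have "\<dots> = (\<integral>\<^sup>+u. \<integral>\<^sup>+t. indicator sq01 (u, t) * ennreal ((case_prod (Kop g (\<lambda>u x. b x * \<eta> u)) (u, t))\<^sup>2) \<partial>lborel \<partial>lborel)"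
    using meas by (subst lborel.nn_integral_fst[symmetric]) (auto simp: lborel_prod)
  also have "\<dots> \<le> (\<integral>\<^sup>+u. (indicator {0..1} u * ennreal ((\<eta> u)\<^sup>2)) * ennreal D \<partial>lborel)"
  proof (intro nn_integral_mono)
    fix u :: real
    have Gm: "(\<lambda>t. indicator {0..1} t * ennreal ((G u t)\<^sup>2)) \<in> borel_measurable lborel"
    proof -
      \<comment> \<open>Taking the factor 1 in place of \<open>\<eta>\<close> produces
        \<open>G\<close> itself. Dividing the image by \<open>\<eta> u\<close> would fail where this
        vanishes.\<close>
      have "(\<lambda>t. case_prod (Kop g (\<lambda>u x. b x * 1)) (u, t)) \<in> borel_measurable borel"
        by (rule measurable_compose[OF _ Kop_measurable[OF g]]) (auto simp: case_prod_beta' borel_prod[symmetric])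
      then have [measurable]: "G u \<in> borel_measurable borel" by (simp add: Kop_def G_def[abs_def])
      show ?thesis by measurable
    qed
    have "(\<integral>\<^sup>+t. indicator sq01 (u, t) * ennreal ((case_prod (Kop g (\<lambda>u x. b x * \<eta> u)) (u, t))\<^sup>2) \<partial>lborel)
       = (\<integral>\<^sup>+t. (indicator {0..1} u * ennreal ((\<eta> u)\<^sup>2)) * (indicator {0..1} t * ennreal ((G u t)\<^sup>2)) \<partial>lborel)"
      by (intro nn_integral_cong) (auto simp: sq01_def indicator_def KG power_mult_distrib ennreal_mult)
    also have "\<dots> = (indicator {0..1} u * ennreal ((\<eta> u)\<^sup>2)) * (\<integral>\<^sup>+t. indicator {0..1} t * ennreal ((G u t)\<^sup>2) \<partial>lborel)"
      by (rule nn_integral_cmult[OF Gm])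
    also have "\<dots> \<le> (indicator {0..1} u * ennreal ((\<eta> u)\<^sup>2)) * ennreal D"
      using Gn[of u] by (cases "u \<in> {0..1}") (auto intro!: mult_left_mono)
    finally show "(\<integral>\<^sup>+t. indicator sq01 (u, t) * ennreal ((case_prod (Kop g (\<lambda>u x. b x * \<eta> u)) (u, t))\<^sup>2) \<partial>lborel)
      \<le> (indicator {0..1} u * ennreal ((\<eta> u)\<^sup>2)) * ennreal D" .
  qed
  also have "\<dots> = ennreal D"
    by (subst nn_integral_multc) (auto simp: L2set_on_nn_integral[OF \<eta>(1)] \<eta>(2))
  finally have le: "L2sq2 (Kop g (\<lambda>u x. b x * \<eta> u)) \<le> ennreal D" .
  then have "L2sq2 (Kop g (\<lambda>u x. b x * \<eta> u)) < \<infinity>" by (metis ennreal_less_top le_less_trans infinity_ennreal_def)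
  then show L: "Kop g (\<lambda>u x. b x * \<eta> u) \<in> L2set2"
    using meas by (simp add: L2set2_def)
  show "ip2 (Kop g (\<lambda>u x. b x * \<eta> u)) (Kop g (\<lambda>u x. b x * \<eta> u)) \<le> D"
    using le D0 unfolding L2sq2_eq_ip2[OF L] by (simp add: ennreal_le_iff)
qed

text \<open>At \<open>\<omega> = 2 * pi * m / 2 ^ nat j\<close> the band
  \<open>2 * pi / 3 \<le> \<bar>\<omega>\<bar> \<le> 8 * pi / 3\<close> of \<open>psi\<close>
  becomes the range of \<open>\<bar>m\<bar>\<close> from \<open>2 ^ nat j / 3\<close> to
  \<open>4 * 2 ^ nat j / 3\<close>. Level \<open>m0 - 1\<close> is excluded because the band of the
  scaling function contains 0.\<close>

lemma meyer_band_limited: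
  assumes "meyer_basis m0 B" "m0 \<le> j" "k \<in> kset m0 j"
    and "real_of_int \<bar>m\<bar> < 2 ^ nat j / 3 \<or> real_of_int \<bar>m\<bar> > 4 * 2 ^ nat j / 3"
  shows "fcoef (B j k) m = 0"
proof -
  from assms(1) obtain phi psi where psi: "integrable lborel psi"
    and FT: "\<And>\<omega>. (\<bar>\<omega>\<bar> < 2 * pi / 3 \<or> \<bar>\<omega>\<bar> > 8 * pi / 3) \<Longrightarrow> FT psi \<omega> = 0"
    and per: "periodized_from m0 phi psi B"
    unfolding meyer_basis_def by blast
  have B: "B j k = per psi (nat j) k" using per assms(2,3) by (auto simp: periodized_from_def)
  have "(j, k) \<in> widx m0" using assms(2,3) by (auto simp: widx_def levels_def)
  then have "B j k \<in> L2set_on {0..1}" using per by (force simp: periodized_from_def ONB_on_def)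
  then have meas: "per psi (nat j) k \<in> borel_measurable borel" by (simp add: L2set_on_def B)
  show ?thesis unfolding B
  proof (rule fcoef_per_eq_0[OF psi meas], rule FT)
    have eq: "\<bar>2 * pi * real_of_int m / 2 ^ nat j\<bar> = 2 * pi * (real_of_int \<bar>m\<bar> / 2 ^ nat j)"
      by (simp add: abs_mult)
    have "real_of_int \<bar>m\<bar> / 2 ^ nat j < 1 / 3 \<or> real_of_int \<bar>m\<bar> / 2 ^ nat j > 4 / 3"
      using assms(4) by (auto simp: field_simps)
    then show "\<bar>2 * pi * real_of_int m / 2 ^ nat j\<bar> < 2 * pi / 3 \<or> \<bar>2 * pi * real_of_int m / 2 ^ nat j\<bar> > 8 * pi / 3"
    proof
      assume "real_of_int \<bar>m\<bar> / 2 ^ nat j < 1 / 3"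
      from mult_strict_left_mono[OF this, of "2 * pi"] show ?thesis unfolding eq by simp
    next
      assume "real_of_int \<bar>m\<bar> / 2 ^ nat j > 4 / 3"
      from mult_strict_left_mono[OF this, of "2 * pi"] show ?thesis unfolding eq by simp
    qed
  qed
qed

section \<open>Rates\<close>

lemma enn2real_ge_1:
  assumes "1 \<le> p" "p \<noteq> \<infinity>"
  shows "1 \<le> enn2real p"
  using enn2real_mono[OF assms(1)] assms(2) by (simp add: less_top)

lemma lpn_zero:
  assumes "finite F" "F \<noteq> {}"
  shows "lpn p F (\<lambda>_. 0) = 0"
  using assms by (simp add: lpn_def)

text \<open>For coefficients of equal size on \<open>I\<close> the norm depends only on their
  number. The convention that \<open>invp\<close> is 0 at infinity lets one formula serve the
  maximum norm as well.\<close>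

lemma lpn_flat:
  assumes p: "1 \<le> p" and F: "finite F" and I: "I \<subseteq> F" "I \<noteq> {}"
    and \<beta>: "0 \<le> \<beta>" and b: "\<And>i. i \<in> I \<Longrightarrow> \<bar>b i\<bar> = \<beta>" "\<And>i. i \<in> F - I \<Longrightarrow> b i = 0"
  shows "lpn p F b \<le> \<beta> * real (card I) powr invp p"
proof (cases "p = \<infinity>")
  case True
  have "Max ((\<lambda>i. \<bar>b i\<bar>) ` F) \<le> \<beta>"
  proof (rule Max.boundedI)
    show "finite ((\<lambda>i. \<bar>b i\<bar>) ` F)" "(\<lambda>i. \<bar>b i\<bar>) ` F \<noteq> {}" using F I by auto
    fix a assume "a \<in> (\<lambda>i. \<bar>b i\<bar>) ` F"
    then obtain i where i: "i \<in> F" "a = \<bar>b i\<bar>" by auto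
    show "a \<le> \<beta>" using i b(1)[of i] b(2)[of i] \<beta> by (cases "i \<in> I") auto
  qed
  moreover have "card I \<noteq> 0" using I F finite_subset by fastforce
  moreover have "lpn p F b = Max ((\<lambda>i. \<bar>b i\<bar>) ` F)"
    unfolding lpn_def by (rule if_P[OF True])
  moreover have "invp p = 0" unfolding invp_def by (rule if_P[OF True])
  ultimately show ?thesis by simp
next
  case False
  define r where "r = enn2real p"
  have r: "r \<ge> 1" unfolding r_def by (rule enn2real_ge_1[OF p False])
  have fI: "finite I" using I F finite_subset by blast
  have "(\<Sum>i\<in>F. \<bar>b i\<bar> powr r) = (\<Sum>i\<in>I. \<bar>b i\<bar> powr r)"
    by (rule sum.mono_neutral_right[OF F I(1)]) (use b in simp)
  also have "\<dots> = real (card I) * \<beta> powr r" using b by simp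
  finally have "lpn p F b = (real (card I) * \<beta> powr r) powr (1 / r)"
    using False by (simp add: lpn_def r_def)
  also have "\<dots> = real (card I) powr (1 / r) * (\<beta> powr r) powr (1 / r)"
    by (rule powr_mult)
  also have "(\<beta> powr r) powr (1 / r) = \<beta>"
    using r \<beta> by (simp add: powr_powr)
  finally show ?thesis using False by (simp add: invp_def r_def mult.commute)
qed

lemma ip2_cong_sq01:
  assumes "\<And>u x. u \<in> {0..1} \<Longrightarrow> x \<in> {0..1} \<Longrightarrow> h u x = h' u x"
  shows "ip2 h \<phi> = ip2 h' \<phi>"
  unfolding ip2_def using assms
  by (intro Bochner_Integration.integral_cong refl) (auto simp: sq01_def indicator_def)

lemma kset_finite: "finite (kset m0 j)" by (simp add: kset_def)

lemma zero_in_kset: "0 \<in> kset m0 j" by (simp add: kset_def)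

lemma kset_nonempty: "kset m0 j \<noteq> {}" using zero_in_kset by blast

lemma card_kset: "0 \<le> m0 \<Longrightarrow> m0 \<le> j \<Longrightarrow> card (kset m0 j) = 2 ^ nat j"
  by (simp add: kset_def nat_power_eq max_def)

text \<open>The level is the real number \<open>y\<close> at which the smallness condition holds
  with equality, rounded up. Rounding costs at most one level, hence the factor
  \<open>2 powr (- \<alpha>)\<close> in \<open>C\<close>; solving for \<open>y\<close> produces the
  factor \<open>(1 / \<kappa>) powr (\<alpha> / \<gamma>)\<close>.\<close>

lemma rate_from_levels:
  fixes R :: "real \<Rightarrow> ennreal" and \<alpha> \<gamma> \<kappa> c A :: real
  assumes \<gamma>: "0 < \<gamma>" and \<alpha>: "0 \<le> \<alpha>" and \<kappa>: "0 < \<kappa>" and c: "0 < c" and A: "0 < A"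
    and low: "\<And>\<epsilon> J. 0 < \<epsilon> \<Longrightarrow> J0 \<le> J \<Longrightarrow> \<kappa> * 2 powr (- (real J * \<gamma>)) \<le> \<epsilon>\<^sup>2 / A\<^sup>2
        \<Longrightarrow> ennreal (c * A\<^sup>2 * 2 powr (- (real J * \<alpha>))) \<le> R \<epsilon>"
  shows "\<exists>C>0. \<forall>\<^sub>F \<epsilon> in at_right 0. ennreal (C * A\<^sup>2 * (\<epsilon>\<^sup>2 / A\<^sup>2) powr (\<alpha> / \<gamma>)) \<le> R \<epsilon>"
proof (intro exI conjI)
  define C where "C = c * 2 powr (- \<alpha>) * (1 / \<kappa>) powr (\<alpha> / \<gamma>)"
  show "0 < C" using c \<kappa> by (simp add: C_def)
  \<comment> \<open>Below this threshold the level \<open>y\<close> is at least \<open>J0\<close>,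
    so the hypothesis on levels becomes available.\<close>
  define x0 where "x0 = \<kappa> * 2 powr (- (real J0 * \<gamma>))"
  have x0: "0 < x0" using \<kappa> by (simp add: x0_def)
  have "((\<lambda>\<epsilon>. \<epsilon>\<^sup>2 / A\<^sup>2) \<longlongrightarrow> 0\<^sup>2 / A\<^sup>2) (at_right 0)"
    using A by (intro tendsto_intros) auto
  then have "\<forall>\<^sub>F \<epsilon> in at_right 0. \<epsilon>\<^sup>2 / A\<^sup>2 < x0"
    using x0 by (intro order_tendstoD) auto
  moreover have "\<forall>\<^sub>F \<epsilon> in at_right (0::real). 0 < \<epsilon>" by (rule eventually_at_right_less)
  ultimately show "\<forall>\<^sub>F \<epsilon> in at_right 0. ennreal (C * A\<^sup>2 * (\<epsilon>\<^sup>2 / A\<^sup>2) powr (\<alpha> / \<gamma>)) \<le> R \<epsilon>"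
  proof eventually_elim
    case (elim \<epsilon>)
    define x where "x = \<epsilon>\<^sup>2 / A\<^sup>2"
    have x: "0 < x" "x < x0" using elim A by (auto simp: x_def)
    define y where "y = log 2 (\<kappa> / x) / \<gamma>"
    have yx: "2 powr (- (y * \<gamma>)) = x / \<kappa>"
      using \<gamma> \<kappa> x by (simp add: y_def powr_minus)
    have yJ: "real J0 \<le> y"
    proof -
      have "2 powr (real J0 * \<gamma>) \<le> \<kappa> / x"
        using x \<kappa> by (simp add: x0_def powr_minus field_simps)
      then have "real J0 * \<gamma> \<le> log 2 (\<kappa> / x)"
        using \<kappa> x by (simp add: le_log_iff)
      then show ?thesis using \<gamma> by (simp add: y_def field_simps)
    qed
    define J where "J = nat \<lceil>y\<rceil>"
    have J: "y \<le> real J" "real J \<le> y + 1" using yJ by (auto simp: J_def)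
    have "2 powr (- (real J * \<gamma>)) \<le> 2 powr (- (y * \<gamma>))" using J \<gamma> by (simp add: mult_right_mono)
    from mult_left_mono[OF this, of \<kappa>] have "\<kappa> * 2 powr (- (real J * \<gamma>)) \<le> x" unfolding yx using \<kappa> by simp
    moreover have "J0 \<le> J" using yJ J by linarith
    ultimately have "ennreal (c * A\<^sup>2 * 2 powr (- (real J * \<alpha>))) \<le> R \<epsilon>"
      using low elim by (auto simp: x_def)
    moreover have "C * A\<^sup>2 * x powr (\<alpha> / \<gamma>) \<le> c * A\<^sup>2 * 2 powr (- (real J * \<alpha>))"
    proof -
      have "2 powr (- \<alpha>) * (x / \<kappa>) powr (\<alpha> / \<gamma>) = 2 powr (- ((y + 1) * \<alpha>))"
        unfolding yx[symmetric] using \<gamma> by (simp add: powr_powr powr_add[symmetric] field_simps)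
      also have "\<dots> \<le> 2 powr (- (real J * \<alpha>))" using J \<alpha> by (simp add: mult_right_mono)
      finally have "c * A\<^sup>2 * (2 powr (- \<alpha>) * (x / \<kappa>) powr (\<alpha> / \<gamma>)) \<le> c * A\<^sup>2 * 2 powr (- (real J * \<alpha>))"
        using c by (intro mult_left_mono) auto
      moreover have "(x / \<kappa>) powr (\<alpha> / \<gamma>) = (1 / \<kappa>) powr (\<alpha> / \<gamma>) * x powr (\<alpha> / \<gamma>)"
        using x \<kappa> by (simp add: powr_mult[symmetric])
      ultimately show ?thesis by (simp add: C_def mult_ac)
    qed
    ultimately show ?case unfolding x_def[symmetric] by (meson ennreal_leI order_trans)
  qed
qed

section \<open>Lower bounds from one pair of resolution levels\<close>

locale functional_deconvolution =
  fixes s1 s2 A \<nu> C1 C2 :: real and p q :: ennreal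
    and m0 m0' :: int and s0 :: nat
    and B H :: "int \<Rightarrow> int \<Rightarrow> real \<Rightarrow> real"
    and g :: "real \<Rightarrow> real \<Rightarrow> real"
    and M :: "'a measure" and W :: "'a \<Rightarrow> (real \<Rightarrow> real \<Rightarrow> real) \<Rightarrow> real"
  assumes s1: "s1 > 0" and s2: "s2 > 0" and p: "1 \<le> p" and q: "1 \<le> q"
    and smooth: "min s1 s2 \<ge> max (invp p) (1/2)"
    and A: "A > 0"
    and meyer: "meyer_basis m0 B" and daub: "daub_basis s0 m0' H"
    and W: "white_noise M W"
    and g: "case_prod g \<in> borel_measurable borel"
    and gper: "\<forall>u t. g u (t + 1) = g u t"
    and gint: "\<forall>u\<in>{0..1}. set_integrable lborel {0..1} (g u)"
    and \<nu>: "\<nu> > 0" and C1: "0 < C1" and C2: "C1 \<le> C2"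
    and gcoef: "\<forall>m::int. m \<noteq> 0 \<longrightarrow> (\<forall>u\<in>{0..1}.
           C1 * \<bar>real_of_int m\<bar> powr (- 2 * \<nu>) \<le> (cmod (gcoef g m u))\<^sup>2 \<and>
           (cmod (gcoef g m u))\<^sup>2 \<le> C2 * \<bar>real_of_int m\<bar> powr (- 2 * \<nu>))"
begin

lemma m0_nonneg: "0 \<le> m0" "0 \<le> m0'"
  using meyer daub by (auto simp: meyer_basis_def daub_basis_def)

lemma B_ONB: "ONB_on {0..1} (widx m0) (\<lambda>(j, k). B j k)"
  using meyer by (auto simp: meyer_basis_def periodized_from_def)

lemma H_ONB: "ONB_on {0..1} (widx m0') (\<lambda>(j, k). H j k)"
  using daub by (auto simp: daub_basis_def periodized_from_def)

lemma B_L2: "(j, k) \<in> widx m0 \<Longrightarrow> B j k \<in> L2set_on {0..1}"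
  using B_ONB by (force simp: ONB_on_def)

lemma H_L2: "(j, k) \<in> widx m0' \<Longrightarrow> H j k \<in> L2set_on {0..1}"
  using H_ONB by (force simp: ONB_on_def)

lemma B_ip: "(j, k) \<in> widx m0 \<Longrightarrow> (l, n) \<in> widx m0 \<Longrightarrow>
    ip_on {0..1} (B j k) (B l n) = (if j = l \<and> k = n then 1 else 0)"
  using B_ONB unfolding ONB_on_def by fastforce

lemma H_ip: "(j, k) \<in> widx m0' \<Longrightarrow> (l, n) \<in> widx m0' \<Longrightarrow>
    ip_on {0..1} (H j k) (H l n) = (if j = l \<and> k = n then 1 else 0)"
  using H_ONB unfolding ONB_on_def by fastforce

text \<open>The assumed upper bound on \<open>gcoef\<close> decreases with the frequency, so over
  the band of a wavelet at level \<open>j\<close> it is largest at the lower end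
  \<open>2 ^ nat j / 3\<close>.\<close>

definition operator_bound :: "int \<Rightarrow> real" where
  "operator_bound j = C2 * (2 ^ nat j / 3) powr (- 2 * \<nu>)"

lemma gcoef_band_bound:
  assumes "real_of_int \<bar>m\<bar> \<ge> 2 ^ nat j / 3" and "u \<in> {0..1}"
  shows "(cmod (gcoef g m u))\<^sup>2 \<le> operator_bound j"
proof -
  have pos: "(2 :: real) ^ nat j / 3 > 0" by simp
  have "m \<noteq> 0"
  proof
    assume "m = 0"
    then show False using assms(1) pos by simp
  qed
  then have "(cmod (gcoef g m u))\<^sup>2 \<le> C2 * \<bar>real_of_int m\<bar> powr (- 2 * \<nu>)"
    using gcoef assms(2) by blast
  also have "\<dots> \<le> operator_bound j" unfolding operator_bound_def
    using assms(1) C1 C2 \<nu> pos by (intro mult_left_mono powr_mono2') auto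
  finally show ?thesis .
qed

lemma Kop_wavelet:
  assumes j: "m0 \<le> j" "k \<in> kset m0 j" and j': "(j', k') \<in> widx m0'"
  shows "u \<in> {0..1} \<Longrightarrow> integrable lborel (\<lambda>x. indicator {0..1} x * g u (t - x) * (B j k x * H j' k' u))"
    and "Kop g (\<lambda>u x. B j k x * H j' k' u) \<in> L2set2"
    and "ip2 (Kop g (\<lambda>u x. B j k x * H j' k' u)) (Kop g (\<lambda>u x. B j k x * H j' k' u)) \<le> operator_bound j"
proof -
  define F where "F = {m :: int. 2 ^ nat j / 3 \<le> real_of_int \<bar>m\<bar> \<and> real_of_int \<bar>m\<bar> \<le> 4 * 2 ^ nat j / 3}"
  have "F \<subseteq> {- \<lceil>4 * 2 ^ nat j / 3 :: real\<rceil> .. \<lceil>4 * 2 ^ nat j / 3 :: real\<rceil>}"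
    unfolding F_def by (auto simp: abs_le_iff) linarith+
  then have F: "finite F" using finite_subset by blast
  have z: "fcoef (B j k) m = 0" if "m \<notin> F" for m
    by (rule meyer_band_limited[OF meyer j]) (use that in \<open>auto simp: F_def\<close>)
  have jk: "(j, k) \<in> widx m0" using j by (auto simp: widx_def levels_def)
  have D0: "0 \<le> operator_bound j" using C1 C2 by (simp add: operator_bound_def)
  note K = Kop_tensor[OF g gper gint B_L2[OF jk] _ H_L2[OF j'] _ F z _ D0]
  have n: "ip_on {0..1} (B j k) (B j k) = 1" "ip_on {0..1} (H j' k') (H j' k') = 1"
    using B_ip[OF jk jk] H_ip[OF j' j'] by auto
  have D: "(cmod (gcoef g m u))\<^sup>2 \<le> operator_bound j" if "m \<in> F" "u \<in> {0..1}" for m u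
    using that by (intro gcoef_band_bound) (auto simp: F_def)
  show "u \<in> {0..1} \<Longrightarrow> integrable lborel (\<lambda>x. indicator {0..1} x * g u (t - x) * (B j k x * H j' k' u))"
    by (rule K(1)) (use n D in auto)
  show "Kop g (\<lambda>u x. B j k x * H j' k' u) \<in> L2set2"
    by (rule K(2)) (use n D in auto)
  show "ip2 (Kop g (\<lambda>u x. B j k x * H j' k' u)) (Kop g (\<lambda>u x. B j k x * H j' k' u)) \<le> operator_bound j"
    by (rule K(3)) (use n D in auto)
qed

lemma wavelet_ip2:
  assumes "(j, k) \<in> widx m0" "(j', k') \<in> widx m0'" "(l, n) \<in> widx m0" "(l', n') \<in> widx m0'"
  shows "ip2 (\<lambda>u x. B j k x * H j' k' u) (\<lambda>u x. B l n x * H l' n' u)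
    = (if j = l \<and> k = n \<and> j' = l' \<and> k' = n' then 1 else 0)"
  using assms by (simp add: ip2_tensor B_L2 H_L2 B_ip H_ip)

text \<open>By orthonormality all nonzero coefficients sit on one pair of levels, so for every
  \<open>q\<close> the condition over all levels reduces to the weight of that single pair.\<close>

lemma flat_sum_in_besov_ball:
  assumes j: "m0 \<le> j" and j': "m0' \<le> j'" and I: "I \<subseteq> kset m0 j \<times> kset m0' j'" "I \<noteq> {}"
    and \<beta>: "0 \<le> \<beta>" and \<theta>: "\<forall>i. \<bar>\<theta> i\<bar> = 1"
    and bound: "2 powr (real_of_int j * (s1 + 1/2 - invp p) + real_of_int j' * (s2 + 1/2 - invp p))
      * (\<beta> * real (card I) powr invp p) \<le> A"
  shows "(\<lambda>u x. \<Sum>i\<in>I. \<beta> * \<theta> i * (B j (fst i) x * H j' (snd i) u)) \<in> besov_ball B m0 H m0' s1 s2 p q A"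
proof -
  define f where "f = (\<lambda>u x. \<Sum>i\<in>I. (\<beta> * \<theta> i) * (B j (fst i) x * H j' (snd i) u))"
  have fI: "finite I" using I(1) by (rule finite_subset) (simp add: kset_finite)
  have idx: "(j, fst i) \<in> widx m0" "(j', snd i) \<in> widx m0'" if "i \<in> I" for i
    using that I j j' by (auto simp: widx_def levels_def)
  have eL: "(\<lambda>u x. B j (fst i) x * H j' (snd i) u) \<in> L2set2" if "i \<in> I" for i
    by (intro tensor_L2set2 B_L2 H_L2 idx that)
  have fL: "f \<in> L2set2" unfolding f_def by (rule L2set2_sum[OF fI eL])
  have wc: "wcoef B H f l n l' n' = (if l = j \<and> l' = j' \<and> (n, n') \<in> I then \<beta> * \<theta> (n, n') else 0)"
    if "(l, n) \<in> widx m0" "(l', n') \<in> widx m0'" for l n l' n'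
  proof -
    have L: "(\<lambda>u x. B l n x * H l' n' u) \<in> L2set2" by (intro tensor_L2set2 B_L2 H_L2 that)
    have "wcoef B H f l n l' n' = (\<Sum>i\<in>I. (\<beta> * \<theta> i) * ip2 (\<lambda>u x. B j (fst i) x * H j' (snd i) u) (\<lambda>u x. B l n x * H l' n' u))"
      unfolding wcoef_def f_def by (rule ip2_sum_left[OF fI eL L])
    also have "\<dots> = (\<Sum>i\<in>I. if i = (n, n') then (if l = j \<and> l' = j' then \<beta> * \<theta> (n, n') else 0) else 0)"
      by (intro sum.cong refl, subst wavelet_ip2) (use idx that in \<open>auto simp: prod_eq_iff\<close>)
    also have "\<dots> = (if l = j \<and> l' = j' \<and> (n, n') \<in> I then \<beta> * \<theta> (n, n') else 0)"
      using fI by simp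
    finally show ?thesis .
  qed
  have widx: "(l, n) \<in> widx m \<longleftrightarrow> l \<in> levels m \<and> n \<in> kset m l" for l n m by (simp add: widx_def)
  let ?w = "level_weight B H m0 m0' s1 s2 p f"
  have w0: "?w l l' = 0" if "l \<in> levels m0" "l' \<in> levels m0'" "(l, l') \<noteq> (j, j')" for l l'
  proof -
    have "lpn p (kset m0 l \<times> kset m0' l') (\<lambda>(k, k'). wcoef B H f l k l' k') = lpn p (kset m0 l \<times> kset m0' l') (\<lambda>_. 0)"
    proof -
      have z: "wcoef B H f l k l' k' = 0" if "k \<in> kset m0 l" "k' \<in> kset m0' l'" for k k'
        using wc[of l k l' k'] that \<open>l \<in> levels m0\<close> \<open>l' \<in> levels m0'\<close> \<open>(l, l') \<noteq> (j, j')\<close> by (auto simp: widx)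
      \<comment> \<open>The coefficients are known to vanish only at indices of the basis, so the
        two sequences in \<open>lpn\<close> are compared on the finite index set and not as
        functions.\<close>
      have "(\<lambda>i. \<bar>case i of (k, k') \<Rightarrow> wcoef B H f l k l' k'\<bar>) ` (kset m0 l \<times> kset m0' l') = (\<lambda>i. \<bar>0\<bar>) ` (kset m0 l \<times> kset m0' l')"
        by (intro image_cong refl) (auto simp: z)
      moreover have "(\<Sum>i\<in>kset m0 l \<times> kset m0' l'. \<bar>case i of (k, k') \<Rightarrow> wcoef B H f l k l' k'\<bar> powr enn2real p)
         = (\<Sum>i\<in>kset m0 l \<times> kset m0' l'. \<bar>0\<bar> powr enn2real p)"
        by (intro sum.cong refl) (auto simp: z)
      ultimately show ?thesis unfolding lpn_def by simp
    qed
    also have "\<dots> = 0"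
      by (rule lpn_zero) (use zero_in_kset in \<open>auto simp: kset_finite\<close>)
    finally show ?thesis by (simp add: level_weight_def)
  qed
  have wj: "?w j j' \<le> A"
  proof -
    have "lpn p (kset m0 j \<times> kset m0' j') (\<lambda>(k, k'). wcoef B H f j k j' k') \<le> \<beta> * real (card I) powr invp p"
    proof (rule lpn_flat[OF p _ I \<beta>])
      show "finite (kset m0 j \<times> kset m0' j')" by (simp add: kset_finite)
      show "\<bar>case i of (k, k') \<Rightarrow> wcoef B H f j k j' k'\<bar> = \<beta>" if "i \<in> I" for i
        using wc[OF idx[OF that]] that \<theta>[rule_format, of i] \<beta> by (simp add: case_prod_beta' abs_mult)
      show "(case i of (k, k') \<Rightarrow> wcoef B H f j k j' k') = 0" if "i \<in> kset m0 j \<times> kset m0' j' - I" for i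
        using wc[of j "fst i" j' "snd i"] that j j' by (auto simp: case_prod_beta' widx levels_def)
    qed
    then have "?w j j' \<le> 2 powr (real_of_int j * (s1 + 1/2 - invp p) + real_of_int j' * (s2 + 1/2 - invp p))
      * (\<beta> * real (card I) powr invp p)"
      unfolding level_weight_def by (intro mult_left_mono) auto
    then show ?thesis using bound by linarith
  qed
  \<comment> \<open>Needed because raising to the power given by \<open>q\<close> is monotone on
    nonnegative numbers.\<close>
  have w_nonneg: "0 \<le> ?w j j'"
  proof -
    have "0 \<le> lpn p (kset m0 j \<times> kset m0' j') (\<lambda>(k, k'). wcoef B H f j k j' k')"
    proof (cases "p = \<infinity>")
      case True
      let ?S = "(\<lambda>i. \<bar>case i of (k, k') \<Rightarrow> wcoef B H f j k j' k'\<bar>) ` (kset m0 j \<times> kset m0' j')"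
      have "\<bar>wcoef B H f j 0 j' 0\<bar> \<in> ?S"
        using zero_in_kset by (intro image_eqI[of _ _ "(0, 0)"]) auto
      then have "\<bar>wcoef B H f j 0 j' 0\<bar> \<le> Max ?S" by (intro Max_ge) (auto simp: kset_finite)
      then show ?thesis using True by (simp add: lpn_def)
    qed (simp add: lpn_def)
    then show ?thesis by (simp add: level_weight_def)
  qed
  have jl: "j \<in> levels m0" "j' \<in> levels m0'" using j j' by (auto simp: levels_def)
  have "f \<in> besov_ball B m0 H m0' s1 s2 p q A"
  proof (cases "q = \<infinity>")
    case True
    have "?w l l' \<le> A" if "l \<in> levels m0" "l' \<in> levels m0'" for l l'
      using w0[OF that] wj A by (cases "(l, l') = (j, j')") auto
    then show ?thesis using True fL by (simp add: besov_ball_def)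
  next
    case False
    define r where "r = enn2real q"
    have "(\<integral>\<^sup>+ jj. ennreal (case_prod ?w jj powr r) \<partial>count_space (levels m0 \<times> levels m0'))
      = (\<integral>\<^sup>+ jj. ennreal (?w j j' powr r) * indicator {(j, j')} jj \<partial>count_space (levels m0 \<times> levels m0'))"
    proof (rule nn_integral_cong)
      fix jj assume "jj \<in> space (count_space (levels m0 \<times> levels m0'))"
      then show "ennreal (case_prod ?w jj powr r) = ennreal (?w j j' powr r) * indicator {(j, j')} jj"
        using w0[of "fst jj" "snd jj"] by (cases "jj = (j, j')") (auto simp: case_prod_beta' mem_Times_iff)
    qed
    also have "\<dots> = ennreal (?w j j' powr r)"
      using jl by (subst nn_integral_cmult_indicator) auto
    also have "\<dots> \<le> ennreal (A powr r)"
      using wj w_nonneg by (intro ennreal_leI powr_mono2) (auto simp: r_def)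
    finally show ?thesis using False fL by (simp add: besov_ball_def r_def)
  qed
  then show ?thesis by (simp add: f_def)
qed

text \<open>\<open>\<beta>\<close> solves the condition of \<open>flat_sum_in_besov_ball\<close>
  with equality, so it is the largest amplitude that this condition admits for the index set
  \<open>I\<close>. Orthogonality of the images is not at issue: signs are flipped one at a time,
  and only the norm of each image counts.\<close>

lemma minimax_lower_bound_at_levels:
  assumes j: "m0 \<le> j" and j': "m0' \<le> j'" and I: "I \<subseteq> kset m0 j \<times> kset m0' j'" "I \<noteq> {}"
    and \<beta>: "\<beta> = A * 2 powr (- (real_of_int j * (s1 + 1/2 - invp p) + real_of_int j' * (s2 + 1/2 - invp p)))
      * real (card I) powr (- invp p)"
    and eps: "0 < \<epsilon>" and small: "(2 * \<beta>)\<^sup>2 * operator_bound j \<le> \<epsilon>\<^sup>2"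
  shows "ennreal (std_normal_density 2 * real (card I) * \<beta>\<^sup>2)
    \<le> minimax_risk M W g \<epsilon> (besov_ball B m0 H m0' s1 s2 p q A)"
proof -
  have fI: "finite I" using I(1) by (rule finite_subset) (simp add: kset_finite)
  have idx: "(j, fst i) \<in> widx m0" "(j', snd i) \<in> widx m0'" and ks: "fst i \<in> kset m0 j" if "i \<in> I" for i
    using that I j j' by (auto simp: widx_def levels_def)
  let ?e = "\<lambda>i u x. B j (fst i) x * H j' (snd i) u"
  have eL: "?e i \<in> L2set2" if "i \<in> I" for i
    by (intro tensor_L2set2 B_L2 H_L2 idx that)
  have \<beta>0: "0 \<le> \<beta>" using A by (simp add: \<beta>)
  have cI: "card I > 0" using I fI by (simp add: card_gt_0_iff)
  have Kw: "u \<in> {0..1} \<Longrightarrow> integrable lborel (\<lambda>x. indicator {0..1} x * g u (t - x) * ?e i u x)"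
    "Kop g (?e i) \<in> L2set2" "ip2 (Kop g (?e i)) (Kop g (?e i)) \<le> operator_bound j" if "i \<in> I" for i u t
    using Kop_wavelet[OF j ks[OF that] idx(2)[OF that]] by auto
  show ?thesis
  proof (rule assouad_lower_bound[where e = ?e and k = "\<lambda>i. Kop g (?e i)", OF W eps fI eL])
    show "ip2 (?e i) (?e l) = (if i = l then 1 else 0)" if "i \<in> I" "l \<in> I" for i l
      using wavelet_ip2[OF idx[OF that(1)] idx[OF that(2)]] by (auto simp: prod_eq_iff)
    show "(\<lambda>u x. \<Sum>i\<in>I. \<beta> * \<theta> i * ?e i u x) \<in> besov_ball B m0 H m0' s1 s2 p q A" if "\<forall>i. \<bar>\<theta> i\<bar> = 1" for \<theta>
    proof (rule flat_sum_in_besov_ball[OF j j' I \<beta>0 that])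
      let ?a = "real_of_int j * (s1 + 1/2 - invp p) + real_of_int j' * (s2 + 1/2 - invp p)"
      have "2 powr ?a * (\<beta> * real (card I) powr invp p) = A * (2 powr ?a * 2 powr (- ?a)) * (real (card I) powr (- invp p) * real (card I) powr invp p)"
        by (simp only: \<beta> mult_ac)
      also have "\<dots> = A" using cI by (simp flip: powr_add)
      finally show "2 powr ?a * (\<beta> * real (card I) powr invp p) \<le> A" by simp
    qed
    show "ip2 (Kop g (\<lambda>u x. \<Sum>i\<in>I. \<beta> * \<theta> i * ?e i u x)) \<phi> = (\<Sum>i\<in>I. \<beta> * \<theta> i * ip2 (Kop g (?e i)) \<phi>)"
      if \<phi>: "\<phi> \<in> L2set2" for \<theta> \<phi>
    proof -
      have "ip2 (Kop g (\<lambda>u x. \<Sum>i\<in>I. \<beta> * \<theta> i * ?e i u x)) \<phi> = ip2 (\<lambda>u t. \<Sum>i\<in>I. (\<beta> * \<theta> i) * Kop g (?e i) u t) \<phi>"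
      proof (rule ip2_cong_sq01)
        \<comment> \<open>Integrability of the summands, hence linearity of the integral, is
          available for \<open>u\<close> in the unit interval; \<open>ip2\<close> depends on no
          other values.\<close>
        fix u t :: real assume u: "u \<in> {0..1}"
        have "Kop g (\<lambda>u x. \<Sum>i\<in>I. \<beta> * \<theta> i * ?e i u x) u t
          = (\<integral>x. (\<Sum>i\<in>I. (\<beta> * \<theta> i) * (indicator {0..1} x * g u (t - x) * ?e i u x)) \<partial>lborel)"
          unfolding Kop_def by (intro Bochner_Integration.integral_cong refl) (simp add: sum_distrib_left mult_ac)
        also have "\<dots> = (\<Sum>i\<in>I. (\<beta> * \<theta> i) * Kop g (?e i) u t)"
          unfolding Kop_def
          by (subst Bochner_Integration.integral_sum, intro integrable_mult_right Kw u, assumption)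
            (simp only: integral_mult_right_zero)
        finally show "Kop g (\<lambda>u x. \<Sum>i\<in>I. \<beta> * \<theta> i * ?e i u x) u t = (\<Sum>i\<in>I. (\<beta> * \<theta> i) * Kop g (?e i) u t)" .
      qed
      also have "\<dots> = (\<Sum>i\<in>I. \<beta> * \<theta> i * ip2 (Kop g (?e i)) \<phi>)"
        by (rule ip2_sum_left[OF fI Kw(2) \<phi>])
      finally show ?thesis .
    qed
    show "Kop g (?e i) \<in> L2set2" if "i \<in> I" for i by (rule Kw(2)[OF that])
    show "(2 * \<beta>)\<^sup>2 * ip2 (Kop g (?e i)) (Kop g (?e i)) \<le> \<epsilon>\<^sup>2" if "i \<in> I" for i
      using mult_left_mono[OF Kw(3)[OF that], of "(2 * \<beta>)\<^sup>2"] small by simp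
  qed
qed

text \<open>At level \<open>J\<close> the amplitude is
  \<open>A * b0 * 2 powr (- (J * \<tau>))\<close>, the squared operator norm is of order
  \<open>2 powr (- (J * \<delta>))\<close>, and there are \<open>2 powr (J * n)\<close> signs. The
  data are uninformative once \<open>2 powr (- (J * (2 * \<tau> + \<delta>)))\<close> is below a
  multiple of \<open>\<epsilon>\<^sup>2 / A\<^sup>2\<close>, and the risk is then of order
  \<open>2 powr (- (J * (2 * \<tau> - n)))\<close>, hence the quotient of the two exponents. The 4
  in the threshold is the square of the 2 in \<open>2 * \<beta>\<close>.\<close>

lemma minimax_rate:
  fixes jx ju :: "nat \<Rightarrow> int" and I :: "nat \<Rightarrow> (int \<times> int) set" and b0 D0 \<tau> \<delta> n :: real
  assumes pos: "0 < b0" "0 < D0" "0 < 2 * \<tau> + \<delta>" "0 \<le> 2 * \<tau> - n"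
    and lev: "\<And>J. J0 \<le> J \<Longrightarrow> m0 \<le> jx J" "\<And>J. J0 \<le> J \<Longrightarrow> m0' \<le> ju J"
    and I: "\<And>J. J0 \<le> J \<Longrightarrow> I J \<subseteq> kset m0 (jx J) \<times> kset m0' (ju J)" "\<And>J. J0 \<le> J \<Longrightarrow> I J \<noteq> {}"
    and card: "\<And>J. J0 \<le> J \<Longrightarrow> real (card (I J)) = 2 powr (real J * n)"
    and amp: "\<And>J. J0 \<le> J \<Longrightarrow> 2 powr (- (real_of_int (jx J) * (s1 + 1/2 - invp p) + real_of_int (ju J) * (s2 + 1/2 - invp p)))
      * real (card (I J)) powr (- invp p) = b0 * 2 powr (- (real J * \<tau>))"
    and op: "\<And>J. J0 \<le> J \<Longrightarrow> operator_bound (jx J) \<le> D0 * 2 powr (- (real J * \<delta>))"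
  shows "\<exists>C>0. \<forall>\<^sub>F \<epsilon> in at_right 0. ennreal (C * A\<^sup>2 * (\<epsilon>\<^sup>2 / A\<^sup>2) powr ((2 * \<tau> - n) / (2 * \<tau> + \<delta>)))
    \<le> minimax_risk M W g \<epsilon> (besov_ball B m0 H m0' s1 s2 p q A)"
proof (rule rate_from_levels[where \<kappa> = "4 * b0\<^sup>2 * D0" and c = "std_normal_density 2 * b0\<^sup>2" and ?J0.0 = J0])
  show "0 < 2 * \<tau> + \<delta>" "0 \<le> 2 * \<tau> - n" "0 < A" by (fact pos A)+
  show "0 < 4 * b0\<^sup>2 * D0" "0 < std_normal_density 2 * b0\<^sup>2" using pos by (simp_all add: normal_density_pos)
  fix \<epsilon> :: real and J assume eps: "0 < \<epsilon>" and J: "J0 \<le> J"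
    and small: "4 * b0\<^sup>2 * D0 * 2 powr (- (real J * (2 * \<tau> + \<delta>))) \<le> \<epsilon>\<^sup>2 / A\<^sup>2"
  define \<beta> where "\<beta> = A * 2 powr (- (real_of_int (jx J) * (s1 + 1/2 - invp p) + real_of_int (ju J) * (s2 + 1/2 - invp p)))
      * real (card (I J)) powr (- invp p)"
  have \<beta>: "\<beta> = A * (b0 * 2 powr (- (real J * \<tau>)))"
    unfolding \<beta>_def mult.assoc amp[OF J] ..
  have sq: "\<beta>\<^sup>2 = A\<^sup>2 * b0\<^sup>2 * 2 powr (- (real J * (2 * \<tau>)))"
    by (simp add: \<beta> power_mult_distrib power2_eq_square[of "_ powr _"] mult_ac flip: powr_add)
  have "(2 * \<beta>)\<^sup>2 * operator_bound (jx J) \<le> (2 * \<beta>)\<^sup>2 * (D0 * 2 powr (- (real J * \<delta>)))"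
    by (intro mult_left_mono op J) simp
  also have "\<dots> = A\<^sup>2 * (4 * b0\<^sup>2 * D0 * (2 powr (- (real J * (2 * \<tau>))) * 2 powr (- (real J * \<delta>))))"
    by (simp add: power_mult_distrib sq mult_ac)
  also have "2 powr (- (real J * (2 * \<tau>))) * 2 powr (- (real J * \<delta>)) = 2 powr (- (real J * (2 * \<tau> + \<delta>)))"
    by (simp add: distrib_left flip: powr_add)
  also have "A\<^sup>2 * (4 * b0\<^sup>2 * D0 * 2 powr (- (real J * (2 * \<tau> + \<delta>)))) \<le> A\<^sup>2 * (\<epsilon>\<^sup>2 / A\<^sup>2)"
    by (intro mult_left_mono small) simp
  also have "\<dots> = \<epsilon>\<^sup>2" using A by simp
  finally have "ennreal (std_normal_density 2 * real (card (I J)) * \<beta>\<^sup>2)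
      \<le> minimax_risk M W g \<epsilon> (besov_ball B m0 H m0' s1 s2 p q A)"
    by (intro minimax_lower_bound_at_levels[OF lev(1)[OF J] lev(2)[OF J] I(1)[OF J] I(2)[OF J] \<beta>_def eps])
  moreover have "std_normal_density 2 * real (card (I J)) * \<beta>\<^sup>2
      = std_normal_density 2 * b0\<^sup>2 * A\<^sup>2 * (2 powr (real J * n) * 2 powr (- (real J * (2 * \<tau>))))"
    unfolding card[OF J] sq by (simp only: mult_ac)
  moreover have "2 powr (real J * n) * 2 powr (- (real J * (2 * \<tau>))) = 2 powr (- (real J * (2 * \<tau> - n)))"
    by (simp add: right_diff_distrib flip: powr_add)
  ultimately show "ennreal (std_normal_density 2 * b0\<^sup>2 * A\<^sup>2 * 2 powr (- (real J * (2 * \<tau> - n))))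
      \<le> minimax_risk M W g \<epsilon> (besov_ball B m0 H m0' s1 s2 p q A)" by simp
qed

section \<open>The three exponents\<close>

lemma operator_bound_nat: "operator_bound (int J) = (C2 * 3 powr (2 * \<nu>)) * 2 powr (- (real J * (2 * \<nu>)))"
proof -
  have "((2 :: real) ^ J / 3) powr (- 2 * \<nu>) = (2 powr real J) powr (- 2 * \<nu>) / 3 powr (- 2 * \<nu>)"
    by (simp add: powr_divide powr_realpow)
  also have "\<dots> = 2 powr (- (real J * (2 * \<nu>))) * 3 powr (2 * \<nu>)"
    by (simp add: powr_powr powr_minus field_simps)
  finally show ?thesis by (simp add: operator_bound_def mult_ac)
qed

lemma card_kset_powr:
  assumes "0 \<le> m" "m \<le> int J"
  shows "real (card (kset m (int J))) = 2 powr (real J * 1)"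
  using card_kset[OF assms] by (simp add: powr_realpow)

text \<open>The level in \<open>x\<close> stays at \<open>m0\<close>, so the operator norm is
  bounded by a constant and \<open>\<delta> = 0\<close>. Using all \<open>2 ^ J\<close> shifts in
  \<open>u\<close> gives \<open>n = 1\<close>, and the power of the cardinality cancels
  \<open>invp p\<close> in the Besov weight, leaving \<open>\<tau> = s2 + 1/2\<close>.\<close>

lemma dense_u_rate:
  "\<exists>C>0. \<forall>\<^sub>F \<epsilon> in at_right 0. ennreal (C * A\<^sup>2 * (\<epsilon>\<^sup>2 / A\<^sup>2) powr (2 * s2 / (2 * s2 + 1)))
    \<le> minimax_risk M W g \<epsilon> (besov_ball B m0 H m0' s1 s2 p q A)"
proof -
  let ?b = "2 powr (- (real_of_int m0 * (s1 + 1/2 - invp p)))"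
  let ?I = "\<lambda>J. {0} \<times> kset m0' (int J)"
  have c: "real (card (?I J)) = 2 powr (real J * 1)" if "nat m0' \<le> J" for J
    using card_kset_powr[OF m0_nonneg(2), of J] that by (simp add: card_cartesian_product)
  have "\<exists>C>0. \<forall>\<^sub>F \<epsilon> in at_right 0. ennreal (C * A\<^sup>2 * (\<epsilon>\<^sup>2 / A\<^sup>2) powr ((2 * (s2 + 1/2) - 1) / (2 * (s2 + 1/2) + 0)))
    \<le> minimax_risk M W g \<epsilon> (besov_ball B m0 H m0' s1 s2 p q A)"
  proof (rule minimax_rate[where jx = "\<lambda>_. m0" and ju = int and ?J0.0 = "nat m0'" and I = ?I and ?b0.0 = ?b and ?D0.0 = "operator_bound m0"])
    show "0 < operator_bound m0" using C1 C2 by (simp add: operator_bound_def)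
    show "real (card (?I J)) = 2 powr (real J * 1)" if "nat m0' \<le> J" for J by (rule c[OF that])
    show "2 powr (- (real_of_int m0 * (s1 + 1/2 - invp p) + real_of_int (int J) * (s2 + 1/2 - invp p)))
      * real (card (?I J)) powr (- invp p) = ?b * 2 powr (- (real J * (s2 + 1/2)))" if "nat m0' \<le> J" for J
      unfolding c[OF that] by (simp add: powr_powr algebra_simps flip: powr_add)
  qed (use s2 in \<open>auto simp: zero_in_kset kset_nonempty nat_le_iff\<close>)
  then show ?thesis by (simp add: distrib_left)
qed

text \<open>\<open>invp p\<close> cancels as in the other dense case, now with
  \<open>\<tau> = s1 + 1/2\<close> and \<open>n = 1\<close>. The frequencies grow with the level, so
  the smoothing of the operator contributes \<open>\<delta> = 2 * \<nu>\<close>.\<close>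

lemma dense_x_rate:
  "\<exists>C>0. \<forall>\<^sub>F \<epsilon> in at_right 0. ennreal (C * A\<^sup>2 * (\<epsilon>\<^sup>2 / A\<^sup>2) powr (2 * s1 / (2 * s1 + 2 * \<nu> + 1)))
    \<le> minimax_risk M W g \<epsilon> (besov_ball B m0 H m0' s1 s2 p q A)"
proof -
  let ?b = "2 powr (- (real_of_int m0' * (s2 + 1/2 - invp p)))"
  let ?I = "\<lambda>J. kset m0 (int J) \<times> {0}"
  have c: "real (card (?I J)) = 2 powr (real J * 1)" if "nat m0 \<le> J" for J
    using card_kset_powr[OF m0_nonneg(1), of J] that by (simp add: card_cartesian_product)
  have "\<exists>C>0. \<forall>\<^sub>F \<epsilon> in at_right 0. ennreal (C * A\<^sup>2 * (\<epsilon>\<^sup>2 / A\<^sup>2) powr ((2 * (s1 + 1/2) - 1) / (2 * (s1 + 1/2) + 2 * \<nu>)))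
    \<le> minimax_risk M W g \<epsilon> (besov_ball B m0 H m0' s1 s2 p q A)"
  proof (rule minimax_rate[where jx = int and ju = "\<lambda>_. m0'" and ?J0.0 = "nat m0" and I = ?I and ?b0.0 = ?b and ?D0.0 = "C2 * 3 powr (2 * \<nu>)"])
    show "0 < C2 * 3 powr (2 * \<nu>)" using C1 C2 by simp
    show "real (card (?I J)) = 2 powr (real J * 1)" if "nat m0 \<le> J" for J by (rule c[OF that])
    show "2 powr (- (real_of_int (int J) * (s1 + 1/2 - invp p) + real_of_int m0' * (s2 + 1/2 - invp p)))
      * real (card (?I J)) powr (- invp p) = ?b * 2 powr (- (real J * (s1 + 1/2)))" if "nat m0 \<le> J" for J
      unfolding c[OF that] by (simp add: powr_powr algebra_simps flip: powr_add)
    show "operator_bound (int J) \<le> C2 * 3 powr (2 * \<nu>) * 2 powr (- (real J * (2 * \<nu>)))" for J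
      by (simp only: operator_bound_nat order_refl)
  qed (use s1 \<nu> in \<open>auto simp: zero_in_kset kset_nonempty nat_le_iff\<close>)
  then show ?thesis by (simp add: distrib_left add_ac)
qed

text \<open>With a single index \<open>n = 0\<close> and nothing compensates \<open>invp p\<close>,
  so \<open>\<tau> = s1 + 1/2 - invp p\<close>, which is positive because \<open>smooth\<close>
  makes \<open>s1\<close> at least \<open>invp p\<close>.\<close>

lemma sparse_rate:
  "\<exists>C>0. \<forall>\<^sub>F \<epsilon> in at_right 0. ennreal (C * A\<^sup>2 * (\<epsilon>\<^sup>2 / A\<^sup>2) powr
      (2 * (s1 + 1/2 - invp p) / (2 * (s1 + 1/2 - invp p) + 2 * \<nu>)))
    \<le> minimax_risk M W g \<epsilon> (besov_ball B m0 H m0' s1 s2 p q A)"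
proof -
  let ?b = "2 powr (- (real_of_int m0' * (s2 + 1/2 - invp p)))"
  have s: "s1 + 1/2 - invp p > 0" using smooth by auto
  have "\<exists>C>0. \<forall>\<^sub>F \<epsilon> in at_right 0. ennreal (C * A\<^sup>2 * (\<epsilon>\<^sup>2 / A\<^sup>2) powr ((2 * (s1 + 1/2 - invp p) - 0) / (2 * (s1 + 1/2 - invp p) + 2 * \<nu>)))
    \<le> minimax_risk M W g \<epsilon> (besov_ball B m0 H m0' s1 s2 p q A)"
  proof (rule minimax_rate[where jx = int and ju = "\<lambda>_. m0'" and ?J0.0 = "nat m0" and I = "\<lambda>_. {(0, 0)}" and ?b0.0 = ?b and ?D0.0 = "C2 * 3 powr (2 * \<nu>)"])
    show "0 < C2 * 3 powr (2 * \<nu>)" using C1 C2 by simp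
    show "2 powr (- (real_of_int (int J) * (s1 + 1/2 - invp p) + real_of_int m0' * (s2 + 1/2 - invp p)))
      * real (card {(0 :: int, 0 :: int)}) powr (- invp p) = ?b * 2 powr (- (real J * (s1 + 1/2 - invp p)))" for J
      by (simp add: algebra_simps flip: powr_add)
    show "operator_bound (int J) \<le> C2 * 3 powr (2 * \<nu>) * 2 powr (- (real J * (2 * \<nu>)))" for J
      by (simp only: operator_bound_nat order_refl)
    show "0 < 2 * (s1 + 1/2 - invp p) + 2 * \<nu>" "0 \<le> 2 * (s1 + 1/2 - invp p) - 0" using s \<nu> by auto
  qed (auto simp: zero_in_kset nat_le_iff)
  then show ?thesis by simp
qed

theorem minimax_lower_bound:
  "\<exists>C>0. \<forall>\<^sub>F \<epsilon> in at_right 0.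
     minimax_risk M W g \<epsilon> (besov_ball B m0 H m0' s1 s2 p q A)
       \<ge> ennreal (C * A\<^sup>2 * (\<epsilon>\<^sup>2 / A\<^sup>2) powr
            (let s1' = s1 + 1/2 - max (invp p) (1/2) in
             min (2 * s2 / (2 * s2 + 1))
                 (min (2 * s1 / (2 * s1 + 2 * \<nu> + 1)) (2 * s1' / (2 * s1' + 2 * \<nu>)))))"
proof -
  define s1' where "s1' = s1 + 1/2 - max (invp p) (1/2)"
  let ?d1 = "2 * s2 / (2 * s2 + 1)" and ?d2 = "2 * s1 / (2 * s1 + 2 * \<nu> + 1)" and ?d3 = "2 * s1' / (2 * s1' + 2 * \<nu>)"
  \<comment> \<open>The strict inequality in the third case is what later excludes \<open>p\<close>
    above 2 there.\<close>
  have min3: "min a (min b c) = a \<or> min a (min b c) = b \<or> min a (min b c) = c \<and> c < b" for a b c :: real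
    by (simp add: min_def)
  consider "min ?d1 (min ?d2 ?d3) = ?d1" | "min ?d1 (min ?d2 ?d3) = ?d2" | "min ?d1 (min ?d2 ?d3) = ?d3" "?d3 < ?d2"
    using min3[of ?d1 ?d2 ?d3] by blast
  then show ?thesis
  proof cases
    case 1
    show ?thesis unfolding Let_def s1'_def[symmetric] 1 by (rule dense_u_rate)
  next
    case 2
    show ?thesis unfolding Let_def s1'_def[symmetric] 2 by (rule dense_x_rate)
  next
    case 3
    \<comment> \<open>The sparse family produces the third exponent only if \<open>invp p\<close>
      attains the maximum in \<open>s1'\<close>. Otherwise \<open>s1' = s1\<close>, and the third
      exponent, whose denominator is then smaller by 1, is at least the second one.\<close>
    have "invp p \<ge> 1/2"
    proof (rule ccontr)
      assume "\<not> invp p \<ge> 1/2"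
      then have s: "s1' = s1" by (simp add: s1'_def)
      have "?d2 \<le> ?d3" unfolding s using s1 \<nu> by (intro divide_left_mono) auto
      with 3(2) show False by simp
    qed
    then have "s1' = s1 + 1/2 - invp p" by (simp add: s1'_def)
    then show ?thesis unfolding Let_def s1'_def[symmetric] 3(1) using sparse_rate by simp
  qed
qed

end

theorem theorem1:
  fixes s1 s2 A \<nu> C1 C2 :: real and p q :: ennreal
    and m0 m0' :: int and s0 :: nat
    and B H :: "int \<Rightarrow> int \<Rightarrow> real \<Rightarrow> real"
    and g :: "real \<Rightarrow> real \<Rightarrow> real"
    and M :: "'a measure" and W :: "'a \<Rightarrow> (real \<Rightarrow> real \<Rightarrow> real) \<Rightarrow> real"
  assumes "s1 > 0" and "s2 > 0" and "1 \<le> p" and "1 \<le> q"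
    and "min s1 s2 \<ge> max (invp p) (1/2)"
    and "A > 0"
    and "meyer_basis m0 B" and "daub_basis s0 m0' H"
    and "white_noise M W"
    and "case_prod g \<in> borel_measurable borel"
    and "\<forall>u t. g u (t + 1) = g u t"
    and "\<forall>u\<in>{0..1}. set_integrable lborel {0..1} (g u)"
    and "\<nu> > 0" and "0 < C1" and "C1 \<le> C2"
    and "\<forall>m::int. m \<noteq> 0 \<longrightarrow> (\<forall>u\<in>{0..1}.
           C1 * \<bar>real_of_int m\<bar> powr (- 2 * \<nu>) \<le> (cmod (gcoef g m u))\<^sup>2 \<and>
           (cmod (gcoef g m u))\<^sup>2 \<le> C2 * \<bar>real_of_int m\<bar> powr (- 2 * \<nu>))"
  shows "\<exists>C>0. \<forall>\<^sub>F \<epsilon> in at_right 0.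
           minimax_risk M W g \<epsilon> (besov_ball B m0 H m0' s1 s2 p q A)
             \<ge> ennreal (C * A\<^sup>2 * (\<epsilon>\<^sup>2 / A\<^sup>2) powr
                  (let s1' = s1 + 1/2 - max (invp p) (1/2) in
                   min (2 * s2 / (2 * s2 + 1))
                       (min (2 * s1 / (2 * s1 + 2 * \<nu> + 1)) (2 * s1' / (2 * s1' + 2 * \<nu>)))))"
  by (rule functional_deconvolution.minimax_lower_bound[OF functional_deconvolution.intro[OF assms]])

end
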